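(* There is a metric language $L'$ (effectively numbered, with uniformly computable moduli of uniform continuity) and a computably presentable $L'$-structure $\mathcal{M}$ with the following properties: (1) The closed quantifier-free diagram of $\mathcal{M}$ is $\Pi^0_1$-complete, and the open quantifier-free diagram of $\mathcal{M}$ is $\Sigma^0_1$-complete. (2) For every positive integer $N$, the closed $\Pi_N$ diagram of $\mathcal{M}$ is $\Pi^0_N$-complete, and the open $\Pi_N$ diagram of $\mathcal{M}$ is $\Sigma^0_{N+1}$-complete. (3) For every positive integer $N$, the closed $\Sigma_N$ diagram of $\mathcal{M}$ is $\Pi^0_{N+1}$-complete, and the open $\Sigma_N$ diagram of $\mathcal{M}$ is $\Sigma^0_N$-complete.
   Context: We work in continuous first-order logic: formulas take truth values in $[0,1]$ (with $0$ meaning "true"), the connectives are $\neg$ ($x\mapsto 1-x$), $\frac12$ ($x\mapsto x/2$) and truncated subtraction $\dot{-}$, and the quantifiers are $\sup_x$ and $\inf_x$. Quantifier-free formulas are $\Sigma_0=\Pi_0$; for $N\ge1$ a $\Pi_N$ formula is $\sup_{\bar x}\psi$ with $\psi$ a $\Sigma_{N-1}$ formula and a $\Sigma_N$ formula is $\inf_{\bar x}\psi$ with $\psi$ a $\Pi_{N-1}$ formula. For a sentence $\phi$, $\phi^{\mathcal{M}}\in[0,1]$ is its value. A presentation of $\mathcal{M}$ is a pair $(\mathcal{M},g)$, $g:\mathbb{N}\to|\mathcal{M}|$, such that the closure of $\operatorname{ran}(g)$ under the functions of $\mathcal{M}$ (the rational points) is dense; it is computable if the predicates of $\mathcal{M}$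 (including the metric) are uniformly computable on the rational points. $\mathcal{M}$ is computably presentable if it has a computable presentation. The closed (resp. open) quantifier-free / $\Pi_N$ / $\Sigma_N$ diagram of $\mathcal{M}$ is the set of pairs $(\phi,q)$ with $\phi$ a quantifier-free / $\Pi_N$ / $\Sigma_N$ sentence (without parameters), $q\in\mathbb{Q}\cap[0,1]$, and $\phi^{\mathcal{M}}\le q$ (resp. $\phi^{\mathcal{M}}<q$), viewed as sets of natural numbers via an effective coding. *)

theory Defs
  imports "HOL-Analysis.Analysis" "HOL-Library.Nat_Bijection"
begin

datatype recf =
    RZero
  | RSucc
  | RProj nat
  | RComp recf "recf list"
  | RPrim recf recf
  | RMu recf

text \<open>Graph of the partial recursive function denoted by a program. Primitive recursion and
  minimization act on the first argument; \<^term>\<open>RMu f\<close> requires \<^term>\<open>f\<close> to be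
  defined (and nonzero) at every argument below the zero it returns.\<close>

inductive reval :: "recf \<Rightarrow> nat list \<Rightarrow> nat \<Rightarrow> bool" where
  zero: "reval RZero xs 0"
| succ: "reval RSucc [x] (Suc x)"
| proj: "i < length xs \<Longrightarrow> reval (RProj i) xs (xs ! i)"
| comp: "list_all2 (\<lambda>g y. reval g xs y) gs ys \<Longrightarrow> reval f ys z \<Longrightarrow> reval (RComp f gs) xs z"
| prim_0: "reval f xs z \<Longrightarrow> reval (RPrim f g) (0 # xs) z"
| prim_Suc: "reval (RPrim f g) (n # xs) y \<Longrightarrow> reval g (n # y # xs) z \<Longrightarrow>
    reval (RPrim f g) (Suc n # xs) z"
| mu: "reval f (n # xs) 0 \<Longrightarrow> (\<And>m. m < n \<Longrightarrow> \<exists>k>0. reval f (m # xs) k) \<Longrightarrow>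
    reval (RMu f) xs n"

text \<open>Total computable functions of \<open>n\<close> arguments; values at lists of other lengths are
  irrelevant.\<close>

definition computable :: "nat \<Rightarrow> (nat list \<Rightarrow> nat) \<Rightarrow> bool" where
  "computable n F \<longleftrightarrow> (\<exists>r. \<forall>xs. length xs = n \<longrightarrow> reval r xs (F xs))"

definition computable_set :: "nat set \<Rightarrow> bool" where
  "computable_set A \<longleftrightarrow> computable 1 (\<lambda>xs. if xs ! 0 \<in> A then 1 else 0)"

fun Sigma0 :: "nat \<Rightarrow> nat set set" and Pi0 :: "nat \<Rightarrow> nat set set" where
  "Sigma0 0 = {A. computable_set A}"
| "Pi0 0 = {A. computable_set A}"
| "Sigma0 (Suc n) = {{x. \<exists>y. prod_encode (x, y) \<in> B} | B. B \<in> Pi0 n}"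
| "Pi0 (Suc n) = {{x. \<forall>y. prod_encode (x, y) \<in> B} | B. B \<in> Sigma0 n}"

definition many_one_reducible :: "nat set \<Rightarrow> nat set \<Rightarrow> bool" where
  "many_one_reducible A B \<longleftrightarrow> (\<exists>F. computable 1 F \<and> (\<forall>x. x \<in> A \<longleftrightarrow> F [x] \<in> B))"

definition complete_for :: "nat set set \<Rightarrow> nat set \<Rightarrow> bool" where
  "complete_for \<Gamma> A \<longleftrightarrow> A \<in> \<Gamma> \<and> (\<forall>B\<in>\<Gamma>. many_one_reducible B A)"

text \<open>Symbols are natural numbers; constant symbols are the function symbols of arity 0. The
  metric is a logical symbol and is not listed among the predicate symbols. A modulus of uniform
  continuity is a function \<open>\<Delta>\<close> on the natural numbers, where \<open>\<Delta> k\<close> stands for the bound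
  \<open>2\<^sup>-\<^sup>\<Delta>\<^sup>k\<close> that goes with the precision \<open>2\<^sup>-\<^sup>k\<close>.\<close>

record metric_lang =
  fun_syms :: "nat set"
  fun_arity :: "nat \<Rightarrow> nat"
  fun_modulus :: "nat \<Rightarrow> nat \<Rightarrow> nat"
  pred_syms :: "nat set"
  pred_arity :: "nat \<Rightarrow> nat"
  pred_modulus :: "nat \<Rightarrow> nat \<Rightarrow> nat"

definition metric_language :: "metric_lang \<Rightarrow> bool" where
  "metric_language L \<longleftrightarrow> (\<forall>P\<in>pred_syms L. pred_arity L P > 0)"

definition effectively_numbered :: "metric_lang \<Rightarrow> bool" where
  "effectively_numbered L \<longleftrightarrow>
     computable_set (fun_syms L) \<and> computable 1 (\<lambda>xs. fun_arity L (xs ! 0)) \<and>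
     computable_set (pred_syms L) \<and> computable 1 (\<lambda>xs. pred_arity L (xs ! 0))"

definition uniformly_computable_moduli :: "metric_lang \<Rightarrow> bool" where
  "uniformly_computable_moduli L \<longleftrightarrow>
     computable 2 (\<lambda>xs. fun_modulus L (xs ! 0) (xs ! 1)) \<and>
     computable 2 (\<lambda>xs. pred_modulus L (xs ! 0) (xs ! 1))"

datatype mterm = Var nat | App nat "mterm list"

datatype mformula =
    DistF mterm mterm
  | PredF nat "mterm list"
  | NegF mformula
  | HalfF mformula
  | MinusF mformula mformula
  | SupF nat mformula
  | InfF nat mformula

primrec wf_term :: "metric_lang \<Rightarrow> mterm \<Rightarrow> bool" where
  "wf_term L (Var i) \<longleftrightarrow> True"
| "wf_term L (App f ts) \<longleftrightarrow>
     f \<in> fun_syms L \<and> length ts = fun_arity L f \<and> list_all id (map (wf_term L) ts)"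

primrec wf_formula :: "metric_lang \<Rightarrow> mformula \<Rightarrow> bool" where
  "wf_formula L (DistF s t) \<longleftrightarrow> wf_term L s \<and> wf_term L t"
| "wf_formula L (PredF P ts) \<longleftrightarrow>
     P \<in> pred_syms L \<and> length ts = pred_arity L P \<and> list_all (wf_term L) ts"
| "wf_formula L (NegF \<phi>) \<longleftrightarrow> wf_formula L \<phi>"
| "wf_formula L (HalfF \<phi>) \<longleftrightarrow> wf_formula L \<phi>"
| "wf_formula L (MinusF \<phi> \<psi>) \<longleftrightarrow> wf_formula L \<phi> \<and> wf_formula L \<psi>"
| "wf_formula L (SupF x \<phi>) \<longleftrightarrow> wf_formula L \<phi>"
| "wf_formula L (InfF x \<phi>) \<longleftrightarrow> wf_formula L \<phi>"

primrec term_vars :: "mterm \<Rightarrow> nat set" where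
  "term_vars (Var i) = {i}"
| "term_vars (App f ts) = \<Union>(set (map term_vars ts))"

primrec free_vars :: "mformula \<Rightarrow> nat set" where
  "free_vars (DistF s t) = term_vars s \<union> term_vars t"
| "free_vars (PredF P ts) = \<Union>(set (map term_vars ts))"
| "free_vars (NegF \<phi>) = free_vars \<phi>"
| "free_vars (HalfF \<phi>) = free_vars \<phi>"
| "free_vars (MinusF \<phi> \<psi>) = free_vars \<phi> \<union> free_vars \<psi>"
| "free_vars (SupF x \<phi>) = free_vars \<phi> - {x}"
| "free_vars (InfF x \<phi>) = free_vars \<phi> - {x}"

definition sentence :: "metric_lang \<Rightarrow> mformula \<Rightarrow> bool" where
  "sentence L \<phi> \<longleftrightarrow> wf_formula L \<phi> \<and> free_vars \<phi> = {}"

primrec atomic :: "mformula \<Rightarrow> bool" where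
  "atomic (DistF s t) \<longleftrightarrow> True"
| "atomic (PredF P ts) \<longleftrightarrow> True"
| "atomic (NegF \<phi>) \<longleftrightarrow> False"
| "atomic (HalfF \<phi>) \<longleftrightarrow> False"
| "atomic (MinusF \<phi> \<psi>) \<longleftrightarrow> False"
| "atomic (SupF x \<phi>) \<longleftrightarrow> False"
| "atomic (InfF x \<phi>) \<longleftrightarrow> False"

primrec quantifier_free :: "mformula \<Rightarrow> bool" where
  "quantifier_free (DistF s t) \<longleftrightarrow> True"
| "quantifier_free (PredF P ts) \<longleftrightarrow> True"
| "quantifier_free (NegF \<phi>) \<longleftrightarrow> quantifier_free \<phi>"
| "quantifier_free (HalfF \<phi>) \<longleftrightarrow> quantifier_free \<phi>"
| "quantifier_free (MinusF \<phi> \<psi>) \<longleftrightarrow> quantifier_free \<phi> \<and> quantifier_free \<psi>"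
| "quantifier_free (SupF x \<phi>) \<longleftrightarrow> False"
| "quantifier_free (InfF x \<phi>) \<longleftrightarrow> False"

text \<open>A block of quantifiers is given by a finite tuple of variables, which may be empty.\<close>

fun Sigma_formula :: "nat \<Rightarrow> mformula \<Rightarrow> bool" and Pi_formula :: "nat \<Rightarrow> mformula \<Rightarrow> bool" where
  "Sigma_formula 0 \<phi> \<longleftrightarrow> quantifier_free \<phi>"
| "Pi_formula 0 \<phi> \<longleftrightarrow> quantifier_free \<phi>"
| "Sigma_formula (Suc N) \<phi> \<longleftrightarrow> (\<exists>xs \<psi>. \<phi> = foldr InfF xs \<psi> \<and> Pi_formula N \<psi>)"
| "Pi_formula (Suc N) \<phi> \<longleftrightarrow> (\<exists>xs \<psi>. \<phi> = foldr SupF xs \<psi> \<and> Sigma_formula N \<psi>)"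

text \<open>A computably presentable structure is separable, so its universe has at most the
  cardinality of the reals: an existence claim about such structures loses nothing by taking the
  universe to be a set of reals, with an arbitrary metric on it.\<close>

record 'a metric_struct =
  universe :: "'a set"
  metric :: "'a \<Rightarrow> 'a \<Rightarrow> real"
  fun_interp :: "nat \<Rightarrow> 'a list \<Rightarrow> 'a"
  pred_interp :: "nat \<Rightarrow> 'a list \<Rightarrow> real"

definition metric_structure :: "metric_lang \<Rightarrow> 'a metric_struct \<Rightarrow> bool" where
  "metric_structure L M \<longleftrightarrow>
     universe M \<noteq> {} \<and>
     Metric_space (universe M) (metric M) \<and>
     Metric_space.mcomplete (universe M) (metric M) \<and>
     (\<forall>x\<in>universe M. \<forall>y\<in>universe M. metric M x y \<le> 1) \<and>
     (\<forall>f\<in>fun_syms L. \<forall>xs\<in>lists (universe M). length xs = fun_arity L f \<longrightarrow>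
        fun_interp M f xs \<in> universe M) \<and>
     (\<forall>P\<in>pred_syms L. \<forall>xs\<in>lists (universe M). length xs = pred_arity L P \<longrightarrow>
        pred_interp M P xs \<in> {0..1}) \<and>
     (\<forall>f\<in>fun_syms L. \<forall>xs\<in>lists (universe M). \<forall>ys\<in>lists (universe M). \<forall>k.
        length xs = fun_arity L f \<and> length ys = fun_arity L f \<and>
        (\<forall>i<fun_arity L f. metric M (xs ! i) (ys ! i) < 1 / 2 ^ fun_modulus L f k) \<longrightarrow>
        metric M (fun_interp M f xs) (fun_interp M f ys) \<le> 1 / 2 ^ k) \<and>
     (\<forall>P\<in>pred_syms L. \<forall>xs\<in>lists (universe M). \<forall>ys\<in>lists (universe M). \<forall>k.
        length xs = pred_arity L P \<and> length ys = pred_arity L P \<and>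
        (\<forall>i<pred_arity L P. metric M (xs ! i) (ys ! i) < 1 / 2 ^ pred_modulus L P k) \<longrightarrow>
        \<bar>pred_interp M P xs - pred_interp M P ys\<bar> \<le> 1 / 2 ^ k)"

primrec term_value :: "'a metric_struct \<Rightarrow> (nat \<Rightarrow> 'a) \<Rightarrow> mterm \<Rightarrow> 'a" where
  "term_value M e (Var i) = e i"
| "term_value M e (App f ts) = fun_interp M f (map (term_value M e) ts)"

primrec formula_value :: "'a metric_struct \<Rightarrow> (nat \<Rightarrow> 'a) \<Rightarrow> mformula \<Rightarrow> real" where
  "formula_value M e (DistF s t) = metric M (term_value M e s) (term_value M e t)"
| "formula_value M e (PredF P ts) = pred_interp M P (map (term_value M e) ts)"
| "formula_value M e (NegF \<phi>) = 1 - formula_value M e \<phi>"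
| "formula_value M e (HalfF \<phi>) = formula_value M e \<phi> / 2"
| "formula_value M e (MinusF \<phi> \<psi>) = max 0 (formula_value M e \<phi> - formula_value M e \<psi>)"
| "formula_value M e (SupF x \<phi>) = (SUP a\<in>universe M. formula_value M (e(x := a)) \<phi>)"
| "formula_value M e (InfF x \<phi>) = (INF a\<in>universe M. formula_value M (e(x := a)) \<phi>)"

text \<open>The value of a sentence does not depend on the assignment chosen here.\<close>

definition sentence_value :: "'a metric_struct \<Rightarrow> mformula \<Rightarrow> real" where
  "sentence_value M \<phi> = formula_value M (\<lambda>_. SOME a. a \<in> universe M) \<phi>"

primrec term_code :: "mterm \<Rightarrow> nat" where
  "term_code (Var i) = prod_encode (0, i)"
| "term_code (App f ts) = prod_encode (1, prod_encode (f, list_encode (map term_code ts)))"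

primrec formula_code :: "mformula \<Rightarrow> nat" where
  "formula_code (DistF s t) = prod_encode (0, prod_encode (term_code s, term_code t))"
| "formula_code (PredF P ts) = prod_encode (1, prod_encode (P, list_encode (map term_code ts)))"
| "formula_code (NegF \<phi>) = prod_encode (2, formula_code \<phi>)"
| "formula_code (HalfF \<phi>) = prod_encode (3, formula_code \<phi>)"
| "formula_code (MinusF \<phi> \<psi>) = prod_encode (4, prod_encode (formula_code \<phi>, formula_code \<psi>))"
| "formula_code (SupF x \<phi>) = prod_encode (5, prod_encode (x, formula_code \<phi>))"
| "formula_code (InfF x \<phi>) = prod_encode (6, prod_encode (x, formula_code \<phi>))"

text \<open>Meant for nonnegative rationals only: numerator and denominator in lowest terms.\<close>

definition rat_code :: "rat \<Rightarrow> nat" where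
  "rat_code q = prod_encode (nat (fst (quotient_of q)), nat (snd (quotient_of q)))"

inductive_set rational_points :: "metric_lang \<Rightarrow> 'a metric_struct \<Rightarrow> (nat \<Rightarrow> 'a) \<Rightarrow> 'a set"
  for L M g where
  gen: "g i \<in> rational_points L M g"
| app: "f \<in> fun_syms L \<Longrightarrow> length xs = fun_arity L f \<Longrightarrow>
    (\<And>x. x \<in> set xs \<Longrightarrow> x \<in> rational_points L M g) \<Longrightarrow>
    fun_interp M f xs \<in> rational_points L M g"

definition presentation :: "metric_lang \<Rightarrow> 'a metric_struct \<Rightarrow> (nat \<Rightarrow> 'a) \<Rightarrow> bool" where
  "presentation L M g \<longleftrightarrow>
     range g \<subseteq> universe M \<and>
     Metric_space.mtopology (universe M) (metric M) closure_of rational_points L M g = universe M"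

text \<open>Rational points are named by terms in which the variable \<open>i\<close> denotes the generator
  \<open>g i\<close>. Hence a predicate (or the metric) together with a tuple of names of rational points is
  an atomic formula, and its value is the value of that formula under the assignment \<open>g\<close>.\<close>

definition computable_presentation ::
    "metric_lang \<Rightarrow> 'a metric_struct \<Rightarrow> (nat \<Rightarrow> 'a) \<Rightarrow> bool" where
  "computable_presentation L M g \<longleftrightarrow>
     presentation L M g \<and>
     (\<exists>F. computable 2 F \<and>
        (\<forall>\<phi> k. atomic \<phi> \<and> wf_formula L \<phi> \<longrightarrow>
           (\<exists>q::rat. q \<ge> 0 \<and> F [formula_code \<phi>, k] = rat_code q \<and>
              \<bar>formula_value M g \<phi> - of_rat q\<bar> < 1 / 2 ^ k)))"

definition computably_presentable :: "metric_lang \<Rightarrow> 'a metric_struct \<Rightarrow> bool" where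
  "computably_presentable L M \<longleftrightarrow> (\<exists>g. computable_presentation L M g)"

definition closed_diagram :: "metric_lang \<Rightarrow> 'a metric_struct \<Rightarrow> (mformula \<Rightarrow> bool) \<Rightarrow> nat set" where
  "closed_diagram L M C =
     {prod_encode (formula_code \<phi>, rat_code q) | \<phi> q.
        sentence L \<phi> \<and> C \<phi> \<and> 0 \<le> q \<and> q \<le> 1 \<and> sentence_value M \<phi> \<le> of_rat q}"

definition open_diagram :: "metric_lang \<Rightarrow> 'a metric_struct \<Rightarrow> (mformula \<Rightarrow> bool) \<Rightarrow> nat set" where
  "open_diagram L M C =
     {prod_encode (formula_code \<phi>, rat_code q) | \<phi> q.
        sentence L \<phi> \<and> C \<phi> \<and> 0 \<le> q \<and> q \<le> 1 \<and> sentence_value M \<phi> < of_rat q}"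

end

theory Submission
  imports Defs
begin

text \<open>The structure is the set of natural numbers with the discrete metric, in which every number is
  named by a constant. A predicate of each arity either compares a decidable relation on its
  arguments with a bit and returns \<open>2\<^sup>-\<^sup>k\<close> or \<open>1\<close> accordingly, where \<open>k\<close> is one of the arguments, or
  (in the unary case) returns \<open>2\<^sup>-\<^sup>d\<close>, where \<open>d\<close> is the least witness that a given program halts,
  and \<open>0\<close> if there is none. The decidable relation is Kleene's predicate, so that \<open>N\<close> alternating
  quantifiers over it, with \<open>k = 1\<close>, express an arbitrary \<open>\<Sigma>\<^sub>N\<close> or \<open>\<Pi>\<^sub>N\<close> set. Quantifying over \<open>k\<close> as
  well yields one more alternation: an infimum over \<open>k\<close> vanishes iff the relation holds for
  arbitrarily large \<open>k\<close>.

  For the upper bounds, the value of a quantifier-free formula can be approximated effectively, so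
  that both \<open>< q\<close> and \<open>> q\<close> are \<open>\<Sigma>\<^sub>1\<close>. A supremum is \<open>\<le> q\<close> iff all its instances are, and a value
  is \<open>< q\<close> iff it is \<open>\<le> q'\<close> for some rational \<open>q' < q\<close>; dually for infima.\<close>

section \<open>Computable functions and relations\<close>

text \<open>If all predicates took decidable values in a finite set, suprema and infima would be
  attained, quantifier blocks would act as plain universal or existential blocks, and no diagram
  could gain the extra alternation required of the closed \<open>Sigma_formula\<close> and open
  \<open>Pi_formula\<close> diagrams. It has to come from bounds that are approached but not
  attained, hence the values \<open>2^-k\<close> with \<open>k\<close> quantifiable. Monotonicity in
  \<open>k\<close> is obtained by truncating a matrix \<open>\<forall>y. Q\<close> to
  \<open>\<forall>y<k. Q\<close>: by collection this stays at the Sigma level of \<open>Q\<close>,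
  and the infimum over \<open>k\<close> merges with the infima that follow it, so the class of the
  formula does not rise. The unary predicate serves the quantifier-free case, where exactly
  computable values would make the diagrams decidable: \<open>halting_value\<close> can be
  approximated effectively, but its vanishing cannot be decided. The discrete metric makes
  completeness and uniform continuity automatic, so predicates may be arbitrary functions. The bit
  paired with a program compensates for the parity of the number of quantifiers, since the universal
  relations are built by iterated complementation.\<close>

named_theorems rc

lemma length_2_conv: "length xs = 2 \<longleftrightarrow> (\<exists>x y. xs = [x, y])"
  by (auto simp: numeral_2_eq_2 length_Suc_conv)

lemma computable_proj: "i < n \<Longrightarrow> computable n (\<lambda>xs. xs ! i)"
  unfolding computable_def by (metis reval.proj)

lemma computable_zero: "computable n (\<lambda>xs. 0)"
  unfolding computable_def by (metis reval.zero)

lemma computable_Suc: "computable 1 (\<lambda>xs. Suc (xs ! 0))"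
  unfolding computable_def by (auto simp: length_Suc_conv intro!: exI[of _ RSucc] reval.succ)

lemma computable_comp1:
  assumes "computable 1 (\<lambda>xs. f (xs ! 0))" "computable n G"
  shows "computable n (\<lambda>xs. f (G xs))"
proof -
  obtain r s where r: "\<And>xs. length xs = 1 \<Longrightarrow> reval r xs (f (xs ! 0))"
    and s: "\<And>xs. length xs = n \<Longrightarrow> reval s xs (G xs)"
    using assms unfolding computable_def by blast
  have "reval (RComp r [s]) xs (f (G xs))" if "length xs = n" for xs
    using s[OF that] r[of "[G xs]"] by (intro reval.comp[where ys = "[G xs]"]) auto
  then show ?thesis
    unfolding computable_def by blast
qed

lemma computable_comp2:
  assumes "computable 2 (\<lambda>xs. f (xs ! 0) (xs ! 1))" "computable n G" "computable n H"
  shows "computable n (\<lambda>xs. f (G xs) (H xs))"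
proof -
  obtain r s t where r: "\<And>xs. length xs = 2 \<Longrightarrow> reval r xs (f (xs ! 0) (xs ! 1))"
    and s: "\<And>xs. length xs = n \<Longrightarrow> reval s xs (G xs)"
    and t: "\<And>xs. length xs = n \<Longrightarrow> reval t xs (H xs)"
    using assms unfolding computable_def by blast
  have "reval (RComp r [s, t]) xs (f (G xs) (H xs))" if "length xs = n" for xs
    using s[OF that] t[OF that] r[of "[G xs, H xs]"]
    by (intro reval.comp[where ys = "[G xs, H xs]"]) auto
  then show ?thesis
    unfolding computable_def by blast
qed

text \<open>One parameter suffices: \<open>rcf_rec_nat\<close> later passes all further data through
  it in coded form.\<close>

lemma computable_prim:
  assumes "computable 1 (\<lambda>xs. a (xs ! 0))" "computable 3 (\<lambda>xs. h (xs ! 0) (xs ! 1) (xs ! 2))"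
  shows "computable 2 (\<lambda>xs. rec_nat (a (xs ! 1)) (\<lambda>n y. h n y (xs ! 1)) (xs ! 0))"
proof -
  obtain r s where r: "\<And>xs. length xs = 1 \<Longrightarrow> reval r xs (a (xs ! 0))"
    and s: "\<And>xs. length xs = 3 \<Longrightarrow> reval s xs (h (xs ! 0) (xs ! 1) (xs ! 2))"
    using assms unfolding computable_def by blast
  have "reval (RPrim r s) [n, x] (rec_nat (a x) (\<lambda>n y. h n y x) n)" for n x
  proof (induction n)
    case 0
    show ?case using r[of "[x]"] by (auto intro: reval.prim_0)
  next
    case (Suc n)
    show ?case
      using reval.prim_Suc[OF Suc] s[of "[n, rec_nat (a x) (\<lambda>n y. h n y x) n, x]"] by simp
  qed
  then show ?thesis
    unfolding computable_def by (auto simp: length_2_conv intro!: exI[of _ "RPrim r s"])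
qed

lemma computable_add: "computable 2 (\<lambda>xs. xs ! 0 + xs ! 1)"
proof -
  have "computable 3 (\<lambda>xs. Suc (xs ! 1))"
    by (rule computable_comp1[OF computable_Suc]) (simp add: computable_proj)
  from computable_prim[where a = "\<lambda>x. x" and h = "\<lambda>n y x. Suc y", OF _ this]
  have "computable 2 (\<lambda>xs. rec_nat (xs ! 1) (\<lambda>n y. Suc y) (xs ! 0))"
    by (simp add: computable_proj)
  moreover have "rec_nat (x::nat) (\<lambda>n y. Suc y) n = n + x" for n x
    by (induction n) auto
  ultimately show ?thesis by simp
qed

lemma computable_mult: "computable 2 (\<lambda>xs. xs ! 0 * xs ! 1)"
proof -
  have "computable 3 (\<lambda>xs. xs ! 1 + xs ! 2)"
    by (rule computable_comp2[where f = "(+)", OF computable_add]) (simp_all add: computable_proj)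
  from computable_prim[where a = "\<lambda>x. 0" and h = "\<lambda>n y x. y + x", OF _ this]
  have "computable 2 (\<lambda>xs. rec_nat 0 (\<lambda>n y. y + xs ! 1) (xs ! 0))"
    by (simp add: computable_zero)
  moreover have "rec_nat (0::nat) (\<lambda>n y. y + x) n = n * x" for n x
    by (induction n) auto
  ultimately show ?thesis by simp
qed

lemma computable_pred: "computable 1 (\<lambda>xs. xs ! 0 - 1)"
proof -
  have "computable 3 (\<lambda>xs. xs ! 0)"
    by (simp add: computable_proj)
  from computable_prim[where a = "\<lambda>x. 0" and h = "\<lambda>n y x. n", OF _ this]
  have "computable 2 (\<lambda>xs. rec_nat 0 (\<lambda>n y. n) (xs ! 0))"
    by (simp add: computable_zero)
  moreover have "rec_nat 0 (\<lambda>n y. n) m = m - 1" for m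
    by (cases m) auto
  ultimately have c: "computable 2 (\<lambda>xs. xs ! 0 - 1)" by simp
  \<comment> \<open>\<open>computable_prim\<close> leaves a dummy parameter, which is removed by
    feeding it zero; the same device recurs below.\<close>
  show ?thesis
    by (rule computable_comp2[where f = "\<lambda>x y. x - 1" and n = 1, OF c _ computable_zero]) (simp_all add: computable_proj)
qed

lemma computable_diff: "computable 2 (\<lambda>xs. xs ! 0 - xs ! 1)"
proof -
  have "computable 3 (\<lambda>xs. xs ! 1 - 1)"
    by (rule computable_comp1[OF computable_pred]) (simp add: computable_proj)
  from computable_prim[where a = "\<lambda>x. x" and h = "\<lambda>n y x. y - 1", OF _ this]
  have "computable 2 (\<lambda>xs. rec_nat (xs ! 1) (\<lambda>n y. y - 1) (xs ! 0))"
    by (simp add: computable_proj)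
  moreover have "rec_nat (x::nat) (\<lambda>n y. y - 1) n = x - n" for n x
    by (induction n) auto
  ultimately have "computable 2 (\<lambda>xs. xs ! 1 - xs ! 0)" by simp
  from computable_comp2[where f = "\<lambda>x y. y - x" and n = 2, OF this, of "\<lambda>xs. xs ! 1" "\<lambda>xs. xs ! 0"]
  show ?thesis by (simp add: computable_proj del: One_nat_def)
qed

lemma computable_triangle: "computable 1 (\<lambda>xs. triangle (xs ! 0))"
proof -
  have "computable 3 (\<lambda>xs. xs ! 1 + Suc (xs ! 0))"
    by (intro computable_comp2[where f = "(+)", OF computable_add]
        computable_comp1[where f = Suc, OF computable_Suc]) (simp_all add: computable_proj)
  from computable_prim[where a = "\<lambda>x. 0" and h = "\<lambda>n y x. y + Suc n", OF _ this]
  have "computable 2 (\<lambda>xs. rec_nat 0 (\<lambda>n y. y + Suc n) (xs ! 0))"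
    by (simp add: computable_zero)
  moreover have "rec_nat (0::nat) (\<lambda>n y. y + Suc n) n = triangle n" for n
    by (induction n) auto
  ultimately have c: "computable 2 (\<lambda>xs. triangle (xs ! 0))" by simp
  show ?thesis
    by (rule computable_comp2[where f = "\<lambda>x y. triangle x" and n = 1, OF c _ computable_zero]) (simp_all add: computable_proj)
qed

section \<open>Arithmetic decoding of pairs\<close>

definition pfst :: "nat \<Rightarrow> nat" where
  "pfst x = fst (prod_decode x)"

definition psnd :: "nat \<Rightarrow> nat" where
  "psnd x = snd (prod_decode x)"

abbreviation pr :: "nat \<Rightarrow> nat \<Rightarrow> nat" where
  "pr x y \<equiv> prod_encode (x, y)"

lemma pfst_pr [simp]: "pfst (pr x y) = x" and psnd_pr [simp]: "psnd (pr x y) = y"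
  by (simp_all add: pfst_def psnd_def)

lemma pr_collapse [simp]: "pr (pfst x) (psnd x) = x"
  by (simp add: pfst_def psnd_def)

lemma pfst_le: "pfst x \<le> x" and psnd_le: "psnd x \<le> x"
  using le_prod_encode_1[of "pfst x" "psnd x"] le_prod_encode_2[of "psnd x" "pfst x"] by simp_all

lemma all_pr: "(\<forall>z. P z) \<longleftrightarrow> (\<forall>x y. P (pr x y))" (is "?l \<longleftrightarrow> ?r")
proof
  assume ?r
  then have "P (pr (pfst z) (psnd z))" for z by blast
  then show ?l by simp
qed blast

lemma ex_pr: "(\<exists>z. P z) \<longleftrightarrow> (\<exists>x y. P (pr x y))"
  using all_pr[of "\<lambda>z. \<not> P z"] by blast

text \<open>Inverts \<^const>\<open>triangle\<close>; the components of a pair are read off from it.\<close>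

definition troot :: "nat \<Rightarrow> nat" where
  "troot x = rec_nat 0 (\<lambda>m r. r + (1 - (triangle (Suc r) - Suc m))) x"

lemma troot_bounds: "triangle (troot x) \<le> x \<and> x < triangle (Suc (troot x))"
proof (induction x)
  case 0
  show ?case by (simp add: troot_def)
next
  case (Suc x)
  \<comment> \<open>The truncated difference \<open>1 - (_ - _)\<close> is 1 exactly if the next
    triangular number has been reached, and 0 otherwise.\<close>
  have "troot (Suc x) = (if triangle (Suc (troot x)) \<le> Suc x then Suc (troot x) else troot x)"
    by (simp add: troot_def del: triangle_Suc)
  with Suc show ?case by auto
qed

lemma mono_triangle: "m \<le> n \<Longrightarrow> triangle m \<le> triangle n"
  by (induction rule: dec_induct) auto

text \<open>The pair is coded as \<open>triangle (x + y) + x\<close>, which lies between the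
  triangular numbers with indices \<open>x + y\<close> and \<open>x + y + 1\<close>.\<close>

lemma troot_pr: "troot (pr x y) = x + y"
proof -
  have 1: "triangle (x + y) \<le> pr x y" "pr x y < triangle (Suc (x + y))"
    by (simp_all add: prod_encode_def)
  have "x + y < Suc (troot (pr x y))"
  proof (rule ccontr)
    assume "\<not> x + y < Suc (troot (pr x y))"
    then have "triangle (Suc (troot (pr x y))) \<le> triangle (x + y)"
      by (intro mono_triangle) simp
    with 1 troot_bounds[of "pr x y"] show False by linarith
  qed
  moreover have "troot (pr x y) < Suc (x + y)"
  proof (rule ccontr)
    assume "\<not> troot (pr x y) < Suc (x + y)"
    then have "triangle (Suc (x + y)) \<le> triangle (troot (pr x y))"
      by (intro mono_triangle) simp
    with 1 troot_bounds[of "pr x y"] show False by linarith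
  qed
  ultimately show ?thesis by simp
qed

lemma pfst_troot: "pfst x = x - triangle (troot x)"
proof -
  have "pfst (pr a b) = pr a b - triangle (troot (pr a b))" for a b
    unfolding troot_pr pfst_pr by (simp add: prod_encode_def)
  then show ?thesis by (metis pr_collapse)
qed

lemma psnd_troot: "psnd x = troot x - pfst x"
proof -
  have "psnd (pr a b) = troot (pr a b) - pfst (pr a b)" for a b
    unfolding troot_pr by simp
  then show ?thesis by (metis pr_collapse)
qed

lemma computable_1: "computable n (\<lambda>xs. 1)"
  using computable_comp1[where f = Suc, OF computable_Suc computable_zero] by simp

lemma computable_troot: "computable 1 (\<lambda>xs. troot (xs ! 0))"
proof -
  have "computable 3 (\<lambda>xs. xs ! 1 + (1 - (triangle (Suc (xs ! 1)) - Suc (xs ! 0))))"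
    by (intro computable_comp2[where f = "(+)", OF computable_add]
        computable_comp2[where f = "(-)", OF computable_diff]
        computable_comp1[where f = Suc, OF computable_Suc]
        computable_comp1[where f = triangle, OF computable_triangle]
        computable_1) (simp_all add: computable_proj)
  from computable_prim[where a = "\<lambda>x. 0" and h = "\<lambda>m r x. r + (1 - (triangle (Suc r) - Suc m))", OF _ this]
  have c: "computable 2 (\<lambda>xs. troot (xs ! 0))"
    by (simp add: computable_zero troot_def)
  show ?thesis
    by (rule computable_comp2[where f = "\<lambda>x y. troot x" and n = 1, OF c _ computable_zero]) (simp_all add: computable_proj)
qed

lemma computable_pfst: "computable 1 (\<lambda>xs. pfst (xs ! 0))"
  unfolding pfst_troot
  by (intro computable_comp2[where f = "(-)", OF computable_diff]
      computable_comp1[where f = triangle, OF computable_triangle]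
      computable_troot) (simp_all add: computable_proj)

lemma computable_psnd: "computable 1 (\<lambda>xs. psnd (xs ! 0))"
  unfolding psnd_troot
  by (intro computable_comp2[where f = "(-)", OF computable_diff]
      computable_troot computable_pfst)

lemma computable_pr: "computable 2 (\<lambda>xs. pr (xs ! 0) (xs ! 1))"
  unfolding prod_encode_def split
  by (intro computable_comp2[where f = "(+)", OF computable_add]
      computable_comp1[where f = triangle, OF computable_triangle])
    (simp_all add: computable_proj)

text \<open>Functions are unary from here on, with tuples coded by pairing: this way the computability of
  an expression in one variable \<open>x\<close> follows from introduction rules alone.\<close>

definition rcf :: "(nat \<Rightarrow> nat) \<Rightarrow> bool" where
  "rcf f \<longleftrightarrow> computable 1 (\<lambda>xs. f (xs ! 0))"

abbreviation rcf2 :: "(nat \<Rightarrow> nat \<Rightarrow> nat) \<Rightarrow> bool" where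
  "rcf2 f \<equiv> rcf (\<lambda>z. f (pfst z) (psnd z))"

abbreviation rcf3 :: "(nat \<Rightarrow> nat \<Rightarrow> nat \<Rightarrow> nat) \<Rightarrow> bool" where
  "rcf3 f \<equiv> rcf (\<lambda>z. f (pfst z) (pfst (psnd z)) (psnd (psnd z)))"

abbreviation rcf4 :: "(nat \<Rightarrow> nat \<Rightarrow> nat \<Rightarrow> nat \<Rightarrow> nat) \<Rightarrow> bool" where
  "rcf4 f \<equiv> rcf (\<lambda>z. f (pfst z) (pfst (psnd z)) (pfst (psnd (psnd z))) (psnd (psnd (psnd z))))"

text \<open>Not declared \<open>rc\<close>: its outer function is schematic, so it would match every
  goal. Each named function gets a rule of its own instead, derived from this one or from
  \<open>rcf2_app\<close> and its variants.\<close>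

lemma rcf_comp: "rcf f \<Longrightarrow> rcf g \<Longrightarrow> rcf (\<lambda>x. f (g x))"
  unfolding rcf_def by (rule computable_comp1)

lemma rcf_id [rc]: "rcf (\<lambda>x. x)"
  unfolding rcf_def by (simp add: computable_proj)

lemma rcf_Suc [rc]: "rcf f \<Longrightarrow> rcf (\<lambda>x. Suc (f x))"
  by (rule rcf_comp[of Suc]) (simp_all add: rcf_def computable_Suc del: One_nat_def)

lemma rcf_const [rc]: "rcf (\<lambda>x. c)"
proof (induction c)
  case 0
  show ?case by (simp add: rcf_def computable_zero)
qed (rule rcf_Suc)

lemma rcf_pfst [rc]: "rcf f \<Longrightarrow> rcf (\<lambda>x. pfst (f x))"
  by (rule rcf_comp[of pfst]) (simp_all add: rcf_def computable_pfst del: One_nat_def)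

lemma rcf_psnd [rc]: "rcf f \<Longrightarrow> rcf (\<lambda>x. psnd (f x))"
  by (rule rcf_comp[of psnd]) (simp_all add: rcf_def computable_psnd del: One_nat_def)

lemma rcf_pr [rc]: "rcf f \<Longrightarrow> rcf g \<Longrightarrow> rcf (\<lambda>x. pr (f x) (g x))"
  unfolding rcf_def by (rule computable_comp2[OF computable_pr])

lemma rcf_add [rc]: "rcf f \<Longrightarrow> rcf g \<Longrightarrow> rcf (\<lambda>x. f x + g x)"
  unfolding rcf_def by (rule computable_comp2[OF computable_add])

lemma rcf_mult [rc]: "rcf f \<Longrightarrow> rcf g \<Longrightarrow> rcf (\<lambda>x. f x * g x)"
  unfolding rcf_def by (rule computable_comp2[OF computable_mult])

lemma rcf_diff [rc]: "rcf f \<Longrightarrow> rcf g \<Longrightarrow> rcf (\<lambda>x. f x - g x)"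
  unfolding rcf_def by (rule computable_comp2[OF computable_diff])

lemma rcf2_app: "rcf2 f \<Longrightarrow> rcf a \<Longrightarrow> rcf b \<Longrightarrow> rcf (\<lambda>x. f (a x) (b x))"
  using rcf_comp[of "\<lambda>z. f (pfst z) (psnd z)" "\<lambda>x. pr (a x) (b x)"] by (simp add: rcf_pr)

lemma rcf3_app: "rcf3 f \<Longrightarrow> rcf a \<Longrightarrow> rcf b \<Longrightarrow> rcf c \<Longrightarrow> rcf (\<lambda>x. f (a x) (b x) (c x))"
  using rcf_comp[of "\<lambda>z. f (pfst z) (pfst (psnd z)) (psnd (psnd z))" "\<lambda>x. pr (a x) (pr (b x) (c x))"]
  by (simp add: rcf_pr)

lemma rcf4_app:
  "rcf4 f \<Longrightarrow> rcf a \<Longrightarrow> rcf b \<Longrightarrow> rcf c \<Longrightarrow> rcf d \<Longrightarrow> rcf (\<lambda>x. f (a x) (b x) (c x) (d x))"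
  using rcf_comp[of "\<lambda>z. f (pfst z) (pfst (psnd z)) (pfst (psnd (psnd z))) (psnd (psnd (psnd z)))"
      "\<lambda>x. pr (a x) (pr (b x) (pr (c x) (d x)))"]
  by (simp add: rcf_pr)

lemma computable2_rcf2: "rcf2 f \<longleftrightarrow> computable 2 (\<lambda>xs. f (xs ! 0) (xs ! 1))"
proof
  assume "rcf2 f"
  then have 1: "computable 1 (\<lambda>xs. f (pfst (xs ! 0)) (psnd (xs ! 0)))"
    by (simp add: rcf_def)
  from computable_comp1[where f = "\<lambda>z. f (pfst z) (psnd z)", OF 1 computable_pr]
  show "computable 2 (\<lambda>xs. f (xs ! 0) (xs ! 1))" by simp
next
  assume "computable 2 (\<lambda>xs. f (xs ! 0) (xs ! 1))"
  from computable_comp2[OF this computable_pfst computable_psnd]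
  show "rcf2 f" by (simp add: rcf_def)
qed

lemma rcf_rec_nat [rc]:
  assumes "rcf a" "rcf3 h" "rcf f"
  shows "rcf (\<lambda>x. rec_nat (a x) (\<lambda>n y. h n y x) (f x))"
proof -
  have 1: "computable 1 (\<lambda>xs. h (pfst (xs ! 0)) (pfst (psnd (xs ! 0))) (psnd (psnd (xs ! 0))))"
    using assms(2) by (simp add: rcf_def)
  have 2: "computable 3 (\<lambda>xs. pr (xs ! 0) (pr (xs ! 1) (xs ! 2)))"
    by (intro computable_comp2[where f = pr, OF computable_pr] computable_proj) auto
  from computable_comp1[where f = "\<lambda>z. h (pfst z) (pfst (psnd z)) (psnd (psnd z))", OF 1 2]
  have "computable 3 (\<lambda>xs. h (xs ! 0) (xs ! 1) (xs ! 2))" by simp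
  from computable_prim[OF assms(1)[unfolded rcf_def] this]
  have "rcf2 (\<lambda>n x. rec_nat (a x) (\<lambda>n y. h n y x) n)"
    by (subst computable2_rcf2)
  from rcf2_app[OF this assms(3) rcf_id] show ?thesis by simp
qed

section \<open>Decidable predicates and bounded search\<close>

definition rcp :: "(nat \<Rightarrow> bool) \<Rightarrow> bool" where
  "rcp P \<longleftrightarrow> rcf (\<lambda>x. if P x then 1 else 0)"

abbreviation rcp2 :: "(nat \<Rightarrow> nat \<Rightarrow> bool) \<Rightarrow> bool" where
  "rcp2 P \<equiv> rcp (\<lambda>z. P (pfst z) (psnd z))"

abbreviation rcp3 :: "(nat \<Rightarrow> nat \<Rightarrow> nat \<Rightarrow> bool) \<Rightarrow> bool" where
  "rcp3 P \<equiv> rcp (\<lambda>z. P (pfst z) (pfst (psnd z)) (psnd (psnd z)))"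

abbreviation rcp4 :: "(nat \<Rightarrow> nat \<Rightarrow> nat \<Rightarrow> nat \<Rightarrow> bool) \<Rightarrow> bool" where
  "rcp4 P \<equiv> rcp (\<lambda>z. P (pfst z) (pfst (psnd z)) (pfst (psnd (psnd z))) (psnd (psnd (psnd z))))"

lemma computable_set_rcp: "computable_set A \<longleftrightarrow> rcp (\<lambda>x. x \<in> A)"
  by (simp add: computable_set_def rcp_def rcf_def)

lemma rcp_comp: "rcp P \<Longrightarrow> rcf g \<Longrightarrow> rcp (\<lambda>x. P (g x))"
  unfolding rcp_def by (rule rcf_comp)

lemma rcp2_app: "rcp2 P \<Longrightarrow> rcf a \<Longrightarrow> rcf b \<Longrightarrow> rcp (\<lambda>x. P (a x) (b x))"
  unfolding rcp_def by (rule rcf2_app)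

lemma rcp3_app: "rcp3 P \<Longrightarrow> rcf a \<Longrightarrow> rcf b \<Longrightarrow> rcf c \<Longrightarrow> rcp (\<lambda>x. P (a x) (b x) (c x))"
  unfolding rcp_def by (rule rcf3_app)

lemma rcp4_app:
  "rcp4 P \<Longrightarrow> rcf a \<Longrightarrow> rcf b \<Longrightarrow> rcf c \<Longrightarrow> rcf d \<Longrightarrow> rcp (\<lambda>x. P (a x) (b x) (c x) (d x))"
  unfolding rcp_def by (rule rcf4_app)

lemma rcf_if [rc]:
  assumes "rcp P" "rcf f" "rcf g"
  shows "rcf (\<lambda>x. if P x then f x else g x)"
proof -
  have "rcf (\<lambda>x. (if P x then 1 else 0) * f x + (1 - (if P x then 1 else 0)) * g x)"
    using assms unfolding rcp_def by (intro rc)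
  moreover have "(\<lambda>x. (if P x then 1 else 0) * f x + (1 - (if P x then 1 else 0)) * g x)
      = (\<lambda>x. if P x then f x else g x)" by auto
  ultimately show ?thesis by simp
qed

lemma rcp_const [rc]: "rcp (\<lambda>x. c)"
  unfolding rcp_def by (rule rcf_const)

lemma rcp_not [rc]:
  assumes "rcp P" shows "rcp (\<lambda>x. \<not> P x)"
proof -
  have "rcf (\<lambda>x. if P x then 0 else 1)"
    using assms by (intro rc)
  moreover have "(\<lambda>x. if P x then 0 else 1) = (\<lambda>x. if \<not> P x then 1 else (0::nat))" by auto
  ultimately show ?thesis by (simp add: rcp_def)
qed

lemma rcp_conj [rc]:
  assumes "rcp P" "rcp Q" shows "rcp (\<lambda>x. P x \<and> Q x)"
proof -
  have "rcf (\<lambda>x. if P x then if Q x then 1 else 0 else 0)"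
    using assms by (intro rc)
  moreover have "(\<lambda>x. if P x then if Q x then 1 else 0 else (0::nat)) = (\<lambda>x. if P x \<and> Q x then 1 else 0)"
    by auto
  ultimately show ?thesis by (simp add: rcp_def)
qed

lemma rcp_disj [rc]: "rcp P \<Longrightarrow> rcp Q \<Longrightarrow> rcp (\<lambda>x. P x \<or> Q x)"
  using rcp_not[OF rcp_conj[OF rcp_not[of P] rcp_not[of Q]]] by simp

lemma rcp_imp [rc]: "rcp P \<Longrightarrow> rcp Q \<Longrightarrow> rcp (\<lambda>x. P x \<longrightarrow> Q x)"
  using rcp_disj[OF rcp_not[of P], of Q] by simp

lemma rcp_le [rc]: 
  assumes "rcf f" "rcf g" shows "rcp (\<lambda>x. f x \<le> g x)"
proof -
  have "rcf (\<lambda>x. 1 - (f x - g x))" using assms by (intro rc)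
  moreover have "(\<lambda>x. 1 - (f x - g x)) = (\<lambda>x. if f x \<le> g x then 1 else 0)" by auto
  ultimately show ?thesis by (simp add: rcp_def)
qed

lemma rcp_less [rc]: "rcf f \<Longrightarrow> rcf g \<Longrightarrow> rcp (\<lambda>x. f x < g x)"
  using rcp_not[OF rcp_le[of g f]] by (simp add: not_le)

lemma rcp_eq [rc]: "rcf f \<Longrightarrow> rcf g \<Longrightarrow> rcp (\<lambda>x. f x = g x)"
  using rcp_conj[OF rcp_le[of f g] rcp_le[of g f]] by (simp add: order_eq_iff)

lemma rcp_iff [rc]: "rcp P \<Longrightarrow> rcp Q \<Longrightarrow> rcp (\<lambda>x. P x \<longleftrightarrow> Q x)"
  unfolding iff_conv_conj_imp by (intro rc)

lemma rcp_All_less [rc]: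
  assumes "rcp2 P" "rcf f"
  shows "rcp (\<lambda>x. \<forall>y<f x. P x y)"
proof -
  \<comment> \<open>The recursion step receives index, previous value and parameter as a nested
    pair, so \<open>P\<close> has to be applied to its last and its first entry.\<close>
  have 1: "rcp (\<lambda>z. P (psnd (psnd z)) (pfst z))"
    by (rule rcp2_app[OF assms(1)]) (intro rc)+
  have "rcf (\<lambda>x. rec_nat 1 (\<lambda>n y. if P x n then y else 0) (f x))"
    using assms 1 by (intro rc)
  moreover have "rec_nat (1::nat) (\<lambda>n y. if P x n then y else 0) k = (if \<forall>y<k. P x y then 1 else 0)" for x k
    by (induction k) (auto simp: less_Suc_eq)
  ultimately show ?thesis by (simp add: rcp_def del: One_nat_def)
qed

lemma rcp_Ex_less [rc]:
  assumes "rcp2 P" "rcf f"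
  shows "rcp (\<lambda>x. \<exists>y<f x. P x y)"
  using rcp_not[OF rcp_All_less[of "\<lambda>x y. \<not> P x y", OF rcp_not[OF assms(1)] assms(2)]] by simp

lemma rcp_Ex_le [rc]:
  assumes "rcp2 P" "rcf f"
  shows "rcp (\<lambda>x. \<exists>y\<le>f x. P x y)"
  using rcp_Ex_less[OF assms(1) rcf_Suc[OF assms(2)]] by (simp add: less_Suc_eq_le)

lemma rcp_All_le [rc]:
  assumes "rcp2 P" "rcf f"
  shows "rcp (\<lambda>x. \<forall>y\<le>f x. P x y)"
  using rcp_All_less[OF assms(1) rcf_Suc[OF assms(2)]] by (simp add: less_Suc_eq_le)

lemma rcp_If [rc]: "rcp P \<Longrightarrow> rcp Q \<Longrightarrow> rcp R \<Longrightarrow> rcp (\<lambda>x. if P x then Q x else R x)"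
  unfolding if_bool_eq_conj by (intro rc)

text \<open>Raising the bound from \<open>n\<close> to \<open>Suc n\<close> matters only if nothing
  was found below \<open>n\<close>, that is, if \<open>l = n\<close>; then just \<open>n\<close>
  itself is left to test.\<close>

lemma Least_Suc_bound:
  fixes l n :: nat
  assumes "P l \<or> n \<le> l" "l \<le> n" "\<And>y. y < l \<Longrightarrow> \<not> P y"
  shows "(LEAST y. P y \<or> Suc n \<le> y) = (if l < n then l else if P n then n else Suc n)"
proof (rule Least_equality)
  show "P (if l < n then l else if P n then n else Suc n) \<or>
      Suc n \<le> (if l < n then l else if P n then n else Suc n)"
    using assms(1) by auto
  fix y assume "P y \<or> Suc n \<le> y"
  moreover have "l \<le> y" if "P y"
    using assms(3) that not_less by blast
  ultimately show "(if l < n then l else if P n then n else Suc n) \<le> y"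
    using assms(2) by (auto simp: le_less less_Suc_eq)
qed

text \<open>The disjunct \<open>f x \<le> y\<close> bounds the search, so that primitive recursion
  suffices; the result \<open>f x\<close> signals that no witness lies below
  \<open>f x\<close>.\<close>

lemma rcf_Least [rc]:
  assumes "rcp2 P" "rcf f"
  shows "rcf (\<lambda>x. LEAST y. P x y \<or> f x \<le> y)"
proof -
  have 1: "rcp (\<lambda>z. P (psnd (psnd z)) (pfst z))"
    by (rule rcp2_app[OF assms(1)]) (intro rc)+
  have 2: "rcf (\<lambda>x. rec_nat 0 (\<lambda>n y. if y < n then y else if P x n then n else Suc n) (f x))"
    using assms 1 by (intro rc)
  have L: "(LEAST y. P x y \<or> Suc n \<le> y) = (if (LEAST y. P x y \<or> n \<le> y) < n
    then (LEAST y. P x y \<or> n \<le> y) else if P x n then n else Suc n)" for x n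
  proof -
    let ?l = "LEAST y. P x y \<or> n \<le> y"
    have a: "P x ?l \<or> n \<le> ?l" "?l \<le> n"
      by (rule LeastI2[of _ n], simp, simp) (rule Least_le, simp)
    have b: "\<not> P x y" if "y < ?l" for y
      using not_less_Least[OF that] by simp
    show ?thesis
      by (rule Least_Suc_bound[where P = "P x" and l = ?l]) (use a b in blast)+
  qed
  have "rec_nat 0 (\<lambda>n y. if y < n then y else if P x n then n else Suc n) k = (LEAST y. P x y \<or> k \<le> y)" for x k
  proof (induction k)
    case 0
    show ?case by (simp add: Least_eq_0)
  next
    case (Suc k)
    show ?case unfolding L nat.rec Suc by (rule refl)
  qed
  with 2 show ?thesis by simp
qed

lemma rcf_power [rc]:
  assumes "rcf f" "rcf g" shows "rcf (\<lambda>x. f x ^ g x)"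
proof -
  have 1: "rcf (\<lambda>z. f (psnd (psnd z)))"
    by (rule rcf_comp[OF assms(1)]) (intro rc)
  have "rcf (\<lambda>x. rec_nat 1 (\<lambda>n y. y * f x) (g x))"
    using assms 1 by (intro rc)
  moreover have "rec_nat 1 (\<lambda>n y. y * a) n = a ^ n" for a n :: nat
    by (induction n) (auto simp: mult.commute)
  ultimately show ?thesis by simp
qed

lemma rcf_div [rc]:
  assumes "rcf f" "rcf g" shows "rcf (\<lambda>x. f x div g x)"
proof -
  \<comment> \<open>The quotient is the first \<open>y\<close> with \<open>a < (y + 1) * b\<close>,
    and \<open>a\<close> itself is a safe bound for the search.\<close>
  have *: "a div b = (if b = 0 then 0 else (LEAST y. a < (Suc y) * b \<or> a \<le> y))" for a b :: nat
  proof (cases "b = 0")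
    case False
    have "(LEAST y. a < (Suc y) * b \<or> a \<le> y) = a div b"
    proof (rule Least_equality)
      show "a < Suc (a div b) * b \<or> a \<le> a div b"
        using False dividend_less_div_times[of b a] by (simp add: add.commute)
      fix y assume "a < Suc y * b \<or> a \<le> y"
      then show "a div b \<le> y"
        using False by (metis div_le_dividend le_trans less_Suc_eq_le less_mult_imp_div_less)
    qed
    then show ?thesis using False by simp
  qed simp
  have 1: "rcf (\<lambda>z. f (pfst z))" "rcf (\<lambda>z. g (pfst z))"
    by (rule rcf_comp[OF assms(1)], intro rc) (rule rcf_comp[OF assms(2)], intro rc)
  show ?thesis
    unfolding * by (intro rc assms 1)
qed

section \<open>Lists and course-of-values recursion\<close>

text \<open>A nonempty list is coded as the successor of the pair of its head and its coded tail,
  hence the \<open>- 1\<close>; on the code 0 of the empty list the result is 0.\<close>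

definition lhd :: "nat \<Rightarrow> nat" where
  "lhd l = pfst (l - 1)"

definition ltl :: "nat \<Rightarrow> nat" where
  "ltl l = psnd (l - 1)"

definition lnth :: "nat \<Rightarrow> nat \<Rightarrow> nat" where
  "lnth l i = lhd (rec_nat l (\<lambda>_. ltl) i)"

lemma lhd_Cons [simp]: "lhd (Suc (pr x l)) = x" and ltl_Cons [simp]: "ltl (Suc (pr x l)) = l"
  by (simp_all add: lhd_def ltl_def)

lemma rec_nat_ltl: "rec_nat (ltl l) (\<lambda>_. ltl) i = ltl (rec_nat l (\<lambda>_. ltl) i)"
  by (induction i) auto

lemma lnth_0 [simp]: "lnth l 0 = lhd l" and lnth_Suc [simp]: "lnth l (Suc i) = lnth (ltl l) i"
  by (simp_all add: lnth_def rec_nat_ltl)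

lemma lnth_list_encode: "i < length xs \<Longrightarrow> lnth (list_encode xs) i = xs ! i"
  by (induction xs arbitrary: i) (auto simp: nth_Cons split: nat.splits)

lemma lnth_list_decode: "i < length (list_decode l) \<Longrightarrow> list_decode l ! i = lnth l i"
  using lnth_list_encode[of i "list_decode l"] by simp

lemma rcf_lhd [rc]: "rcf f \<Longrightarrow> rcf (\<lambda>x. lhd (f x))"
  unfolding lhd_def by (intro rc)

lemma rcf_ltl [rc]: "rcf f \<Longrightarrow> rcf (\<lambda>x. ltl (f x))"
  unfolding ltl_def by (intro rc)

lemma rcf_lnth [rc]:
  assumes "rcf f" "rcf g" shows "rcf (\<lambda>x. lnth (f x) (g x))"
  unfolding lnth_def by (intro rc assms)

text \<open>\<^term>\<open>H p c L\<close> may look up earlier values in the code \<open>L\<close> of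
  the list of all of them, most recent first.\<close>

definition history :: "(nat \<Rightarrow> nat \<Rightarrow> nat \<Rightarrow> nat) \<Rightarrow> nat \<Rightarrow> nat \<Rightarrow> nat" where
  "history H p = rec_nat 0 (\<lambda>c L. Suc (pr (H p c L) L))"

definition covrec :: "(nat \<Rightarrow> nat \<Rightarrow> nat \<Rightarrow> nat) \<Rightarrow> nat \<Rightarrow> nat \<Rightarrow> nat" where
  "covrec H p c = H p c (history H p c)"

definition look :: "nat \<Rightarrow> nat \<Rightarrow> nat \<Rightarrow> nat" where
  "look L c i = lnth L (c - Suc i)"

lemma look_history: "i < c \<Longrightarrow> look (history H p c) c i = covrec H p i"
proof (induction c)
  case (Suc c)
  have h: "history H p (Suc c) = Suc (pr (covrec H p c) (history H p c))"
    by (simp add: history_def covrec_def)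
  show ?case
  proof (cases "i = c")
    case False
    then have "Suc c - Suc i = Suc (c - Suc i)" using Suc.prems by simp
    then show ?thesis using Suc False unfolding look_def h by simp
  qed (simp add: look_def h)
qed simp

lemma rcf_look [rc]: "rcf f \<Longrightarrow> rcf g \<Longrightarrow> rcf h \<Longrightarrow> rcf (\<lambda>x. look (f x) (g x) (h x))"
  unfolding look_def by (intro rc)

lemma rcf_covrec:
  assumes "rcf3 H" "rcf f" "rcf g"
  shows "rcf (\<lambda>x. covrec H (f x) (g x))"
proof -
  have "rcf2 (covrec H)"
    unfolding covrec_def history_def by (intro rc rcf3_app[OF assms(1)])
  from rcf2_app[OF this assms(2,3)] show ?thesis .
qed

text \<open>The tail of a list has a smaller code, so structural recursion becomes course-of-values
  recursion. The step also sees the code of the tail, which \<open>rcp_derivation\<close> relies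
  on.\<close>

lemma rcf_list_rec:
  assumes "\<And>p. F p [] = a p" "\<And>p x xs. F p (x # xs) = h p x (list_encode xs) (F p xs)"
    and "rcf a" "rcf4 h"
  shows "rcf2 (\<lambda>p l. F p (list_decode l))"
proof -
  define H where "H p c L = (if c = 0 then a p else h p (lhd c) (ltl c) (look L c (ltl c)))" for p c L
  have "F p xs = covrec H p (list_encode xs)" for p xs
  proof (induction xs)
    case Nil
    show ?case by (simp add: covrec_def H_def assms(1))
  next
    case (Cons x xs)
    have "list_encode xs < list_encode (x # xs)"
      by (simp add: le_prod_encode_2 less_Suc_eq_le)
    from look_history[OF this, of H p] show ?case
      unfolding assms(2) Cons by (subst covrec_def) (simp add: H_def)
  qed
  moreover have "rcf3 H"
    unfolding H_def by (intro rc rcf4_app[OF assms(4)] rcf_comp[OF assms(3)])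
  ultimately show ?thesis
    by (auto intro!: rcf_covrec rc)
qed

lemma rcf_length [rc]: 
  assumes "rcf f" shows "rcf (\<lambda>x. length (list_decode (f x)))"
proof -
  have "rcf2 (\<lambda>p l. length (list_decode l))"
    by (rule rcf_list_rec[where a = "\<lambda>p. 0" and h = "\<lambda>p x l y. Suc y"]) (auto intro!: rc)
  from rcf2_app[OF this assms assms] show ?thesis .
qed

lemma rcp_Bex_set [rc]:
  assumes "rcp2 P" "rcf f" shows "rcp (\<lambda>x. \<exists>v\<in>set (list_decode (f x)). P x v)"
proof -
  have "rcf2 (\<lambda>p l. if \<exists>v\<in>set (list_decode l). P p v then 1 else 0)"
    by (rule rcf_list_rec[where F = "\<lambda>p l. if \<exists>v\<in>set l. P p v then 1 else 0"
          and a = "\<lambda>p. 0" and h = "\<lambda>p x l y. if P p x then 1 else y"])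
      (auto intro!: rc rcp2_app[OF assms(1)])
  from rcf2_app[OF this rcf_id assms(2)] show ?thesis by (simp add: rcp_def)
qed

lemma rcp_Ball_set [rc]:
  assumes "rcp2 P" "rcf f" shows "rcp (\<lambda>x. \<forall>v\<in>set (list_decode (f x)). P x v)"
  using rcp_not[OF rcp_Bex_set[OF rcp_not[OF assms(1)] assms(2)]] by simp

lemma rcf_map [rc]:
  assumes "rcf2 g" "rcf f" shows "rcf (\<lambda>x. list_encode (map (g x) (list_decode (f x))))"
proof -
  have "rcf2 (\<lambda>p l. list_encode (map (g p) (list_decode l)))"
    by (rule rcf_list_rec[where F = "\<lambda>p l. list_encode (map (g p) l)"
          and a = "\<lambda>p. 0" and h = "\<lambda>p x l y. Suc (pr (g p x) y)"])
      (auto intro!: rc rcf2_app[OF assms(1)])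
  from rcf2_app[OF this rcf_id assms(2)] show ?thesis .
qed

section \<open>Closure properties of the arithmetical hierarchy\<close>

definition sigp :: "nat \<Rightarrow> (nat \<Rightarrow> bool) \<Rightarrow> bool" where
  "sigp n P \<longleftrightarrow> Collect P \<in> Sigma0 n"

definition pip :: "nat \<Rightarrow> (nat \<Rightarrow> bool) \<Rightarrow> bool" where
  "pip n P \<longleftrightarrow> Collect P \<in> Pi0 n"

lemma sigp_0: "sigp 0 P \<longleftrightarrow> rcp P" and pip_0: "pip 0 P \<longleftrightarrow> rcp P"
  by (simp_all add: sigp_def pip_def computable_set_rcp)

lemma sigp_Suc: "sigp (Suc n) P \<longleftrightarrow> (\<exists>Q. pip n Q \<and> P = (\<lambda>x. \<exists>y. Q (pr x y)))"
proof
  assume "sigp (Suc n) P"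
  then obtain B where "B \<in> Pi0 n" "Collect P = {x. \<exists>y. pr x y \<in> B}"
    by (auto simp: sigp_def)
  then show "\<exists>Q. pip n Q \<and> P = (\<lambda>x. \<exists>y. Q (pr x y))"
    by (intro exI[of _ "\<lambda>x. x \<in> B"]) (auto simp: pip_def fun_eq_iff)
next
  assume "\<exists>Q. pip n Q \<and> P = (\<lambda>x. \<exists>y. Q (pr x y))"
  then obtain Q where "Collect Q \<in> Pi0 n" "Collect P = {x. \<exists>y. pr x y \<in> Collect Q}"
    by (auto simp: pip_def)
  then show "sigp (Suc n) P"
    unfolding sigp_def Sigma0.simps by blast
qed

lemma pip_Suc: "pip (Suc n) P \<longleftrightarrow> (\<exists>Q. sigp n Q \<and> P = (\<lambda>x. \<forall>y. Q (pr x y)))"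
proof
  assume "pip (Suc n) P"
  then obtain B where "B \<in> Sigma0 n" "Collect P = {x. \<forall>y. pr x y \<in> B}"
    by (auto simp: pip_def)
  then show "\<exists>Q. sigp n Q \<and> P = (\<lambda>x. \<forall>y. Q (pr x y))"
    by (intro exI[of _ "\<lambda>x. x \<in> B"]) (auto simp: sigp_def fun_eq_iff)
next
  assume "\<exists>Q. sigp n Q \<and> P = (\<lambda>x. \<forall>y. Q (pr x y))"
  then obtain Q where "Collect Q \<in> Sigma0 n" "Collect P = {x. \<forall>y. pr x y \<in> Collect Q}"
    by (auto simp: sigp_def)
  then show "pip (Suc n) P"
    unfolding pip_def Pi0.simps by blast
qed

text \<open>Both directions share one induction because each uses the other one a level
  below.\<close>

lemma sigp_not_pip: "(sigp n P \<longrightarrow> pip n (\<lambda>x. \<not> P x)) \<and> (pip n P \<longrightarrow> sigp n (\<lambda>x. \<not> P x))"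
proof (induction n arbitrary: P)
  case 0
  show ?case by (simp add: sigp_0 pip_0 rcp_not)
next
  case (Suc n)
  show ?case
    unfolding sigp_Suc pip_Suc
  proof (intro conjI impI; elim exE conjE)
    fix Q assume "pip n Q" "P = (\<lambda>x. \<exists>y. Q (pr x y))"
    with Suc show "\<exists>Q. sigp n Q \<and> (\<lambda>x. \<not> P x) = (\<lambda>x. \<forall>y. Q (pr x y))"
      by (intro exI[of _ "\<lambda>x. \<not> Q x"]) simp
  next
    fix Q assume "sigp n Q" "P = (\<lambda>x. \<forall>y. Q (pr x y))"
    with Suc show "\<exists>Q. pip n Q \<and> (\<lambda>x. \<not> P x) = (\<lambda>x. \<exists>y. Q (pr x y))"
      by (intro exI[of _ "\<lambda>x. \<not> Q x"]) simp
  qed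
qed

lemma pip_not: "sigp n P \<Longrightarrow> pip n (\<lambda>x. \<not> P x)" and sigp_not: "pip n P \<Longrightarrow> sigp n (\<lambda>x. \<not> P x)"
  using sigp_not_pip by auto

lemma sigp_pip_comp:
  "rcf f \<Longrightarrow> (sigp n P \<longrightarrow> sigp n (\<lambda>x. P (f x))) \<and> (pip n P \<longrightarrow> pip n (\<lambda>x. P (f x)))"
proof (induction n arbitrary: P f)
  case 0
  then show ?case by (simp add: sigp_0 pip_0 rcp_comp)
next
  case (Suc n)
  have f: "rcf (\<lambda>z. pr (f (pfst z)) (psnd z))"
    by (intro rc rcf_comp[OF Suc.prems])
  show ?case
    unfolding sigp_Suc pip_Suc
  proof (intro conjI impI; elim exE conjE)
    fix Q assume "pip n Q" "P = (\<lambda>x. \<exists>y. Q (pr x y))"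
    with Suc.IH[OF f] show "\<exists>Q. pip n Q \<and> (\<lambda>x. P (f x)) = (\<lambda>x. \<exists>y. Q (pr x y))"
      by (intro exI[of _ "\<lambda>z. Q (pr (f (pfst z)) (psnd z))"]) simp
  next
    fix Q assume "sigp n Q" "P = (\<lambda>x. \<forall>y. Q (pr x y))"
    with Suc.IH[OF f] show "\<exists>Q. sigp n Q \<and> (\<lambda>x. P (f x)) = (\<lambda>x. \<forall>y. Q (pr x y))"
      by (intro exI[of _ "\<lambda>z. Q (pr (f (pfst z)) (psnd z))"]) simp
  qed
qed

lemma sigp_comp: "sigp n P \<Longrightarrow> rcf f \<Longrightarrow> sigp n (\<lambda>x. P (f x))"
  and pip_comp: "pip n P \<Longrightarrow> rcf f \<Longrightarrow> pip n (\<lambda>x. P (f x))"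
  using sigp_pip_comp by auto

lemma sigp_ExI: "pip n (\<lambda>z. P (pfst z) (psnd z)) \<Longrightarrow> sigp (Suc n) (\<lambda>x. \<exists>y. P x y)"
  unfolding sigp_Suc by (intro exI[of _ "\<lambda>z. P (pfst z) (psnd z)"]) simp

lemma pip_AllI: "sigp n (\<lambda>z. P (pfst z) (psnd z)) \<Longrightarrow> pip (Suc n) (\<lambda>x. \<forall>y. P x y)"
  unfolding pip_Suc by (intro exI[of _ "\<lambda>z. P (pfst z) (psnd z)"]) simp

text \<open>Two existential quantifiers contract to one over a pair.\<close>

lemma sigp_Ex:
  assumes "sigp (Suc n) (\<lambda>z. P (pfst z) (psnd z))" shows "sigp (Suc n) (\<lambda>x. \<exists>y. P x y)"
proof -
  obtain Q where Q: "pip n Q" "(\<lambda>z. P (pfst z) (psnd z)) = (\<lambda>x. \<exists>y. Q (pr x y))"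
    using assms unfolding sigp_Suc by auto
  have "P x y \<longleftrightarrow> (\<exists>w. Q (pr (pr x y) w))" for x y
    using fun_cong[OF Q(2), of "pr x y"] by simp
  moreover have "(\<exists>v. Q (pr (pr x (pfst v)) (psnd v))) \<longleftrightarrow> (\<exists>y w. Q (pr (pr x y) w))" for x
    by (subst ex_pr) simp
  ultimately have "(\<lambda>x. \<exists>y. P x y) = (\<lambda>x. \<exists>v. Q (pr (pr x (pfst v)) (psnd v)))"
    by simp
  moreover have "sigp (Suc n) (\<lambda>x. \<exists>v. Q (pr (pr x (pfst v)) (psnd v)))"
    by (intro sigp_ExI pip_comp[OF Q(1)] rc)
  ultimately show ?thesis by simp
qed

lemma pip_All:
  assumes "pip (Suc n) (\<lambda>z. P (pfst z) (psnd z))" shows "pip (Suc n) (\<lambda>x. \<forall>y. P x y)"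
  using pip_not[OF sigp_Ex[OF sigp_not[OF assms]]] by simp

text \<open>A decidable condition moves inside each quantifier in turn until it reaches the
  decidable matrix.\<close>

lemma sigp_pip_conj:
  "rcp R \<Longrightarrow> (sigp n P \<longrightarrow> sigp n (\<lambda>x. R x \<and> P x)) \<and> (pip n P \<longrightarrow> pip n (\<lambda>x. R x \<and> P x))"
proof (induction n arbitrary: P R)
  case 0
  then show ?case by (simp add: sigp_0 pip_0 rcp_conj)
next
  case (Suc n)
  have R: "rcp (\<lambda>z. R (pfst z))"
    by (intro rc rcp_comp[OF Suc.prems])
  show ?case
    unfolding sigp_Suc pip_Suc
  proof (intro conjI impI; elim exE conjE)
    fix Q assume "pip n Q" "P = (\<lambda>x. \<exists>y. Q (pr x y))"
    with Suc.IH[OF R] show "\<exists>Q. pip n Q \<and> (\<lambda>x. R x \<and> P x) = (\<lambda>x. \<exists>y. Q (pr x y))"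
      by (intro exI[of _ "\<lambda>z. R (pfst z) \<and> Q z"]) simp
  next
    fix Q assume "sigp n Q" "P = (\<lambda>x. \<forall>y. Q (pr x y))"
    with Suc.IH[OF R] show "\<exists>Q. sigp n Q \<and> (\<lambda>x. R x \<and> P x) = (\<lambda>x. \<forall>y. Q (pr x y))"
      by (intro exI[of _ "\<lambda>z. R (pfst z) \<and> Q z"]) simp
  qed
qed

lemma sigp_conj: "rcp R \<Longrightarrow> sigp n P \<Longrightarrow> sigp n (\<lambda>x. R x \<and> P x)"
  and pip_conj: "rcp R \<Longrightarrow> pip n P \<Longrightarrow> pip n (\<lambda>x. R x \<and> P x)"
  using sigp_pip_conj by auto

lemma pip_imp: "rcp R \<Longrightarrow> pip n P \<Longrightarrow> pip n (\<lambda>x. R x \<longrightarrow> P x)"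
  using pip_not[OF sigp_conj[OF _ sigp_not[of n P]], of R] by simp

lemma sigp_imp: "rcp R \<Longrightarrow> sigp n P \<Longrightarrow> sigp n (\<lambda>x. R x \<longrightarrow> P x)"
  using sigp_not[OF pip_conj[OF _ pip_not[of n P]], of R] by simp

text \<open>At level 0 a bounded quantifier is decidable; above, it is absorbed by the leading
  universal quantifier.\<close>

lemma pip_bounded_All:
  assumes "pip n (\<lambda>z. P (pfst z) (psnd z))" "rcf f" shows "pip n (\<lambda>x. \<forall>y<f x. P x y)"
proof (cases n)
  case 0
  then show ?thesis using assms by (simp add: pip_0 rcp_All_less)
next
  case (Suc m)
  show ?thesis
    unfolding Suc using assms(1)[unfolded Suc]
    by (intro pip_All pip_imp rc rcf_comp[OF assms(2)])
qed

lemma list_choice: "(\<forall>i<n. \<exists>y. P i y) \<longleftrightarrow> (\<exists>l. \<forall>i<n. P i (lnth l i))"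
proof
  assume "\<forall>i<n. \<exists>y. P i y"
  then obtain f where f: "\<forall>i<n. P i (f i)" by metis
  then show "\<exists>l. \<forall>i<n. P i (lnth l i)"
    by (intro exI[of _ "list_encode (map f [0..<n])"]) (simp add: lnth_list_encode)
qed auto

text \<open>Collection: the finitely many witnesses are coded as one list, which brings the
  existential quantifier to the front. This is what later permits truncated universal quantifiers at
  no cost.\<close>

lemma sigp_bounded_All:
  assumes "sigp (Suc n) (\<lambda>z. P (pfst z) (psnd z))" "rcf f"
  shows "sigp (Suc n) (\<lambda>x. \<forall>y<f x. P x y)"
proof -
  obtain Q where Q: "pip n Q" "(\<lambda>z. P (pfst z) (psnd z)) = (\<lambda>x. \<exists>y. Q (pr x y))"
    using assms unfolding sigp_Suc by auto
  have "P x y \<longleftrightarrow> (\<exists>w. Q (pr (pr x y) w))" for x y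
    using fun_cong[OF Q(2), of "pr x y"] by simp
  then have "(\<lambda>x. \<forall>y<f x. P x y) = (\<lambda>x. \<exists>l. \<forall>y<f x. Q (pr (pr x y) (lnth l y)))"
    by (simp add: list_choice)
  moreover have "sigp (Suc n) (\<lambda>x. \<exists>l. \<forall>y<f x. Q (pr (pr x y) (lnth l y)))"
    by (intro sigp_ExI pip_bounded_All pip_comp[OF Q(1)] rc rcf_comp[OF assms(2)])
  ultimately show ?thesis by simp
qed

section \<open>A universal relation\<close>

inductive_cases reval_RZeroE: "reval RZero xs z"
inductive_cases reval_RSuccE: "reval RSucc xs z"
inductive_cases reval_RProjE: "reval (RProj i) xs z"
inductive_cases reval_RCompE: "reval (RComp f gs) xs z"
inductive_cases reval_RPrim0E: "reval (RPrim f g) (0 # xs) z"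
inductive_cases reval_RPrimSucE: "reval (RPrim f g) (Suc n # xs) z"
inductive_cases reval_RMuE: "reval (RMu f) xs z"

lemma reval_RComp:
  "reval (RComp f gs) xs z \<Longrightarrow> \<exists>ys. list_all2 (\<lambda>g y. reval g xs y) gs ys \<and> reval f ys z"
  by (erule reval_RCompE) (intro exI conjI)

lemma reval_RMu:
  "reval (RMu f) xs n \<Longrightarrow> reval f (n # xs) 0 \<and> (\<forall>m<n. \<exists>k>0. reval f (m # xs) k)"
  by (erule reval_RMuE) (intro allI impI conjI)

lemma reval_functional: "reval r xs z \<Longrightarrow> reval r xs z' \<Longrightarrow> z = z'"
proof (induction arbitrary: z' rule: reval.induct)
  case (zero xs)
  then show ?case by (elim reval_RZeroE) simp
next
  case (succ x)
  then show ?case by (elim reval_RSuccE) simp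
next
  case (proj i xs)
  then show ?case by (elim reval_RProjE) simp
next
  case (comp xs gs ys f z)
  obtain ys' where ys': "list_all2 (\<lambda>g y. reval g xs y) gs ys'" "reval f ys' z'"
    using reval_RComp[OF comp.prems] by (elim exE conjE) (rule that)
  have len: "length gs = length ys" "length gs = length ys'"
    using list_all2_lengthD[OF comp.IH(1)] list_all2_lengthD[OF ys'(1)] .
  have "ys = ys'"
  proof (rule nth_equalityI)
    show "length ys = length ys'" using len by simp
    fix i assume "i < length ys"
    with len have i: "i < length gs" by simp
    show "ys ! i = ys' ! i"
      using list_all2_nthD[OF comp.IH(1) i] list_all2_nthD[OF ys'(1) i] by blast
  qed
  then show ?case using comp.IH(2) ys'(2) by blast
next
  case (prim_0 f xs z g)
  from prim_0.prems have "reval f xs z'" by (elim reval_RPrim0E)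
  then show ?case by (rule prim_0.IH)
next
  case (prim_Suc f g n xs y z)
  from prim_Suc.prems obtain y' where y': "reval (RPrim f g) (n # xs) y'" "reval g (n # y' # xs) z'"
    by (elim reval_RPrimSucE) (rule that)
  then have "y = y'" by (intro prim_Suc.IH(1))
  then show ?case using y'(2) by (intro prim_Suc.IH(2)) simp
next
  case (mu f n xs)
  have z': "reval f (z' # xs) 0" "\<And>m. m < z' \<Longrightarrow> \<exists>k>0. reval f (m # xs) k"
    using reval_RMu[OF mu.prems] by simp_all
  show ?case
  \<comment> \<open>If the results differed, \<open>f\<close> would take both 0 and a positive value
    at the smaller one.\<close>
  proof (cases n z' rule: linorder_cases)
    case less
    with z'(2) obtain k where "k > 0" "reval f (n # xs) k" by blast
    then show ?thesis using mu.IH(1) by blast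
  next
    case greater
    with mu.IH(2) obtain k where "k > 0" "\<forall>y. reval f (z' # xs) y \<longrightarrow> k = y" by blast
    then show ?thesis using z'(1) by blast
  qed
qed

primrec rcode :: "recf \<Rightarrow> nat" where
  "rcode RZero = pr 0 0"
| "rcode RSucc = pr 1 0"
| "rcode (RProj i) = pr 2 i"
| "rcode (RComp f gs) = pr 3 (pr (rcode f) (list_encode (map rcode gs)))"
| "rcode (RPrim f g) = pr 4 (pr (rcode f) (rcode g))"
| "rcode (RMu f) = pr 5 (rcode f)"

text \<open>The triple \<open>(c, w, z)\<close> asserts that the program with code \<open>c\<close> returns \<open>z\<close> on the list with
  code \<open>w\<close>. It is justified by a set of such triples if it is the conclusion of a rule of
  \<^const>\<open>reval\<close> with premises in the set.\<close>

abbreviation triple :: "nat \<Rightarrow> nat \<Rightarrow> nat \<Rightarrow> nat" where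
  "triple c w z \<equiv> pr c (pr w z)"

abbreviation cons :: "nat \<Rightarrow> nat \<Rightarrow> nat" where
  "cons x l \<equiv> Suc (pr x l)"

definition justified :: "nat \<Rightarrow> nat \<Rightarrow> nat \<Rightarrow> nat set \<Rightarrow> bool" where
  "justified c w z S \<longleftrightarrow>
     pfst c = 0 \<and> z = 0 \<or>
     pfst c = 1 \<and> w \<noteq> 0 \<and> ltl w = 0 \<and> z = Suc (lhd w) \<or>
     pfst c = 2 \<and> psnd c < length (list_decode w) \<and> z = lnth w (psnd c) \<or>
     pfst c = 3 \<and> (\<exists>v\<in>S. pfst v = pfst (psnd c) \<and> psnd (psnd v) = z \<and>
       length (list_decode (pfst (psnd v))) = length (list_decode (psnd (psnd c))) \<and>
       (\<forall>i<length (list_decode (psnd (psnd c))).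
          \<exists>u\<in>S. u = triple (lnth (psnd (psnd c)) i) w (lnth (pfst (psnd v)) i))) \<or>
     pfst c = 4 \<and> w \<noteq> 0 \<and> lhd w = 0 \<and> (\<exists>u\<in>S. u = triple (pfst (psnd c)) (ltl w) z) \<or>
     pfst c = 4 \<and> w \<noteq> 0 \<and> lhd w \<noteq> 0 \<and>
       (\<exists>v\<in>S. pfst v = c \<and> pfst (psnd v) = cons (lhd w - 1) (ltl w) \<and>
         (\<exists>u\<in>S. u = triple (psnd (psnd c)) (cons (lhd w - 1) (cons (psnd (psnd v)) (ltl w))) z)) \<or>
     pfst c = 5 \<and> (\<exists>u\<in>S. u = triple (psnd c) (cons z w) 0) \<and>
       (\<forall>m<z. \<exists>v\<in>S. pfst v = psnd c \<and> pfst (psnd v) = cons m w \<and> psnd (psnd v) > 0)"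

lemma justified_mono: "justified c w z S \<Longrightarrow> S \<subseteq> T \<Longrightarrow> justified c w z T"
  unfolding justified_def by (elim disjE; simp) (blast+)

text \<open>Premises stand behind their conclusion, so that a derivation grows by consing and
  induction on the list is induction on proofs.\<close>

primrec derivation :: "nat list \<Rightarrow> bool" where
  "derivation [] \<longleftrightarrow> True"
| "derivation (v # d) \<longleftrightarrow>
     justified (pfst v) (pfst (psnd v)) (psnd (psnd v)) (set d) \<and> derivation d"

lemma derivation_append: "derivation d \<Longrightarrow> derivation d' \<Longrightarrow> derivation (d @ d')"
  by (induction d) (auto elim!: justified_mono)

lemma derivation_sound:
  "derivation d \<Longrightarrow> triple (rcode r) w z \<in> set d \<Longrightarrow> reval r (list_decode w) z"
proof (induction d arbitrary: r w z)
  case (Cons v d)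
  have IH: "reval r (list_decode w) z" if "triple (rcode r) w z \<in> set d" for r w z
    using Cons that by simp
  show ?case
  proof (cases "triple (rcode r) w z \<in> set d")
    case False
    then have v: "v = triple (rcode r) w z" using Cons.prems(2) by auto
    then have J: "justified (rcode r) w z (set d)" using Cons.prems(1) by simp
    have w: "w = cons (lhd w) (ltl w)" if "w \<noteq> 0"
      using that by (simp add: lhd_def ltl_def)
    show ?thesis
    proof (cases r)
      case RZero
      then show ?thesis using J by (auto simp: justified_def intro: reval.intros)
    next
      case RSucc
      then have "w \<noteq> 0" "ltl w = 0" "z = Suc (lhd w)" using J by (auto simp: justified_def)
      then have "list_decode w = [lhd w]" by (subst w) auto
      then show ?thesis using RSucc \<open>z = _\<close> by (auto intro: reval.succ)
    next
      case (RProj i)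
      then show ?thesis
        using J by (auto simp: justified_def lnth_list_decode[symmetric] intro: reval.proj)
    next
      case (RComp f gs)
      then obtain v where v: "v \<in> set d" "pfst v = rcode f" "psnd (psnd v) = z"
        "length (list_decode (pfst (psnd v))) = length gs"
        "\<And>i. i < length gs \<Longrightarrow>
          triple (lnth (list_encode (map rcode gs)) i) w (lnth (pfst (psnd v)) i) \<in> set d"
        using J by (auto simp: justified_def)
      have "triple (rcode f) (pfst (psnd v)) z \<in> set d"
        using v(1) unfolding v(2,3)[symmetric] by simp
      then have f: "reval f (list_decode (pfst (psnd v))) z" by (rule IH)
      have "reval (gs ! i) (list_decode w) (list_decode (pfst (psnd v)) ! i)" if "i < length gs" for i
        using v(4) v(5)[OF that] that by (intro IH) (simp add: lnth_list_encode lnth_list_decode)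
      then show ?thesis
        unfolding RComp using f v(4) by (intro reval.comp[OF _ f]) (simp add: list_all2_conv_all_nth)
    next
      case (RPrim f g)
      show ?thesis
      proof (cases "lhd w")
        case 0
        then have "w \<noteq> 0" "triple (rcode f) (ltl w) z \<in> set d"
          using J RPrim by (auto simp: justified_def)
        then show ?thesis
          using 0 RPrim by (subst w) (auto intro: reval.prim_0 IH)
      next
        case (Suc n)
        then obtain v where v: "w \<noteq> 0" "v \<in> set d" "pfst v = rcode r" "pfst (psnd v) = cons n (ltl w)"
          "triple (rcode g) (cons n (cons (psnd (psnd v)) (ltl w))) z \<in> set d"
          using J RPrim by (auto simp: justified_def)
        have "triple (rcode r) (cons n (ltl w)) (psnd (psnd v)) \<in> set d"
          using v(2) unfolding v(3,4)[symmetric] by simp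
        from IH[OF this] IH[OF v(5)] v(1) show ?thesis
          using Suc RPrim by (subst w) (auto intro: reval.prim_Suc)
      qed
    next
      case (RMu f)
      have "reval f (z # list_decode w) 0"
        using IH[of f "cons z w" 0] J RMu by (auto simp: justified_def)
      moreover have "\<exists>k>0. reval f (m # list_decode w) k" if "m < z" for m
      proof -
        obtain v where v: "v \<in> set d" "pfst v = rcode f" "pfst (psnd v) = cons m w" "psnd (psnd v) > 0"
          using J RMu \<open>m < z\<close> by (auto simp: justified_def)
        have "triple (rcode f) (cons m w) (psnd (psnd v)) \<in> set d"
          using v(1) unfolding v(2,3)[symmetric] by simp
        from IH[OF this] v(4) show ?thesis by auto
      qed
      ultimately show ?thesis unfolding RMu by (rule reval.mu)
    qed
  qed (rule IH)
qed simp

text \<open>The separate derivations can be concatenated because \<open>P i\<close> is monotone. It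
  gathers the argument values of a composition and the earlier values of a minimization.\<close>

lemma derivation_collect:
  fixes n :: nat
  assumes "\<And>i. i < n \<Longrightarrow> \<exists>d. derivation d \<and> P i (set d)"
    and "\<And>i S T. P i S \<Longrightarrow> S \<subseteq> T \<Longrightarrow> P i T"
  shows "\<exists>d. derivation d \<and> (\<forall>i<n. P i (set d))"
proof -
  have "\<exists>d. derivation d \<and> (\<forall>i<m. P i (set d))" if "m \<le> n" for m
    using that
  proof (induction m)
    case 0
    show ?case by (intro exI[of _ "[]"]) simp
  next
    case (Suc m)
    then obtain d d' where d: "derivation d" "\<forall>i<m. P i (set d)" "derivation d'" "P m (set d')"
      using assms(1)[of m] by auto
    have "P i (set (d @ d'))" if "i < Suc m" for i
      using d(2,4) that
      by (cases "i = m") (auto simp: less_Suc_eq elim: assms(2) simp del: Un_iff)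
    then show ?case
      using derivation_append[OF d(1,3)] by blast
  qed
  then show ?thesis by simp
qed

lemma derivation_step:
  assumes "derivation d" "justified c w z (set d)"
  shows "\<exists>d. derivation d \<and> triple c w z \<in> set d"
  using assms by (intro exI[of _ "triple c w z # d"]) simp

lemma derivation_complete:
  "reval r xs z \<Longrightarrow> \<exists>d. derivation d \<and> triple (rcode r) (list_encode xs) z \<in> set d"
proof (induction rule: reval.induct)
  case (zero xs)
  show ?case by (rule derivation_step[of "[]"]) (simp_all add: justified_def)
next
  case (succ x)
  show ?case by (rule derivation_step[of "[]"]) (simp_all add: justified_def)
next
  case (proj i xs)
  then show ?case
    by (intro derivation_step[of "[]"]) (simp_all add: justified_def lnth_list_encode)
next
  case (comp xs gs ys f z)
  let ?P = "\<lambda>i S. triple (rcode (gs ! i)) (list_encode xs) (ys ! i) \<in> S"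
  have len: "length gs = length ys" using comp.IH(1) by (rule list_all2_lengthD)
  have "\<exists>d. derivation d \<and> (\<forall>i<length gs. ?P i (set d))"
    using comp.IH(1) by (intro derivation_collect) (auto simp: list_all2_conv_all_nth)
  then obtain d where d: "derivation d" "\<And>i. i < length gs \<Longrightarrow> ?P i (set d)" by blast
  obtain d' where d': "derivation d'" "triple (rcode f) (list_encode ys) z \<in> set d'"
    using comp.IH(2) by blast
  show ?case
  proof (rule derivation_step[OF derivation_append[OF d(1) d'(1)]])
    show "justified (rcode (RComp f gs)) (list_encode xs) z (set (d @ d'))"
      using d(2) d'(2) len
      by (auto simp: justified_def lnth_list_encode
          intro!: bexI[of _ "triple (rcode f) (list_encode ys) z"])
  qed
next
  case (prim_0 f xs z g)
  then obtain d where "derivation d" "triple (rcode f) (list_encode xs) z \<in> set d" by blast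
  then show ?case by (intro derivation_step[of d]) (simp_all add: justified_def)
next
  case (prim_Suc f g n xs y z)
  then obtain d d' where d: "derivation d" "triple (rcode (RPrim f g)) (list_encode (n # xs)) y \<in> set d"
    and d': "derivation d'" "triple (rcode g) (list_encode (n # y # xs)) z \<in> set d'" by blast
  show ?case
  proof (rule derivation_step[OF derivation_append[OF d(1) d'(1)]])
    show "justified (rcode (RPrim f g)) (list_encode (Suc n # xs)) z (set (d @ d'))"
      using d(2) d'(2)
      by (auto simp: justified_def
          intro!: bexI[of _ "triple (rcode (RPrim f g)) (list_encode (n # xs)) y"])
  qed
next
  case (mu f n xs)
  let ?P = "\<lambda>m S. \<exists>k>0. triple (rcode f) (list_encode (m # xs)) k \<in> S"
  have "\<exists>d. derivation d \<and> (\<forall>m<n. ?P m (set d))"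
    using mu.IH(2) by (intro derivation_collect) (blast+)
  then obtain d where d: "derivation d" "\<And>m. m < n \<Longrightarrow> ?P m (set d)" by blast
  obtain d' where d': "derivation d'" "triple (rcode f) (list_encode (n # xs)) 0 \<in> set d'"
    using mu.IH(1) by blast
  show ?case
  proof (rule derivation_step[OF derivation_append[OF d(1) d'(1)]])
    have "\<exists>v\<in>set (d @ d'). pfst v = rcode f \<and> pfst (psnd v) = cons m (list_encode xs) \<and> psnd (psnd v) > 0"
      if m: "m < n" for m
    proof -
      obtain k where "k > 0" "triple (rcode f) (list_encode (m # xs)) k \<in> set d" using d(2)[OF m] by blast
      then show ?thesis by (intro bexI[of _ "triple (rcode f) (list_encode (m # xs)) k"]) auto
    qed
    then show "justified (rcode (RMu f)) (list_encode xs) n (set (d @ d'))"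
      using d'(2) by (auto simp: justified_def)
  qed
qed

section \<open>Kleene's predicate and the universal relations\<close>

text \<open>A derivation plays the role of the computation history; \<open>cons x 0\<close> codes
  the argument list \<open>[x]\<close>, and the output is left open because only halting
  matters.\<close>

definition halts_in :: "nat \<Rightarrow> nat \<Rightarrow> nat \<Rightarrow> bool" where
  "halts_in d e x \<longleftrightarrow> derivation (list_decode d) \<and>
     (\<exists>v\<in>set (list_decode d). pfst v = e \<and> pfst (psnd v) = cons x 0)"

lemma Ex_halts_in: "(\<exists>d. halts_in d (rcode r) x) \<longleftrightarrow> (\<exists>z. reval r [x] z)"
proof
  assume "\<exists>d. halts_in d (rcode r) x"
  then obtain d v where d: "derivation (list_decode d)" and v: "v \<in> set (list_decode d)"
    "pfst v = rcode r" "pfst (psnd v) = cons x 0" by (auto simp: halts_in_def)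
  have "triple (rcode r) (cons x 0) (psnd (psnd v)) \<in> set (list_decode d)"
    using v(1) unfolding v(2,3)[symmetric] by simp
  from derivation_sound[OF d this] show "\<exists>z. reval r [x] z" by auto
next
  assume "\<exists>z. reval r [x] z"
  then obtain z d where d: "derivation d" "triple (rcode r) (list_encode [x]) z \<in> set d"
    using derivation_complete by blast
  have "halts_in (list_encode d) (rcode r) x"
    unfolding halts_in_def using d(1)
    by (auto intro!: bexI[OF _ d(2)])
  then show "\<exists>d. halts_in d (rcode r) x" ..
qed

text \<open>All quantifiers in \<open>justified\<close> are bounded or range over \<open>S\<close>;
  membership is spelled \<open>\<exists>u\<in>S. u = _\<close> there so that the rules
  \<open>rc\<close> apply.\<close>

lemma rcp_justified:
  assumes "rcf f" "rcf g" "rcf h" "rcf d"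
  shows "rcp (\<lambda>x. justified (f x) (g x) (h x) (set (list_decode (d x))))"
proof -
  have "rcp4 (\<lambda>c w z d. justified c w z (set (list_decode d)))"
    unfolding justified_def by (intro rc)
  from rcp4_app[OF this assms] show ?thesis .
qed

lemma rcp_derivation [rc]:
  assumes "rcf f" shows "rcp (\<lambda>x. derivation (list_decode (f x)))"
proof -
  have 1: "rcf2 (\<lambda>p l. if derivation (list_decode l) then 1 else 0)"
    by (rule rcf_list_rec[where F = "\<lambda>p l. if derivation l then 1 else 0" and a = "\<lambda>p. 1"
          and h = "\<lambda>p v l y. if justified (pfst v) (pfst (psnd v)) (psnd (psnd v))
            (set (list_decode l)) then y else 0"])
      (auto intro!: rc rcp_justified)
  from rcf2_app[OF 1 assms assms] show ?thesis by (simp add: rcp_def)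
qed

lemma rcp_halts_in [rc]: "rcf f \<Longrightarrow> rcf g \<Longrightarrow> rcf h \<Longrightarrow> rcp (\<lambda>x. halts_in (f x) (g x) (h x))"
  by (rule rcp3_app) (unfold halts_in_def, intro rc)

text \<open>A predicate \<open>\<exists>y. Q\<close> is the halting domain of the unbounded search
  for a witness.\<close>

lemma universal_halting:
  assumes "sigp (Suc 0) P" shows "\<exists>e. \<forall>x. P x \<longleftrightarrow> (\<exists>d. halts_in d e x)"
proof -
  obtain Q where Q: "rcp Q" and P: "P = (\<lambda>x. \<exists>y. Q (pr x y))"
    using assms unfolding sigp_Suc pip_0 by blast
  \<comment> \<open>\<open>RMu\<close> searches its first argument for the value 0, hence the order
    of \<open>y\<close> and \<open>x\<close> and the inverted truth values.\<close>
  have "rcf2 (\<lambda>y x. if Q (pr x y) then 0 else 1)"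
    by (intro rc rcp_comp[OF Q])
  then have "computable 2 (\<lambda>xs. if Q (pr (xs ! 1) (xs ! 0)) then 0 else 1)"
    by (rule computable2_rcf2[of "\<lambda>y x. if Q (pr x y) then 0 else 1", THEN iffD1])
  then obtain f where "\<forall>xs. length xs = 2 \<longrightarrow> reval f xs (if Q (pr (xs ! 1) (xs ! 0)) then 0 else 1)"
    unfolding computable_def by blast
  then have f: "reval f [y, x] (if Q (pr x y) then 0 else 1)" for y x
    by (auto dest!: spec[of _ "[y, x]"])
  have "P x \<longleftrightarrow> (\<exists>z. reval (RMu f) [x] z)" for x
  proof
    assume "P x"
    then have ex: "\<exists>y. Q (pr x y)" unfolding P .
    define n where "n = (LEAST y. Q (pr x y))"
    have "reval f [n, x] 0"
      using f[of n x] LeastI_ex[OF ex] by (simp add: n_def)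
    moreover have "\<exists>k>0. reval f [m, x] k" if "m < n" for m
      using f[of m x] not_less_Least[OF that[unfolded n_def]] by auto
    ultimately show "\<exists>z. reval (RMu f) [x] z" using reval.mu by blast
  next
    assume "\<exists>z. reval (RMu f) [x] z"
    then obtain z where "reval f [z, x] 0" using reval_RMu by blast
    from reval_functional[OF this f] show "P x"
      unfolding P by (auto split: if_splits)
  qed
  then show ?thesis using Ex_halts_in by blast
qed

text \<open>Level \<open>n\<close> is universal for \<open>Sigma0 (Suc n)\<close>. Quantified values
  are consed onto the input, so that in the end they form one list with it, to be matched by the
  argument list of a predicate.\<close>

fun univ_rel :: "nat \<Rightarrow> nat \<Rightarrow> nat \<Rightarrow> bool" where
  "univ_rel 0 e x \<longleftrightarrow> (\<exists>d. halts_in d e x)"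
| "univ_rel (Suc n) e x \<longleftrightarrow> (\<exists>y. \<not> univ_rel n e (cons y x))"

text \<open>The matrix of a predicate one level up is \<open>pip (Suc n)\<close>; its complement is
  covered by the induction hypothesis, with \<open>lhd\<close> and \<open>ltl\<close> recovering
  quantified value and input.\<close>

lemma universal: "sigp (Suc n) P \<Longrightarrow> \<exists>e. \<forall>x. P x \<longleftrightarrow> univ_rel n e x"
proof (induction n arbitrary: P)
  case 0
  then show ?case using universal_halting by simp
next
  case (Suc n)
  then obtain Q where Q: "pip (Suc n) Q" and P: "P = (\<lambda>x. \<exists>y. Q (pr x y))"
    unfolding sigp_Suc[of "Suc n"] by blast
  have "sigp (Suc n) (\<lambda>z. \<not> Q (pr (ltl z) (lhd z)))"
    by (intro sigp_not pip_comp[OF Q] rc)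
  from Suc.IH[OF this] obtain e where e: "\<And>z. \<not> Q (pr (ltl z) (lhd z)) \<longleftrightarrow> univ_rel n e z" by blast
  have "\<not> Q (pr x y) \<longleftrightarrow> univ_rel n e (cons y x)" for x y
    using e[of "cons y x"] by simp
  then have "\<forall>x. P x \<longleftrightarrow> univ_rel (Suc n) e x"
    unfolding P by auto
  then show ?case ..
qed

section \<open>The structure\<close>

text \<open>Running the search up to stage \<open>s\<close> determines this real within
  \<open>2^-s\<close>, although it vanishes exactly if the program never halts.\<close>

definition halting_value :: "nat \<Rightarrow> real" where
  "halting_value x = (if \<exists>d. halts_in d (pfst x) (psnd x)
     then 1 / 2 ^ (LEAST d. halts_in d (pfst x) (psnd x)) else 0)"

text \<open>The arguments of \<open>pred_value (d # e # k # l)\<close> are the innermost quantified variable \<open>d\<close>, the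
  pair \<open>e\<close> of a program and a bit that selects which outcome counts as true, the exponent \<open>k\<close>, and
  the input \<open>l\<close> of the program.\<close>

fun pred_value :: "nat list \<Rightarrow> real" where
  "pred_value [x] = halting_value x"
| "pred_value (d # e # k # l) =
     (if halts_in d (pfst e) (list_encode l) \<longleftrightarrow> psnd e = 1 then 1 / 2 ^ k else 1)"
| "pred_value [] = 0"
| "pred_value [x, y] = 0"

text \<open>Predicate symbol \<open>P\<close> has arity \<open>P + 1\<close>, so each positive arity
  occurs once. The modulus 0 asks for distance below 1, which means equality in the discrete
  metric.\<close>

definition arith_lang :: metric_lang where
  "arith_lang = \<lparr>fun_syms = UNIV, fun_arity = (\<lambda>_. 0), fun_modulus = (\<lambda>_ _. 0),
     pred_syms = UNIV, pred_arity = Suc, pred_modulus = (\<lambda>_ _. 0)\<rparr>"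

text \<open>The theorem asks for a universe of reals; \<open>nat \<lfloor>r\<rfloor>\<close>
  recovers the number from its image in \<open>\<nat>\<close>.\<close>

definition arith_struct :: "real metric_struct" where
  "arith_struct = \<lparr>universe = \<nat>, metric = (\<lambda>x y. if x = y then 0 else 1),
     fun_interp = (\<lambda>f _. real f), pred_interp = (\<lambda>_ xs. pred_value (map (\<lambda>r. nat \<lfloor>r\<rfloor>) xs))\<rparr>"

lemma arith_lang_simps [simp]:
  "fun_syms arith_lang = UNIV" "fun_arity arith_lang f = 0" "fun_modulus arith_lang f k = 0"
  "pred_syms arith_lang = UNIV" "pred_arity arith_lang P = Suc P" "pred_modulus arith_lang P k = 0"
  by (simp_all add: arith_lang_def)

lemma arith_struct_simps [simp]:
  "universe arith_struct = \<nat>" "metric arith_struct x y = (if x = y then 0 else 1)"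
  "fun_interp arith_struct f xs = real f" "pred_interp arith_struct P xs = pred_value (map (\<lambda>r. nat \<lfloor>r\<rfloor>) xs)"
  by (simp_all add: arith_struct_def)

lemma metric_language_arith_lang: "metric_language arith_lang"
  by (simp add: metric_language_def)

lemma computable_rcf: "rcf f \<Longrightarrow> computable 1 (\<lambda>xs. f (xs ! 0))"
  by (simp add: rcf_def)

lemma effectively_numbered_arith_lang: "effectively_numbered arith_lang"
  unfolding effectively_numbered_def computable_set_rcp arith_lang_simps by (intro conjI computable_rcf) (simp_all add: rcp_const rcf_Suc rcf_id rcf_const)

lemma uniformly_computable_moduli_arith_lang: "uniformly_computable_moduli arith_lang"
  unfolding uniformly_computable_moduli_def by (simp add: computable_zero)

lemma pred_value_bounds: "0 \<le> pred_value xs \<and> pred_value xs \<le> 1"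
  by (induction xs rule: pred_value.induct) (auto simp: halting_value_def)

lemma list_eq_of_dist:
  assumes "length xs = n" "length ys = n" "\<forall>i<n. (if xs ! i = ys ! i then 0 else 1 :: real) < 1"
  shows "xs = ys"
  using assms by (intro nth_equalityI) (auto split: if_splits)

lemma metric_structure_arith_struct: "metric_structure arith_lang arith_struct"
proof -
  interpret discrete_metric "\<nat> :: real set" .
  have dd: "dd = metric arith_struct"
    by (simp add: dd_def fun_eq_iff)
  have M: "Metric_space (universe arith_struct) (metric arith_struct)" "Metric_space.mcomplete (universe arith_struct) (metric arith_struct)"
    using disc.Metric_space_axioms mcomplete_discrete_metric unfolding dd by simp_all
  show ?thesis
    unfolding metric_structure_def arith_lang_simps
  proof (intro conjI ballI allI impI M)
    show "universe arith_struct \<noteq> {}" by (auto intro: exI[of _ 0])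
  next
    fix P k and xs ys :: "real list"
    assume "length xs = Suc P \<and> length ys = Suc P \<and>
      (\<forall>i<Suc P. metric arith_struct (xs ! i) (ys ! i) < 1 / 2 ^ 0)"
    then have "xs = ys" by (intro list_eq_of_dist[of xs "Suc P" ys]) auto
    then show "\<bar>pred_interp arith_struct P xs - pred_interp arith_struct P ys\<bar> \<le> 1 / 2 ^ k" by simp
  qed (simp_all add: pred_value_bounds)
qed

section \<open>Values under assignments of natural numbers\<close>

primrec teval :: "(nat \<Rightarrow> nat) \<Rightarrow> mterm \<Rightarrow> nat" where
  "teval e (Var i) = e i"
| "teval e (App f ts) = f"

definition val :: "(nat \<Rightarrow> nat) \<Rightarrow> mformula \<Rightarrow> real" where
  "val e \<phi> = formula_value arith_struct (\<lambda>i. real (e i)) \<phi>"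

lemma term_value_arith_struct: "term_value arith_struct (\<lambda>i. real (e i)) t = real (teval e t)"
  by (cases t) simp_all

lemma formula_value_upd: "formula_value arith_struct ((\<lambda>i. real (e i))(x := real a)) \<phi> = val (e(x := a)) \<phi>"
  unfolding val_def by (rule arg_cong[where f = "\<lambda>f. formula_value arith_struct f \<phi>"]) auto

lemma val_simps [simp]:
  "val e (DistF s t) = (if teval e s = teval e t then 0 else 1)"
  "val e (PredF P ts) = pred_value (map (teval e) ts)"
  "val e (NegF \<phi>) = 1 - val e \<phi>"
  "val e (HalfF \<phi>) = val e \<phi> / 2"
  "val e (MinusF \<phi> \<psi>) = max 0 (val e \<phi> - val e \<psi>)"
  "val e (SupF x \<phi>) = (SUP a. val (e(x := a)) \<phi>)"
  "val e (InfF x \<phi>) = (INF a. val (e(x := a)) \<phi>)"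
  by (simp_all add: val_def[of e] term_value_arith_struct Nats_def image_image formula_value_upd comp_def)

lemma val_bounds: "0 \<le> val e \<phi> \<and> val e \<phi> \<le> 1"
proof (induction \<phi> arbitrary: e)
  case (SupF x \<phi>)
  then have "bdd_above (range (\<lambda>a. val (e(x := a)) \<phi>))" by (auto intro!: bdd_aboveI)
  then show ?case using SupF by (auto intro!: cSUP_least cSUP_upper2)
next
  case (InfF x \<phi>)
  then have "bdd_below (range (\<lambda>a. val (e(x := a)) \<phi>))" by (auto intro!: bdd_belowI)
  then show ?case using InfF by (auto intro!: cINF_greatest cINF_lower2)
qed (auto simp: pred_value_bounds, (smt (verit))+)

lemma bdd_val:
  "bdd_above (range (\<lambda>a. val (e a) \<phi>))" "bdd_below (range (\<lambda>a. val (e a) \<phi>))"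
  using val_bounds by (auto intro!: bdd_aboveI bdd_belowI)

text \<open>Here and in \<open>val_InfF_less\<close> the comparison commutes with the quantifier.
  The other two combinations fail when the bound is not attained, which is where the extra
  alternation arises.\<close>

lemma val_SupF_le: "val e (SupF x \<phi>) \<le> r \<longleftrightarrow> (\<forall>a. val (e(x := a)) \<phi> \<le> r)"
  by (simp add: cSUP_le_iff bdd_val)

lemma val_InfF_less: "val e (InfF x \<phi>) < r \<longleftrightarrow> (\<exists>a. val (e(x := a)) \<phi> < r)"
  by (simp add: cINF_less_iff bdd_val)

lemma teval_cong: "(\<And>i. i \<in> term_vars t \<Longrightarrow> e i = e' i) \<Longrightarrow> teval e t = teval e' t"
  by (cases t) auto

lemma val_cong: "(\<And>i. i \<in> free_vars \<phi> \<Longrightarrow> e i = e' i) \<Longrightarrow> val e \<phi> = val e' \<phi>"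
proof (induction \<phi> arbitrary: e e')
  case (DistF s t)
  then have "teval e s = teval e' s" "teval e t = teval e' t" by (auto intro!: teval_cong)
  then show ?case by simp
next
  case (PredF P ts)
  then have "map (teval e) ts = map (teval e') ts" by (auto intro!: teval_cong)
  then show ?case by (simp only: val_simps)
next
  case (NegF \<phi>)
  then show ?case by (metis val_simps(3) free_vars.simps(3))
next
  case (HalfF \<phi>)
  then show ?case by (metis val_simps(4) free_vars.simps(4))
next
  case (MinusF \<phi> \<psi>)
  have "val e \<phi> = val e' \<phi>" "val e \<psi> = val e' \<psi>"
    using MinusF.prems by (auto intro!: MinusF.IH)
  then show ?case by simp
next
  case (SupF x \<phi>)
  have "val (e(x := a)) \<phi> = val (e'(x := a)) \<phi>" for a
    using SupF.prems by (auto intro!: SupF.IH)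
  then show ?case by simp
next
  case (InfF x \<phi>)
  have "val (e(x := a)) \<phi> = val (e'(x := a)) \<phi>" for a
    using InfF.prems by (auto intro!: InfF.IH)
  then show ?case by simp
qed

text \<open>The free choice of \<open>e\<close> is used twice: hardness takes \<open>id\<close>, the
  upper bounds take the assignment with code 0.\<close>

lemma sentence_value_arith_struct:
  assumes "sentence arith_lang \<phi>" shows "sentence_value arith_struct \<phi> = val e \<phi>"
proof -
  have "(SOME a. a \<in> (\<nat> :: real set)) \<in> \<nat>" by (rule someI[of _ 0]) simp
  then obtain n where "(SOME a. a \<in> (\<nat> :: real set)) = real n" by (auto elim: Nats_cases)
  then have "sentence_value arith_struct \<phi> = val (\<lambda>_. n) \<phi>" by (simp add: sentence_value_def val_def)
  also have "\<dots> = val e \<phi>" using assms by (intro val_cong) (simp add: sentence_def)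
  finally show ?thesis .
qed

section \<open>Hardness\<close>

text \<open>Diagrams are sets of codes, so only injectivity of the coding turns membership of a code
  back into a statement about one sentence and one rational.\<close>

lemma term_code_inj: "term_code s = term_code t \<Longrightarrow> s = t"
proof (induction s arbitrary: t)
  case (Var i)
  then show ?case by (cases t) auto
next
  case (App f ts)
  then obtain g us where t: "t = App g us" by (cases t) auto
  with App.prems have "f = g" "map term_code ts = map term_code us"
    by (auto simp: list_encode_eq)
  moreover have "ts = us" if "map term_code ts = map term_code us"
    using that App.IH
  proof (induction ts arbitrary: us)
    case (Cons x ts)
    then show ?case by (cases us) auto
  qed simp
  ultimately show ?case by (simp add: t)
qed

lemma map_term_code_inj: "map term_code ts = map term_code us \<Longrightarrow> ts = us"
  by (rule map_injective) (auto intro: injI term_code_inj)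

lemma formula_code_inj: "formula_code \<phi> = formula_code \<psi> \<Longrightarrow> \<phi> = \<psi>"
proof (induction \<phi> arbitrary: \<psi>)
  case (DistF s t)
  then show ?case by (cases \<psi>) (auto dest: term_code_inj)
next
  case (PredF P ts)
  then show ?case by (cases \<psi>) (auto simp: list_encode_eq dest: map_term_code_inj)
next
  case (NegF \<phi>)
  then show ?case by (cases \<psi>) auto
next
  case (HalfF \<phi>)
  then show ?case by (cases \<psi>) auto
next
  case (MinusF \<phi>1 \<phi>2)
  then show ?case by (cases \<psi>) auto
next
  case (SupF x \<phi>)
  then show ?case by (cases \<psi>) auto
next
  case (InfF x \<phi>)
  then show ?case by (cases \<psi>) auto
qed

lemma quotient_of_nonneg:
  assumes "0 \<le> r" shows "0 \<le> fst (quotient_of r)"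
proof (rule ccontr)
  assume "\<not> 0 \<le> fst (quotient_of r)"
  then have "rat_of_int (fst (quotient_of r)) / rat_of_int (snd (quotient_of r)) < 0"
    using quotient_of_denom_pos'[of r] by (intro divide_neg_pos) simp_all
  with quotient_of_div[of r "fst (quotient_of r)" "snd (quotient_of r)"] assms show False by simp
qed

lemma rat_code_inj:
  assumes "rat_code p = rat_code q" "0 \<le> p" "0 \<le> q" shows "p = q"
proof -
  note nn = quotient_of_nonneg quotient_of_denom_pos'
  have "fst (quotient_of p) = fst (quotient_of q)" "snd (quotient_of p) = snd (quotient_of q)"
    using assms nn(1)[of p] nn(1)[of q] nn(2)[of p] nn(2)[of q]
    unfolding rat_code_def by (auto simp: eq_nat_nat_iff)
  then have "quotient_of p = quotient_of q" by (simp add: prod_eq_iff)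
  then show ?thesis by (simp add: quotient_of_inject_eq)
qed

text \<open>In all reductions the threshold \<open>q\<close> stays fixed and only the sentence
  varies with \<open>x\<close>.\<close>

lemma diagram_hard:
  assumes "rcf (\<lambda>x. formula_code (\<Phi> x))" "\<And>x. sentence arith_lang (\<Phi> x)" "\<And>x. C (\<Phi> x)"
    and "0 \<le> q" "q \<le> 1"
  shows "(\<And>x. x \<in> A \<longleftrightarrow> val id (\<Phi> x) \<le> of_rat q) \<Longrightarrow> many_one_reducible A (closed_diagram arith_lang arith_struct C)"
    and "(\<And>x. x \<in> A \<longleftrightarrow> val id (\<Phi> x) < of_rat q) \<Longrightarrow> many_one_reducible A (open_diagram arith_lang arith_struct C)"
proof -
  let ?f = "\<lambda>x. pr (formula_code (\<Phi> x)) (rat_code q)"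
  have f: "computable 1 (\<lambda>xs. ?f (xs ! 0))"
    by (intro computable_rcf rc assms)
  have sv: "sentence_value arith_struct (\<Phi> x) = val id (\<Phi> x)" for x
    using assms(2) by (rule sentence_value_arith_struct)
  {
    assume *: "\<And>x. x \<in> A \<longleftrightarrow> val id (\<Phi> x) \<le> of_rat q"
    have "?f x \<in> closed_diagram arith_lang arith_struct C \<longleftrightarrow> x \<in> A" for x
      using assms unfolding closed_diagram_def * sv[symmetric]
      by (auto dest!: formula_code_inj dest: rat_code_inj)
    then show "many_one_reducible A (closed_diagram arith_lang arith_struct C)"
      unfolding many_one_reducible_def using f by (intro exI[of _ "\<lambda>xs. ?f (xs ! 0)"]) simp
  next
    assume *: "\<And>x. x \<in> A \<longleftrightarrow> val id (\<Phi> x) < of_rat q"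
    have "?f x \<in> open_diagram arith_lang arith_struct C \<longleftrightarrow> x \<in> A" for x
      using assms unfolding open_diagram_def * sv[symmetric]
      by (auto dest!: formula_code_inj dest: rat_code_inj)
    then show "many_one_reducible A (open_diagram arith_lang arith_struct C)"
      unfolding many_one_reducible_def using f by (intro exI[of _ "\<lambda>xs. ?f (xs ! 0)"]) simp
  }
qed

section \<open>Sentences that express the universal relations\<close>

definition quantifier :: "bool \<Rightarrow> nat \<Rightarrow> mformula \<Rightarrow> mformula" where
  "quantifier b = (if b then InfF else SupF)"

definition literal :: "bool \<Rightarrow> mformula \<Rightarrow> mformula" where
  "literal neg \<phi> = (if neg then NegF \<phi> else \<phi>)"

text \<open>\<open>n + 1\<close> alternating quantifiers, the first one an infimum iff \<open>b\<close>, applied to a predicate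
  that takes just the two values \<open>2\<^sup>-\<^sup>k\<close> and \<open>1\<close> (subtracted from \<open>1\<close> if \<open>neg\<close>), where \<open>k\<close> is the
  value of the term \<open>kt\<close>.\<close>

primrec game :: "nat \<Rightarrow> bool \<Rightarrow> bool \<Rightarrow> nat \<Rightarrow> mterm \<Rightarrow> nat \<Rightarrow> mterm list \<Rightarrow> mformula" where
  "game 0 b neg e kt i ts =
     quantifier b i (literal neg (PredF (Suc (Suc (length ts))) (Var i # App e [] # kt # ts)))"
| "game (Suc n) b neg e kt i ts = quantifier b i (game n (\<not> b) neg e kt (Suc i) (Var i # ts))"

text \<open>With two values the infimum is attained and acts as an existential quantifier; dually
  for the supremum.\<close>

lemma INF_two_values:
  assumes "X \<le> (Y :: real)"
  shows "(INF a. if P a then X else Y) = (if \<exists>a. P a then X else Y)"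
proof (cases "\<exists>a. P a")
  case True
  then obtain a where a: "P a" ..
  have "(INF a. if P a then X else Y) \<le> (if P a then X else Y)"
    using assms by (intro cINF_lower bdd_belowI[of _ X]) auto
  moreover have "X \<le> (INF a. if P a then X else Y)"
    using assms by (intro cINF_greatest) auto
  ultimately show ?thesis using a True by auto
qed simp

lemma SUP_two_values:
  assumes "X \<le> (Y :: real)"
  shows "(SUP a. if P a then X else Y) = (if \<forall>a. P a then X else Y)"
proof (cases "\<forall>a. P a")
  case False
  then obtain a where a: "\<not> P a" by blast
  have "(if P a then X else Y) \<le> (SUP a. if P a then X else Y)"
    using assms by (intro cSUP_upper bdd_aboveI[of _ Y]) auto
  moreover have "(SUP a. if P a then X else Y) \<le> Y"
    using assms by (intro cSUP_least) auto
  ultimately show ?thesis using a False by auto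
qed simp

lemma map_teval_upd:
  assumes "\<Union>(term_vars ` set ts) \<subseteq> {..<i}"
  shows "map (teval (env(i := a))) ts = map (teval env) ts"
  using assms by (auto intro!: teval_cong)

text \<open>Flipping \<open>b\<close> at each level matches the complementation in
  \<open>univ_rel\<close>. The innermost quantifier is an infimum iff \<open>b = even n\<close>;
  exactly then halting must produce the lower value, which fixes the bit \<open>d\<close>, reversed
  under \<open>neg\<close>. The bound \<open>i\<close> on the variables in use keeps the quantified
  ones fresh.\<close>

lemma val_game:
  assumes "\<Union>(term_vars ` set (kt # ts)) \<subseteq> {..<i}" "d = 1 \<longleftrightarrow> (b = even n) \<noteq> neg"
  shows "val env (game n b neg (pr e d) kt i ts) =
    (if univ_rel n e (list_encode (map (teval env) ts)) = b
     then (if neg then 0 else 1 / 2 ^ teval env kt)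
     else (if neg then 1 - 1 / 2 ^ teval env kt else 1))"
  using assms
proof (induction n arbitrary: b i ts env)
  case 0
  let ?lo = "1 / 2 ^ teval env kt :: real"
  let ?X = "if neg then 0 else ?lo" and ?Y = "if neg then 1 - ?lo else 1"
  let ?w = "list_encode (map (teval env) ts)"
  have k: "teval (env(i := a)) kt = teval env kt" for a
    using 0(1) by (intro teval_cong) auto
  have ts: "map (teval (env(i := a))) ts = map (teval env) ts" for a
    using 0(1) by (intro map_teval_upd) auto
  have atom: "val (env(i := a)) (literal neg (PredF P (Var i # App (pr e d) [] # kt # ts))) =
      (if halts_in a e ?w = b then ?X else ?Y)" for a P
  proof -
    have "val (env(i := a)) (PredF P (Var i # App (pr e d) [] # kt # ts)) =
        (if halts_in a e ?w \<longleftrightarrow> d = 1 then ?lo else 1)"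
      unfolding val_simps list.map k ts by simp
    then show ?thesis
      using 0(2) by (cases b; cases neg; cases "d = 1") (simp_all add: literal_def)
  qed
  have XY: "?X \<le> ?Y" by simp
  show ?case
    by (cases b) (simp_all only: game.simps quantifier_def if_True if_False val_simps atom
        INF_two_values[OF XY] SUP_two_values[OF XY] univ_rel.simps, auto)
next
  case (Suc n)
  let ?lo = "1 / 2 ^ teval env kt :: real"
  let ?X = "if neg then 0 else ?lo" and ?Y = "if neg then 1 - ?lo else 1"
  let ?w = "list_encode (map (teval env) ts)"
  have k: "teval (env(i := a)) kt = teval env kt" for a
    using Suc.prems(1) by (intro teval_cong) auto
  have ts: "map (teval (env(i := a))) ts = map (teval env) ts" for a
    using Suc.prems(1) by (intro map_teval_upd) auto
  have IH: "val (env(i := a)) (game n (\<not> b) neg (pr e d) kt (Suc i) (Var i # ts)) =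
      (if univ_rel n e (cons a ?w) = (\<not> b) then ?X else ?Y)" for a
  proof -
    have "\<Union>(term_vars ` set (kt # Var i # ts)) \<subseteq> {..<Suc i}"
      using Suc.prems(1) by auto
    moreover have "d = 1 \<longleftrightarrow> ((\<not> b) = even n) \<noteq> neg"
      using Suc.prems(2) by auto
    ultimately show ?thesis
      by (subst Suc.IH) (simp_all only: k ts list.map teval.simps fun_upd_same list_encode.simps)
  qed
  have XY: "?X \<le> ?Y" by simp
  have "val env (game (Suc n) b neg (pr e d) kt i ts) =
      (if b then val env (InfF i (game n (\<not> b) neg (pr e d) kt (Suc i) (Var i # ts)))
       else val env (SupF i (game n (\<not> b) neg (pr e d) kt (Suc i) (Var i # ts))))"
    by (simp add: quantifier_def del: val_simps)
  then show ?case
    unfolding val_simps IH INF_two_values[OF XY] SUP_two_values[OF XY] by auto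
qed

lemma Sigma_formula_of_Pi: "Pi_formula n \<phi> \<Longrightarrow> Sigma_formula (Suc n) \<phi>"
  and Pi_formula_of_Sigma: "Sigma_formula n \<phi> \<Longrightarrow> Pi_formula (Suc n) \<phi>"
  by (auto intro!: exI[of _ "[]"])

text \<open>A further infimum joins the leading block; thus the outer quantifier over
  \<open>k\<close> does not raise the class.\<close>

lemma Sigma_formula_InfF:
  assumes "Sigma_formula (Suc n) \<phi>" shows "Sigma_formula (Suc n) (InfF x \<phi>)"
proof -
  obtain xs \<psi> where "\<phi> = foldr InfF xs \<psi>" "Pi_formula n \<psi>" using assms by auto
  then show ?thesis by (auto intro!: exI[of _ "x # xs"])
qed

lemma Pi_formula_SupF:
  assumes "Pi_formula (Suc n) \<phi>" shows "Pi_formula (Suc n) (SupF x \<phi>)"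
proof -
  obtain xs \<psi> where "\<phi> = foldr SupF xs \<psi>" "Sigma_formula n \<psi>" using assms by auto
  then show ?thesis by (auto intro!: exI[of _ "x # xs"])
qed

lemma game_class:
  "if b then Sigma_formula (Suc n) (game n b neg e kt i ts) else Pi_formula (Suc n) (game n b neg e kt i ts)"
proof (induction n arbitrary: b i ts)
  case 0
  have "quantifier_free (literal neg (PredF P us))" for P us
    by (simp add: literal_def)
  then show ?case
    by (auto simp: quantifier_def simp del: Sigma_formula.simps(2) Pi_formula.simps(2)
        intro!: Sigma_formula_InfF[OF Sigma_formula_of_Pi] Pi_formula_SupF[OF Pi_formula_of_Sigma])
next
  case (Suc n)
  show ?case
    using Suc[of "\<not> b" "Suc i" "Var i # ts"]
    by (auto simp: quantifier_def simp del: Sigma_formula.simps(2) Pi_formula.simps(2)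
        intro!: Sigma_formula_InfF[OF Sigma_formula_of_Pi] Pi_formula_SupF[OF Pi_formula_of_Sigma])
qed

lemma wf_game: "list_all (wf_term arith_lang) (kt # ts) \<Longrightarrow> wf_formula arith_lang (game n b neg e kt i ts)"
  by (induction n arbitrary: b i ts) (auto simp: quantifier_def literal_def)

lemma free_vars_game: "free_vars (game n b neg e kt i ts) \<subseteq> \<Union>(term_vars ` set (kt # ts))"
proof (induction n arbitrary: b i ts)
  case 0
  show ?case by (auto simp: quantifier_def literal_def)
next
  case (Suc n)
  have "free_vars (game (Suc n) b neg e kt i ts) =
      free_vars (game n (\<not> b) neg e kt (Suc i) (Var i # ts)) - {i}"
    by (simp add: quantifier_def)
  with Suc[of "\<not> b" "Suc i" "Var i # ts"] show ?case by auto
qed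

text \<open>The predicate symbol depends on the number of arguments, so a constant length of
  \<open>ts x\<close> keeps it independent of \<open>x\<close>.\<close>

lemma rcf_game:
  assumes "rcf (\<lambda>x. list_encode (map term_code (ts x)))" "\<And>x. length (ts x) = m"
  shows "rcf (\<lambda>x. formula_code (game n b neg e kt i (ts x)))"
  using assms
proof (induction n arbitrary: b i ts m)
  case 0
  have "rcf (\<lambda>x. formula_code (literal neg (PredF (Suc (Suc (length (ts x))))
      (Var i # App e [] # kt # ts x))))"
    using 0 by (cases neg) (auto simp: literal_def intro!: rc)
  then show ?case by (cases b) (auto simp: quantifier_def intro!: rc)
next
  case (Suc n)
  have "rcf (\<lambda>x. formula_code (game n (\<not> b) neg e kt (Suc i) (Var i # ts x)))"
    using Suc.prems by (intro Suc.IH[of _ "Suc m"]) (auto intro!: rc)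
  then show ?case by (cases b) (auto simp: quantifier_def intro!: rc)
qed

lemma many_one_reducible_open_Sigma:
  assumes "sigp (Suc n) P"
  shows "many_one_reducible (Collect P) (open_diagram arith_lang arith_struct (Sigma_formula (Suc n)))"
proof -
  \<comment> \<open>The predicate sees the coded list \<open>[x]\<close>, whose head is the
    input.\<close>
  have "sigp (Suc n) (\<lambda>z. P (lhd z))" by (intro sigp_comp[OF assms] rc)
  from universal[OF this] obtain e where "\<And>z. P (lhd z) \<longleftrightarrow> univ_rel n e z" by blast
  then have e: "univ_rel n e (cons x 0) \<longleftrightarrow> P x" for x by (metis lhd_Cons)
  \<comment> \<open>The bit that \<open>val_game\<close> demands for \<open>b\<close> true and
    \<open>neg\<close> false. The exponent is the constant 1, so the values are 1/2 and 1, separated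
    by \<open>< 1\<close>.\<close>
  let ?d = "if even n then 1 else 0 :: nat"
  let ?\<Phi> = "\<lambda>x. game n True False (pr e ?d) (App 1 []) 0 [App x []]"
  have v: "val id (?\<Phi> x) = (if P x then 1 / 2 else 1)" for x
    by (subst val_game) (simp_all add: e)
  show ?thesis
  proof (rule diagram_hard(2)[where \<Phi> = ?\<Phi> and q = 1])
    show "rcf (\<lambda>x. formula_code (?\<Phi> x))" by (rule rcf_game[where m = 1]) (auto intro!: rc)
    show "sentence arith_lang (?\<Phi> x)" for x
      using free_vars_game[of n True False "pr e ?d" "App 1 []" 0 "[App x []]"]
      unfolding sentence_def by (intro conjI wf_game) auto
    show "Sigma_formula (Suc n) (?\<Phi> x)" for x
      using game_class[of True n] by simp
    show "x \<in> Collect P \<longleftrightarrow> val id (?\<Phi> x) < of_rat 1" for x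
      unfolding v by simp
  qed simp_all
qed

lemma many_one_reducible_closed_Pi:
  assumes "pip (Suc n) P"
  shows "many_one_reducible (Collect P) (closed_diagram arith_lang arith_struct (Pi_formula (Suc n)))"
proof -
  \<comment> \<open>For a leading supremum the lower value means that \<open>univ_rel\<close> fails,
    hence the program is taken for the complement.\<close>
  have "sigp (Suc n) (\<lambda>z. \<not> P (lhd z))" by (intro sigp_not pip_comp[OF assms] rc)
  from universal[OF this] obtain e where "\<And>z. \<not> P (lhd z) \<longleftrightarrow> univ_rel n e z" by blast
  then have e: "univ_rel n e (cons x 0) \<longleftrightarrow> \<not> P x" for x by (metis lhd_Cons)
  let ?d = "if even n then 0 else 1 :: nat"
  let ?\<Phi> = "\<lambda>x. game n False False (pr e ?d) (App 1 []) 0 [App x []]"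
  have v: "val id (?\<Phi> x) = (if P x then 1 / 2 else 1)" for x
    by (subst val_game) (simp_all add: e)
  show ?thesis
  proof (rule diagram_hard(1)[where \<Phi> = ?\<Phi> and q = "1 / 2"])
    show "rcf (\<lambda>x. formula_code (?\<Phi> x))" by (rule rcf_game[where m = 1]) (auto intro!: rc)
    show "sentence arith_lang (?\<Phi> x)" for x
      using free_vars_game[of n False False "pr e ?d" "App 1 []" 0 "[App x []]"]
      unfolding sentence_def by (intro conjI wf_game) auto
    show "Pi_formula (Suc n) (?\<Phi> x)" for x
      using game_class[of False n] by simp
    show "x \<in> Collect P \<longleftrightarrow> val id (?\<Phi> x) \<le> of_rat (1 / 2)" for x
      unfolding v by (simp add: of_rat_divide)
  qed simp_all
qed

text \<open>An outer quantifier over \<open>k\<close> adds a universal quantifier: the infimum below is \<open>0\<close> iff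
  \<open>B k\<close> holds for arbitrarily large, hence by monotonicity for all, \<open>k\<close>.\<close>

lemma INF_limit:
  assumes "\<And>j k. B k \<Longrightarrow> j \<le> k \<Longrightarrow> B j"
  shows "(INF k. if B k then 1 / 2 ^ k else 1 :: real) \<le> 0 \<longleftrightarrow> (\<forall>k. B k)"
proof
  assume *: "(INF k. if B k then 1 / 2 ^ k else 1 :: real) \<le> 0"
  show "\<forall>k. B k"
  proof (rule ccontr)
    assume "\<not> (\<forall>k. B k)"
    then obtain k where k: "\<not> B k" by blast
    have "1 / 2 ^ k \<le> (if B j then 1 / 2 ^ j else 1 :: real)" for j
    proof (cases "B j")
      case True
      \<comment> \<open>Otherwise \<open>k \<le> j\<close>, and \<open>B j\<close> would yield
        \<open>B k\<close>.\<close>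
      with k assms[of j k] have "j \<le> k" using nle_le assms by blast
      with True show ?thesis by (simp add: frac_le)
    qed simp
    then have "1 / 2 ^ k \<le> (INF k. if B k then 1 / 2 ^ k else 1 :: real)"
      by (intro cINF_greatest) auto
    moreover have "(0 :: real) < 1 / 2 ^ k" by simp
    ultimately show False using * by linarith
  qed
next
  assume B: "\<forall>k. B k"
  have bdd: "bdd_below (range (\<lambda>k. 1 / 2 ^ k :: real))" by (auto intro!: bdd_belowI[of _ 0])
  have "(INF k. 1 / 2 ^ k :: real) \<le> (1 / 2) ^ k" for k
    using cINF_lower[OF bdd, of k] by (simp add: power_one_over)
  then have "(INF k. 1 / 2 ^ k :: real) \<le> 0"
    by (intro LIMSEQ_le_const[OF LIMSEQ_power_zero[of "1 / 2 :: real"]]) auto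
  with B show "(INF k. if B k then 1 / 2 ^ k else 1 :: real) \<le> 0" by simp
qed

text \<open>\<open>INF_limit\<close> reflected by \<open>r \<mapsto> 1 - r\<close>, which exchanges
  infimum and supremum.\<close>

lemma SUP_limit:
  assumes "\<And>j k. B k \<Longrightarrow> j \<le> k \<Longrightarrow> B j"
  shows "(SUP k. if B k then 1 - 1 / 2 ^ k else 0 :: real) < 1 \<longleftrightarrow> (\<exists>k. \<not> B k)"
proof -
  let ?f = "\<lambda>k. if B k then 1 / 2 ^ k else 1 :: real"
  have "bdd_below (range ?f)" by (auto intro!: bdd_belowI[of _ 0])
  have "(SUP k. if B k then 1 - 1 / 2 ^ k else 0 :: real) = (SUP k. 1 - ?f k)"
    by (intro SUP_cong) auto
  also have "\<dots> = 1 - (INF k. ?f k)"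
  proof (rule antisym)
    show "(SUP k. 1 - ?f k) \<le> 1 - (INF k. ?f k)"
      using \<open>bdd_below _\<close> by (intro cSUP_least diff_left_mono cINF_lower) auto
    have "1 - (SUP k. 1 - ?f k) \<le> (INF k. ?f k)"
    proof (rule cINF_greatest)
      fix k
      have "1 - ?f k \<le> (SUP k. 1 - ?f k)"
        by (intro cSUP_upper) (auto intro!: bdd_aboveI[of _ 1])
      then show "1 - (SUP k. 1 - ?f k) \<le> ?f k" by linarith
    qed simp
    then show "1 - (INF k. ?f k) \<le> (SUP k. 1 - ?f k)" by linarith
  qed
  finally have eq: "(SUP k. if B k then 1 - 1 / 2 ^ k else 0 :: real) = 1 - (INF k. ?f k)" .
  have "(INF k. ?f k) \<le> 0 \<longleftrightarrow> (\<forall>k. B k)" using assms by (rule INF_limit)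
  moreover have "1 - (INF k. ?f k) < 1 \<longleftrightarrow> \<not> (INF k. ?f k) \<le> 0" by linarith
  ultimately show ?thesis unfolding eq by (simp only: not_all)
qed

text \<open>Truncation to \<open>y < k\<close> makes the condition decreasing in \<open>k\<close>,
  as \<open>INF_limit\<close> and \<open>SUP_limit\<close> require, without leaving
  \<open>sigp (Suc n)\<close>.\<close>

lemma universal_bounded_All:
  assumes "sigp (Suc n) Q"
  shows "\<exists>e. \<forall>k x. univ_rel n e (cons k (cons x 0)) \<longleftrightarrow> (\<forall>y<k. Q (pr x y))"
proof -
  have "sigp (Suc n) (\<lambda>z. \<forall>y<lhd z. Q (pr (lhd (ltl z)) y))"
    by (intro sigp_bounded_All sigp_comp[OF assms] rc)
  from universal[OF this] obtain e where "\<And>z. (\<forall>y<lhd z. Q (pr (lhd (ltl z)) y)) \<longleftrightarrow> univ_rel n e z"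
    by blast
  from this[of "cons _ (cons _ 0)"] show ?thesis by (intro exI[of _ e]) simp
qed

lemma many_one_reducible_closed_Sigma:
  assumes "pip (Suc (Suc n)) P"
  shows "many_one_reducible (Collect P) (closed_diagram arith_lang arith_struct (Sigma_formula (Suc n)))"
proof -
  obtain Q where Q: "sigp (Suc n) Q" and P: "P = (\<lambda>x. \<forall>y. Q (pr x y))"
    using assms unfolding pip_Suc[of "Suc n"] by blast
  obtain e where e: "\<And>k x. univ_rel n e (cons k (cons x 0)) \<longleftrightarrow> (\<forall>y<k. Q (pr x y))"
    using universal_bounded_All[OF Q] by blast
  let ?d = "if even n then 1 else 0 :: nat"
  \<comment> \<open>Variable 0 is used twice: as the exponent \<open>k\<close> and, at the head of
    the list, as the bound on \<open>y\<close>. The quantifiers of \<open>game\<close> start at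
    variable 1.\<close>
  let ?\<Phi> = "\<lambda>x. InfF 0 (game n True False (pr e ?d) (Var 0) 1 [Var 0, App x []])"
  have "val id (?\<Phi> x) = (INF k. if \<forall>y<k. Q (pr x y) then 1 / 2 ^ k else 1)" for x
    unfolding val_simps by (subst val_game) (simp_all add: e)
  then have v: "val id (?\<Phi> x) \<le> 0 \<longleftrightarrow> (\<forall>k. \<forall>y<k. Q (pr x y))" for x
    using INF_limit[of "\<lambda>k. \<forall>y<k. Q (pr x y)"] by simp
  show ?thesis
  proof (rule diagram_hard(1)[where \<Phi> = ?\<Phi> and q = 0])
    have "rcf (\<lambda>x. formula_code (game n True False (pr e ?d) (Var 0) 1 [Var 0, App x []]))"
      by (rule rcf_game[where m = 2]) (auto intro!: rc)
    then show "rcf (\<lambda>x. formula_code (?\<Phi> x))" by (auto intro!: rc)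
    show "sentence arith_lang (?\<Phi> x)" for x
      using free_vars_game[of n True False "pr e ?d" "Var 0" 1 "[Var 0, App x []]"]
      unfolding sentence_def wf_formula.simps by (intro conjI wf_game) auto
    show "Sigma_formula (Suc n) (?\<Phi> x)" for x
      using game_class[of True n] by (intro Sigma_formula_InfF) simp
    show "x \<in> Collect P \<longleftrightarrow> val id (?\<Phi> x) \<le> of_rat 0" for x
      unfolding of_rat_0 v P by auto
  qed simp_all
qed

lemma many_one_reducible_open_Pi:
  assumes "sigp (Suc (Suc n)) P"
  shows "many_one_reducible (Collect P) (open_diagram arith_lang arith_struct (Pi_formula (Suc n)))"
proof -
  obtain Q where Q: "pip (Suc n) Q" and P: "P = (\<lambda>x. \<exists>y. Q (pr x y))"
    using assms unfolding sigp_Suc[of "Suc n"] by blast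
  obtain e where e: "\<And>k x. univ_rel n e (cons k (cons x 0)) \<longleftrightarrow> (\<forall>y<k. \<not> Q (pr x y))"
    using universal_bounded_All[OF sigp_not[OF Q]] by blast
  let ?d = "if even n then 1 else 0 :: nat"
  \<comment> \<open>With \<open>b\<close> false and \<open>neg\<close> true the value is
    \<open>1 - 2^-k\<close> if \<open>univ_rel\<close> holds and 0 otherwise, so the supremum
    reaches 1 only in the limit.\<close>
  let ?\<Phi> = "\<lambda>x. SupF 0 (game n False True (pr e ?d) (Var 0) 1 [Var 0, App x []])"
  have "val id (?\<Phi> x) = (SUP k. if \<forall>y<k. \<not> Q (pr x y) then 1 - 1 / 2 ^ k else 0)" for x
    unfolding val_simps by (subst val_game) (simp_all add: e Un_commute)
  then have v: "val id (?\<Phi> x) < 1 \<longleftrightarrow> (\<exists>k. \<exists>y<k. Q (pr x y))" for x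
    using SUP_limit[of "\<lambda>k. \<forall>y<k. \<not> Q (pr x y)"] by simp
  show ?thesis
  proof (rule diagram_hard(2)[where \<Phi> = ?\<Phi> and q = 1])
    have "rcf (\<lambda>x. formula_code (game n False True (pr e ?d) (Var 0) 1 [Var 0, App x []]))"
      by (rule rcf_game[where m = 2]) (auto intro!: rc)
    then show "rcf (\<lambda>x. formula_code (?\<Phi> x))" by (auto intro!: rc)
    show "sentence arith_lang (?\<Phi> x)" for x
      using free_vars_game[of n False True "pr e ?d" "Var 0" 1 "[Var 0, App x []]"]
      unfolding sentence_def wf_formula.simps by (intro conjI wf_game) auto
    show "Pi_formula (Suc n) (?\<Phi> x)" for x
      using game_class[of False n] by (intro Pi_formula_SupF) simp
    show "x \<in> Collect P \<longleftrightarrow> val id (?\<Phi> x) < of_rat 1" for x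
      unfolding of_rat_1 v P by auto
  qed simp_all
qed

lemma halting_value_le_0: "halting_value x \<le> 0 \<longleftrightarrow> (\<forall>d. \<not> halts_in d (pfst x) (psnd x))"
proof -
  have "\<not> 1 / 2 ^ k \<le> (0 :: real)" for k
    using zero_less_power[of "2 :: real" k] by (simp add: not_le)
  then show ?thesis by (simp add: halting_value_def)
qed

text \<open>Halting is read off from whether \<open>halting_value\<close> is positive: threshold 0
  for the closed diagram, and \<open>NegF\<close> with threshold 1 for the open one.\<close>

lemma many_one_reducible_quantifier_free:
  shows "pip (Suc 0) P \<Longrightarrow> many_one_reducible (Collect P) (closed_diagram arith_lang arith_struct quantifier_free)"
    and "sigp (Suc 0) P \<Longrightarrow> many_one_reducible (Collect P) (open_diagram arith_lang arith_struct quantifier_free)"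
proof -
  assume "pip (Suc 0) P"
  from universal[OF sigp_not[OF this]] obtain e where e: "\<And>x. \<not> P x \<longleftrightarrow> (\<exists>d. halts_in d e x)" by auto
  let ?\<Phi> = "\<lambda>x. PredF 0 [App (pr e x) []]"
  show "many_one_reducible (Collect P) (closed_diagram arith_lang arith_struct quantifier_free)"
  proof (rule diagram_hard(1)[where \<Phi> = ?\<Phi> and q = 0])
    show "rcf (\<lambda>x. formula_code (?\<Phi> x))" by (auto intro!: rc)
    show "x \<in> Collect P \<longleftrightarrow> val id (?\<Phi> x) \<le> of_rat 0" for x
      using e[of x] by (auto simp: halting_value_le_0)
  qed (simp_all add: sentence_def)
next
  assume "sigp (Suc 0) P"
  from universal[OF this] obtain e where e: "\<And>x. P x \<longleftrightarrow> (\<exists>d. halts_in d e x)" by auto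
  let ?\<Phi> = "\<lambda>x. NegF (PredF 0 [App (pr e x) []])"
  show "many_one_reducible (Collect P) (open_diagram arith_lang arith_struct quantifier_free)"
  proof (rule diagram_hard(2)[where \<Phi> = ?\<Phi> and q = 1])
    show "rcf (\<lambda>x. formula_code (?\<Phi> x))" by (auto intro!: rc)
    show "x \<in> Collect P \<longleftrightarrow> val id (?\<Phi> x) < of_rat 1" for x
      using e[of x] halting_value_le_0[of "pr e x"] by (auto simp: not_le)
  qed (simp_all add: sentence_def)
qed

section \<open>Computable presentation\<close>

text \<open>The default \<open>i\<close> makes the empty list code the identity assignment, which
  names every generator \<open>real i\<close> by its own variable, as the presentation
  requires.\<close>

primrec assoc :: "nat \<Rightarrow> nat list \<Rightarrow> nat" where
  "assoc i [] = i"
| "assoc i (v # l) = (if pfst v = i then psnd v else assoc i l)"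

abbreviation env :: "nat \<Rightarrow> nat \<Rightarrow> nat" where
  "env c \<equiv> \<lambda>i. assoc i (list_decode c)"

lemma env_cons: "env (cons (pr x a) c) = (env c)(x := a)"
  by (simp add: fun_eq_iff)

lemma rcf_assoc [rc]:
  assumes "rcf f" "rcf g" shows "rcf (\<lambda>x. assoc (f x) (list_decode (g x)))"
proof -
  have "rcf2 (\<lambda>p l. assoc p (list_decode l))"
    by (rule rcf_list_rec[where a = "\<lambda>p. p" and h = "\<lambda>p v l y. if pfst v = p then psnd v else y"])
      (auto intro!: rc)
  from rcf2_app[OF this assms] show ?thesis .
qed

definition code_teval :: "nat \<Rightarrow> nat \<Rightarrow> nat" where
  "code_teval c t = (if pfst t = 0 then env c (psnd t) else pfst (psnd t))"

lemma code_teval: "code_teval c (term_code t) = teval (env c) t"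
  by (cases t) (simp_all add: code_teval_def)

lemma rcf_code_teval [rc]: "rcf f \<Longrightarrow> rcf g \<Longrightarrow> rcf (\<lambda>x. code_teval (f x) (g x))"
  unfolding code_teval_def by (intro rc)

text \<open>Values of atomic formulas are represented by \<open>0\<close> (for the value \<open>0\<close>) or \<open>m + 1\<close> (for the
  value \<open>2\<^sup>-\<^sup>m\<close>).\<close>

definition dyadic :: "nat \<Rightarrow> 'a :: field_char_0" where
  "dyadic m = (if m = 0 then 0 else 1 / 2 ^ (m - 1))"

text \<open>The halting time cut off at \<open>s\<close>; the value \<open>s\<close> means that
  nothing halts below \<open>s\<close>.\<close>

definition halting_stage :: "nat \<Rightarrow> nat \<Rightarrow> nat" where
  "halting_stage s x = (LEAST d. halts_in d (pfst x) (psnd x) \<or> s \<le> d)"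

text \<open>The tests on \<open>ltl\<close> separate the clauses of \<open>pred_value\<close> by the
  length of the list. Only the unary clause depends on the stage \<open>s\<close>.\<close>

definition pred_approx :: "nat \<Rightarrow> nat \<Rightarrow> nat" where
  "pred_approx s l =
    (if l = 0 \<or> ltl l \<noteq> 0 \<and> ltl (ltl l) = 0 then 0
     else if ltl l = 0 then if halting_stage s (lhd l) < s then Suc (halting_stage s (lhd l)) else 0
     else if halts_in (lhd l) (pfst (lhd (ltl l))) (ltl (ltl (ltl l))) \<longleftrightarrow> psnd (lhd (ltl l)) = 1
     then Suc (lhd (ltl (ltl l))) else 1)"

definition atom_approx :: "nat \<Rightarrow> nat \<Rightarrow> nat \<Rightarrow> nat" where
  "atom_approx s c a =
    (if pfst a = 0 then if code_teval c (pfst (psnd a)) = code_teval c (psnd (psnd a)) then 0 else 1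
     else pred_approx s (list_encode (map (code_teval c) (list_decode (psnd (psnd a))))))"

lemma rcf_pred_approx [rc]: "rcf f \<Longrightarrow> rcf g \<Longrightarrow> rcf (\<lambda>x. pred_approx (f x) (g x))"
  by (rule rcf2_app) (unfold pred_approx_def halting_stage_def, intro rc)

lemma rcf_atom_approx [rc]: "rcf f \<Longrightarrow> rcf g \<Longrightarrow> rcf h \<Longrightarrow> rcf (\<lambda>x. atom_approx (f x) (g x) (h x))"
  by (rule rcf3_app) (unfold atom_approx_def, intro rc)

lemma halting_stage:
  "if halting_stage s x < s then halting_value x = 1 / 2 ^ halting_stage s x
   else halting_value x \<le> 1 / 2 ^ s"
proof (cases "halting_stage s x < s")
  case True
  have "halts_in (halting_stage s x) (pfst x) (psnd x) \<or> s \<le> halting_stage s x"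
    unfolding halting_stage_def by (rule LeastI[of _ s]) simp
  then have h: "halts_in (halting_stage s x) (pfst x) (psnd x)"
    using True by simp
  have "(LEAST d. halts_in d (pfst x) (psnd x)) = halting_stage s x"
  proof (rule Least_equality)
    show "halts_in (halting_stage s x) (pfst x) (psnd x)" by (rule h)
    fix d assume "halts_in d (pfst x) (psnd x)"
    then show "halting_stage s x \<le> d"
      unfolding halting_stage_def by (intro Least_le) simp
  qed
  then show ?thesis using True h by (auto simp: halting_value_def)
next
  case False
  have "s \<le> (LEAST d. halts_in d (pfst x) (psnd x))" if "\<exists>d. halts_in d (pfst x) (psnd x)"
  proof -
    have "halting_stage s x \<le> (LEAST d. halts_in d (pfst x) (psnd x))"
      unfolding halting_stage_def using LeastI_ex[OF that] by (intro Least_le) simp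
    then show ?thesis using False by simp
  qed
  then have "halting_value x \<le> 1 / 2 ^ s"
    by (auto simp: halting_value_def frac_le)
  then show ?thesis using False by simp
qed

text \<open>The only error arises when the search of a unary atom is cut off at \<open>s\<close>;
  then the true value is at most \<open>2^-s\<close>.\<close>

lemma pred_approx:
  "pred_value xs = dyadic (pred_approx s (list_encode xs)) \<or>
   pred_approx s (list_encode xs) = 0 \<and> pred_value xs \<le> 1 / 2 ^ s"
  using halting_stage[of s "hd xs"]
  by (cases xs rule: pred_value.cases) (auto simp: pred_approx_def dyadic_def split: if_splits)

lemma atom_approx:
  assumes "atomic \<phi>"
  shows "val (env c) \<phi> = dyadic (atom_approx s c (formula_code \<phi>)) \<or>
    atom_approx s c (formula_code \<phi>) = 0 \<and> val (env c) \<phi> \<le> 1 / 2 ^ s"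
proof (cases \<phi>)
  case (DistF t u)
  then show ?thesis by (simp add: atom_approx_def code_teval dyadic_def)
next
  case (PredF P ts)
  have "map (code_teval c) (map term_code ts) = map (teval (env c)) ts"
    by (simp add: code_teval)
  then have "atom_approx s c (formula_code \<phi>) = pred_approx s (list_encode (map (teval (env c)) ts))"
    by (simp add: atom_approx_def PredF del: map_map map_eq_conv)
  then show ?thesis
    using pred_approx[of "map (teval (env c)) ts" s] by (simp add: PredF)
qed (use assms in simp_all)

lemma quotient_of_coprime_nat:
  assumes "0 < b" "coprime a b"
  shows "quotient_of (of_nat a / of_nat b) = (int a, int b)"
proof -
  have "(of_nat a / of_nat b :: rat) = Fract (int a) (int b)"
    using assms(1) by (simp add: Fract_of_int_quotient)
  then show ?thesis
    using assms by (simp add: quotient_of_Fract normalize_stable)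
qed

lemma rat_code_coprime: "0 < b \<Longrightarrow> coprime a b \<Longrightarrow> rat_code (of_nat a / of_nat b) = pr a b"
  by (simp add: rat_code_def quotient_of_coprime_nat)

lemma rat_code_dyadic: "rat_code (dyadic m) = (if m = 0 then pr 0 1 else pr 1 (2 ^ (m - 1)))"
  using rat_code_coprime[of 1 0] rat_code_coprime[of "2 ^ (m - 1)" 1] by (simp add: dyadic_def)

lemma of_rat_dyadic: "(of_rat (dyadic m) :: real) = dyadic m"
  by (simp add: dyadic_def of_rat_divide of_rat_power)

lemma computable_presentation_arith_struct: "computable_presentation arith_lang arith_struct real"
  unfolding computable_presentation_def
\<comment> \<open>Stage \<open>k + 1\<close> is used because the error must be strictly below
  \<open>2^-k\<close>.\<close>
proof (intro conjI exI[of _ "\<lambda>xs. rat_code (dyadic (atom_approx (Suc (xs ! 1)) 0 (xs ! 0)))"] allI impI)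
  interpret discrete_metric "\<nat> :: real set" .
  have dd: "dd = metric arith_struct"
    by (simp add: dd_def fun_eq_iff)
  have "x \<in> \<nat>" if "x \<in> rational_points arith_lang arith_struct real" for x
    using that by induction simp_all
  moreover have "x \<in> rational_points arith_lang arith_struct real" if "x \<in> \<nat>" for x
    using that by (elim Nats_cases) (simp add: rational_points.gen)
  ultimately have "rational_points arith_lang arith_struct real = topspace disc.mtopology"
    unfolding disc.topspace_mtopology by blast
  then have "disc.mtopology closure_of rational_points arith_lang arith_struct real = \<nat>"
    by (metis closure_of_topspace disc.topspace_mtopology)
  then show "presentation arith_lang arith_struct real"
    unfolding presentation_def dd[symmetric] arith_struct_simps(1) by (simp add: image_subset_iff)
next
  let ?f = "\<lambda>c k. if atom_approx (Suc k) 0 c = 0 then pr 0 1 else pr 1 (2 ^ (atom_approx (Suc k) 0 c - 1))"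
  have "rcf2 ?f"
    by (intro rc)
  then show "computable 2 (\<lambda>xs. rat_code (dyadic (atom_approx (Suc (xs ! 1)) 0 (xs ! 0))))"
    unfolding rat_code_dyadic by (rule computable2_rcf2[of ?f, THEN iffD1])
next
  fix \<phi> k
  assume "atomic \<phi> \<and> wf_formula arith_lang \<phi>"
  let ?m = "atom_approx (Suc k) 0 (formula_code \<phi>)"
  have v: "formula_value arith_struct real \<phi> = val (env 0) \<phi>"
    by (simp add: val_def)
  have k: "(1 :: real) / 2 ^ Suc k < 1 / 2 ^ k" "(0 :: real) < 1 / 2 ^ k" by (simp_all add: divide_simps)
  have "val (env 0) \<phi> = dyadic ?m \<or> ?m = 0 \<and> val (env 0) \<phi> \<le> 1 / 2 ^ Suc k"
    using \<open>atomic \<phi> \<and> _\<close> by (intro atom_approx) simp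
  then have "\<bar>val (env 0) \<phi> - dyadic ?m\<bar> < 1 / 2 ^ k"
  proof
    assume "?m = 0 \<and> val (env 0) \<phi> \<le> 1 / 2 ^ Suc k"
    moreover from this have "(dyadic ?m :: real) = 0" by (simp add: dyadic_def)
    ultimately show ?thesis
      using k val_bounds[of "env 0" \<phi>] by linarith
  qed (use k in simp)
  then show "\<exists>q. q \<ge> 0 \<and> rat_code (dyadic (atom_approx (Suc ([formula_code \<phi>, k] ! 1)) 0
      ([formula_code \<phi>, k] ! 0))) = rat_code q \<and> \<bar>formula_value arith_struct real \<phi> - of_rat q\<bar> < 1 / 2 ^ k"
    unfolding v by (intro exI[of _ "dyadic ?m"]) (simp add: of_rat_dyadic, simp add: dyadic_def)
qed

section \<open>Recursion on codes of formulas\<close>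

text \<open>The additive bound, stronger than the bounds on the single components, makes subcodes
  strictly smaller and later lets the errors of two subformulas be added.\<close>

lemma le_pr: "a + b \<le> pr a b"
proof -
  have "n \<le> triangle n" for n by (induction n) auto
  from this[of "a + b"] show ?thesis by (simp add: prod_encode_def)
qed

text \<open>The tags are those of \<open>formula_code\<close>. Both quantifiers share the clause
  \<open>qu\<close>, and a tag beyond 6, which codes no formula, gives 0.\<close>

definition formula_rec_step where
  "formula_rec_step atm neg hf mn qu p c L =
    (if pfst c < 2 then atm p c
     else if pfst c = 2 then neg p (look L c (psnd c))
     else if pfst c = 3 then hf p (look L c (psnd c))
     else if pfst c = 4 then mn p (look L c (pfst (psnd c))) (look L c (psnd (psnd c)))
     else if pfst c < 7 then qu p (pfst (psnd c)) (look L c (psnd (psnd c))) else (0::nat))"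

definition formula_rec where
  "formula_rec atm neg hf mn qu = covrec (formula_rec_step atm neg hf mn qu)"

lemma subcode_less:
  assumes "2 \<le> pfst c"
  shows "psnd c < c" "pfst (psnd c) < c" "psnd (psnd c) < c"
proof -
  show "psnd c < c" using le_pr[of "pfst c" "psnd c"] assms by simp
  then show "pfst (psnd c) < c" "psnd (psnd c) < c"
    using pfst_le[of "psnd c"] psnd_le[of "psnd c"] by simp_all
qed

lemma formula_rec:
  "formula_rec atm neg hf mn qu p c =
    (if pfst c < 2 then atm p c
     else if pfst c = 2 then neg p (formula_rec atm neg hf mn qu p (psnd c))
     else if pfst c = 3 then hf p (formula_rec atm neg hf mn qu p (psnd c))
     else if pfst c = 4 then mn p (formula_rec atm neg hf mn qu p (pfst (psnd c)))
       (formula_rec atm neg hf mn qu p (psnd (psnd c)))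
     else if pfst c < 7 then qu p (pfst (psnd c)) (formula_rec atm neg hf mn qu p (psnd (psnd c)))
     else 0)"
  using subcode_less[of c] unfolding formula_rec_def
  by (subst covrec_def) (simp add: formula_rec_step_def look_history)

lemma rcf_formula_rec:
  assumes "rcf2 atm" "rcf2 neg" "rcf2 hf" "rcf3 mn" "rcf3 qu" "rcf f" "rcf g"
  shows "rcf (\<lambda>x. formula_rec atm neg hf mn qu (f x) (g x))"
  unfolding formula_rec_def
  by (rule rcf_covrec[OF _ assms(6,7)])
    (unfold formula_rec_step_def, intro rc rcf2_app[OF assms(1)] rcf2_app[OF assms(2)]
      rcf2_app[OF assms(3)] rcf3_app[OF assms(4)] rcf3_app[OF assms(5)])

section \<open>Deciding syntax on codes\<close>

text \<open>All function symbols are constants, so an application must have the argument list with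
  code 0, and no recursion over terms is necessary.\<close>

definition code_wf_term :: "nat \<Rightarrow> bool" where
  "code_wf_term t \<longleftrightarrow> pfst t = 0 \<or> pfst t = 1 \<and> psnd (psnd t) = 0"

lemma code_wf_term: "code_wf_term t \<longleftrightarrow> (\<exists>u. wf_term arith_lang u \<and> term_code u = t)"
proof
  assume "code_wf_term t"
  then show "\<exists>u. wf_term arith_lang u \<and> term_code u = t"
    unfolding code_wf_term_def
  proof (elim disjE conjE)
    assume "pfst t = 0"
    then have "term_code (Var (psnd t)) = t" by (metis pr_collapse term_code.simps(1))
    then show ?thesis by (intro exI[of _ "Var (psnd t)"]) simp
  next
    assume "pfst t = 1" "psnd (psnd t) = 0"
    then have "term_code (App (pfst (psnd t)) []) = t"
      by (metis pr_collapse term_code.simps(2) list.map(1) list_encode.simps(1))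
    then show ?thesis by (intro exI[of _ "App (pfst (psnd t)) []"]) simp
  qed
next
  assume "\<exists>u. wf_term arith_lang u \<and> term_code u = t"
  then obtain u where u: "wf_term arith_lang u" "term_code u = t" by blast
  then show "code_wf_term t" by (cases u) (auto simp: code_wf_term_def)
qed

definition code_wf_atom :: "nat \<Rightarrow> bool" where
  "code_wf_atom c \<longleftrightarrow>
    (if pfst c = 0 then code_wf_term (pfst (psnd c)) \<and> code_wf_term (psnd (psnd c))
     else length (list_decode (psnd (psnd c))) = Suc (pfst (psnd c)) \<and>
       (\<forall>v\<in>set (list_decode (psnd (psnd c))). code_wf_term v))"

text \<open>Nonzero stands for true: the product is a conjunction here, the sum a disjunction in
  \<open>code_free_var\<close>. The parameter 0 is a dummy.\<close>

definition code_wf :: "nat \<Rightarrow> nat" where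
  "code_wf = formula_rec (\<lambda>p c. if code_wf_atom c then 1 else 0) (\<lambda>p r. r) (\<lambda>p r. r) (\<lambda>p a b. a * b)
     (\<lambda>p x r. r) 0"

lemma rcf_code_wf [rc]: "rcf f \<Longrightarrow> rcf (\<lambda>x. code_wf (f x))"
  unfolding code_wf_def code_wf_atom_def code_wf_term_def by (intro rcf_formula_rec rc)

lemmas code_wf_rec = formula_rec[of "\<lambda>p c. if code_wf_atom c then 1 else 0" "\<lambda>p r. r" "\<lambda>p r. r"
  "\<lambda>p a b. a * b" "\<lambda>p x r. r" 0, folded code_wf_def]

lemma wf_terms_codes: "(\<forall>v\<in>set l. code_wf_term v) \<longleftrightarrow> (\<exists>ts. list_all (wf_term arith_lang) ts \<and> map term_code ts = l)"
proof (induction l)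
  case (Cons v l)
  show ?case
  proof
    assume "\<forall>v\<in>set (v # l). code_wf_term v"
    with Cons obtain t ts where "wf_term arith_lang t" "term_code t = v" "list_all (wf_term arith_lang) ts" "map term_code ts = l"
      by (auto simp: code_wf_term)
    then show "\<exists>ts. list_all (wf_term arith_lang) ts \<and> map term_code ts = v # l"
      by (intro exI[of _ "t # ts"]) simp
  next
    assume "\<exists>ts. list_all (wf_term arith_lang) ts \<and> map term_code ts = v # l"
    then show "\<forall>v\<in>set (v # l). code_wf_term v"
      using Cons by (auto simp: code_wf_term)
  qed
qed simp

lemma code_wf_formula: "wf_formula arith_lang \<phi> \<Longrightarrow> code_wf (formula_code \<phi>) \<noteq> 0"
proof (induction \<phi>)
  case (DistF s t)
  then show ?case by (subst code_wf_rec) (auto simp: code_wf_atom_def code_wf_term)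
next
  case (PredF P ts)
  then show ?case
    by (subst code_wf_rec) (auto simp: code_wf_atom_def code_wf_term list_all_iff)
qed (subst code_wf_rec, simp)+

text \<open>The formula is rebuilt from its code by strong induction, as components have smaller
  codes.\<close>

lemma ex_wf_formula: "code_wf c \<noteq> 0 \<Longrightarrow> \<exists>\<phi>. wf_formula arith_lang \<phi> \<and> formula_code \<phi> = c"
proof (induction c rule: less_induct)
  case (less c)
  have c: "c = pr (pfst c) (psnd c)" "psnd c = pr (pfst (psnd c)) (psnd (psnd c))" by simp_all
  have small: "code_wf_atom c" if "pfst c < 2"
    using less.prems that by (subst (asm) code_wf_rec) (simp split: if_splits)
  have "pfst c < 7"
    using less.prems by (subst (asm) code_wf_rec) (simp split: if_splits)
  then consider "pfst c = 0" | "pfst c = 1" | "pfst c = 2" | "pfst c = 3" | "pfst c = 4"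
    | "pfst c = 5" | "pfst c = 6" by linarith
  then show ?case
  proof cases
    case 1
    with small obtain s t where "wf_term arith_lang s" "term_code s = pfst (psnd c)"
      "wf_term arith_lang t" "term_code t = psnd (psnd c)"
      by (auto simp: code_wf_atom_def code_wf_term)
    with 1 c show ?thesis by (intro exI[of _ "DistF s t"]) simp
  next
    case 2
    with small obtain ts where "list_all (wf_term arith_lang) ts" "map term_code ts = list_decode (psnd (psnd c))"
      "length (list_decode (psnd (psnd c))) = Suc (pfst (psnd c))"
      by (auto simp: code_wf_atom_def wf_terms_codes)
    moreover from this(2) have "length ts = length (list_decode (psnd (psnd c)))"
      by (metis length_map)
    ultimately show ?thesis
      using 2 c by (intro exI[of _ "PredF (pfst (psnd c)) ts"]) simp
  next
    case 3
    then have "code_wf (psnd c) \<noteq> 0" using less.prems by (subst (asm) code_wf_rec) simp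
    with less.IH[of "psnd c"] subcode_less[of c] 3 obtain \<phi> where "wf_formula arith_lang \<phi>" "formula_code \<phi> = psnd c"
      by auto
    with 3 c show ?thesis by (intro exI[of _ "NegF \<phi>"]) simp
  next
    case 4
    then have "code_wf (psnd c) \<noteq> 0" using less.prems by (subst (asm) code_wf_rec) simp
    with less.IH[of "psnd c"] subcode_less[of c] 4 obtain \<phi> where "wf_formula arith_lang \<phi>" "formula_code \<phi> = psnd c"
      by auto
    with 4 c show ?thesis by (intro exI[of _ "HalfF \<phi>"]) simp
  next
    case 5
    then have "code_wf (pfst (psnd c)) \<noteq> 0" "code_wf (psnd (psnd c)) \<noteq> 0"
      using less.prems by (subst (asm) code_wf_rec, simp)+
    with less.IH[of "pfst (psnd c)"] less.IH[of "psnd (psnd c)"] subcode_less[of c] 5 obtain \<phi> \<psi>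
      where "wf_formula arith_lang \<phi>" "formula_code \<phi> = pfst (psnd c)"
        "wf_formula arith_lang \<psi>" "formula_code \<psi> = psnd (psnd c)"
      by auto
    with 5 c show ?thesis by (intro exI[of _ "MinusF \<phi> \<psi>"]) simp
  next
    case 6
    then have "code_wf (psnd (psnd c)) \<noteq> 0" using less.prems by (subst (asm) code_wf_rec) simp
    with less.IH[of "psnd (psnd c)"] subcode_less[of c] 6 obtain \<phi>
      where "wf_formula arith_lang \<phi>" "formula_code \<phi> = psnd (psnd c)" by auto
    with 6 c show ?thesis by (intro exI[of _ "SupF (pfst (psnd c)) \<phi>"]) simp
  next
    case 7
    then have "code_wf (psnd (psnd c)) \<noteq> 0" using less.prems by (subst (asm) code_wf_rec) simp
    with less.IH[of "psnd (psnd c)"] subcode_less[of c] 7 obtain \<phi>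
      where "wf_formula arith_lang \<phi>" "formula_code \<phi> = psnd (psnd c)" by auto
    with 7 c show ?thesis by (intro exI[of _ "InfF (pfst (psnd c)) \<phi>"]) simp
  qed
qed

definition code_qf :: "nat \<Rightarrow> nat" where
  "code_qf = formula_rec (\<lambda>p c. 1) (\<lambda>p r. r) (\<lambda>p r. r) (\<lambda>p a b. a * b) (\<lambda>p x r. 0) 0"

lemma rcf_code_qf [rc]: "rcf f \<Longrightarrow> rcf (\<lambda>x. code_qf (f x))"
  unfolding code_qf_def by (intro rcf_formula_rec rc)

lemma code_qf: "code_qf (formula_code \<phi>) \<noteq> 0 \<longleftrightarrow> quantifier_free \<phi>"
  unfolding code_qf_def by (induction \<phi>) (subst formula_rec, simp)+

definition code_term_var :: "nat \<Rightarrow> nat \<Rightarrow> bool" where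
  "code_term_var i t \<longleftrightarrow> pfst t = 0 \<and> psnd t = i"

definition code_atom_var :: "nat \<Rightarrow> nat \<Rightarrow> bool" where
  "code_atom_var i c \<longleftrightarrow>
    (if pfst c = 0 then code_term_var i (pfst (psnd c)) \<or> code_term_var i (psnd (psnd c))
     else \<exists>v\<in>set (list_decode (psnd (psnd c))). code_term_var i v)"

definition code_free_var :: "nat \<Rightarrow> nat \<Rightarrow> nat" where
  "code_free_var = formula_rec (\<lambda>i c. if code_atom_var i c then 1 else 0) (\<lambda>i r. r) (\<lambda>i r. r)
     (\<lambda>i a b. a + b) (\<lambda>i x r. if x = i then 0 else r)"

lemma rcf_code_free_var [rc]: "rcf f \<Longrightarrow> rcf g \<Longrightarrow> rcf (\<lambda>x. code_free_var (f x) (g x))"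
  unfolding code_free_var_def code_atom_var_def code_term_var_def by (intro rcf_formula_rec rc)

lemmas code_free_var_rec = formula_rec[of "\<lambda>i c. if code_atom_var i c then 1 else 0" "\<lambda>i r. r"
  "\<lambda>i r. r" "\<lambda>i a b. a + b" "\<lambda>i x r. if x = i then 0 else r", folded code_free_var_def]

lemma code_term_var: "wf_term arith_lang t \<Longrightarrow> code_term_var i (term_code t) \<longleftrightarrow> i \<in> term_vars t"
  by (cases t) (auto simp: code_term_var_def)

lemma code_free_var: "wf_formula arith_lang \<phi> \<Longrightarrow> code_free_var i (formula_code \<phi>) \<noteq> 0 \<longleftrightarrow> i \<in> free_vars \<phi>"
proof (induction \<phi>)
  case (DistF s t)
  then show ?case by (subst code_free_var_rec) (simp add: code_atom_var_def code_term_var)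
next
  case (PredF P ts)
  then show ?case
    by (subst code_free_var_rec) (auto simp: code_atom_var_def code_term_var list_all_iff)
qed (subst code_free_var_rec, simp, blast?)+

lemma member_le_list_encode: "x \<in> set xs \<Longrightarrow> x \<le> list_encode xs"
proof (induction xs)
  case (Cons y xs)
  then show ?case
    using le_pr[of y "list_encode xs"] by auto
qed simp

text \<open>This bound makes the absence of free variables decidable: only variables up to the code
  must be checked.\<close>

lemma free_var_le_code:
  assumes "wf_formula arith_lang \<phi>" "i \<in> free_vars \<phi>" shows "i \<le> formula_code \<phi>"
proof -
  have t: "i \<le> term_code t" if "wf_term arith_lang t" "i \<in> term_vars t" for t
    using that le_prod_encode_2 by (cases t) auto
  have p: "i \<le> pr a b" if "i \<le> a \<or> i \<le> b" for a b
    using that le_pr[of a b] by auto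
  from assms show ?thesis
  proof (induction \<phi>)
    case (PredF P ts)
    then obtain u where "u \<in> set ts" "i \<in> term_vars u" "wf_term arith_lang u"
      by (auto simp: list_all_iff)
    then have "i \<le> list_encode (map term_code ts)"
      using t[of u] member_le_list_encode[of "term_code u" "map term_code ts"] by auto
    then show ?case by (auto intro!: p)
  qed (use t in \<open>auto intro!: p\<close>)
qed

definition code_sentence :: "nat \<Rightarrow> bool" where
  "code_sentence c \<longleftrightarrow> code_wf c \<noteq> 0 \<and> (\<forall>i\<le>c. code_free_var i c = 0)"

lemma rcp_code_sentence [rc]: "rcf f \<Longrightarrow> rcp (\<lambda>x. code_sentence (f x))"
  by (rule rcp_comp) (unfold code_sentence_def, intro rc)

lemma code_sentence: "code_sentence c \<longleftrightarrow> (\<exists>\<phi>. sentence arith_lang \<phi> \<and> formula_code \<phi> = c)"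
proof
  assume c: "code_sentence c"
  then obtain \<phi> where "wf_formula arith_lang \<phi>" "formula_code \<phi> = c"
    using ex_wf_formula by (auto simp: code_sentence_def)
  moreover from this c have "i \<notin> free_vars \<phi>" for i
    using free_var_le_code[of \<phi> i] code_free_var[of \<phi> i] by (auto simp: code_sentence_def)
  ultimately show "\<exists>\<phi>. sentence arith_lang \<phi> \<and> formula_code \<phi> = c"
    by (auto simp: sentence_def)
next
  assume "\<exists>\<phi>. sentence arith_lang \<phi> \<and> formula_code \<phi> = c"
  then show "code_sentence c"
    using code_free_var code_wf_formula by (fastforce simp: sentence_def code_sentence_def)
qed

section \<open>Approximate values of quantifier-free formulas\<close>

text \<open>\<open>code_approx (pr s e) c\<close> is \<open>2\<^sup>s\<close> times the value of the formula with code \<open>c\<close>, up to an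
  error of at most \<open>c + 1\<close>.\<close>

definition code_approx :: "nat \<Rightarrow> nat \<Rightarrow> nat" where
  "code_approx = formula_rec
     (\<lambda>p c. if atom_approx (pfst p) (psnd p) c = 0 then 0
       else 2 ^ pfst p div 2 ^ (atom_approx (pfst p) (psnd p) c - 1))
     (\<lambda>p r. 2 ^ pfst p - r) (\<lambda>p r. r div 2) (\<lambda>p a b. a - b) (\<lambda>p x r. 0)"

lemmas code_approx_rec = formula_rec[of
  "\<lambda>p c. if atom_approx (pfst p) (psnd p) c = 0 then 0
    else 2 ^ pfst p div 2 ^ (atom_approx (pfst p) (psnd p) c - 1)"
  "\<lambda>p r. 2 ^ pfst p - r" "\<lambda>p r. r div 2" "\<lambda>p a b. a - b" "\<lambda>p x r. 0", folded code_approx_def]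

lemma rcf_code_approx [rc]: "rcf f \<Longrightarrow> rcf g \<Longrightarrow> rcf (\<lambda>x. code_approx (f x) (g x))"
  unfolding code_approx_def by (intro rcf_formula_rec rc)

text \<open>Either the value \<open>2^-k\<close> is scaled by \<open>2^s\<close> and rounded down by
  integer division, or the atom was cut off and its value is at most \<open>2^-s\<close>; both
  errors are at most 1 after scaling.\<close>

lemma code_approx_atomic:
  assumes "atomic \<phi>"
  shows "code_approx (pr s e) (formula_code \<phi>) \<le> 2 ^ s \<and>
    \<bar>2 ^ s * val (env e) \<phi> - code_approx (pr s e) (formula_code \<phi>)\<bar> \<le> 1"
proof -
  let ?m = "atom_approx s e (formula_code \<phi>)"
  have c: "code_approx (pr s e) (formula_code \<phi>) = (if ?m = 0 then 0 else 2 ^ s div 2 ^ (?m - 1))"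
    by (subst code_approx_rec) (use assms in \<open>cases \<phi>; simp\<close>)
  from atom_approx[OF assms, of e s] show ?thesis
  proof
    assume v: "val (env e) \<phi> = dyadic ?m"
    have "\<bar>2 ^ s * (1 / 2 ^ k) - real (2 ^ s div 2 ^ k)\<bar> \<le> 1" for k
    proof -
      have "real m = real (m div n) * real n + real (m mod n)" for m n :: nat
        by (metis of_nat_add of_nat_mult div_mult_mod_eq)
      from this[of "2 ^ s" "2 ^ k"]
      have "(2::real) ^ s = real (2 ^ s div 2 ^ k) * 2 ^ k + real (2 ^ s mod 2 ^ k)"
        by (simp only: of_nat_power of_nat_numeral)
      moreover have "real (2 ^ s mod 2 ^ k) < 2 ^ k"
        using mod_less_divisor[of "2 ^ k" "2 ^ s"] by (simp flip: of_nat_less_iff)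
      ultimately show ?thesis by (simp add: field_simps)
    qed
    then show ?thesis unfolding c v by (simp add: dyadic_def)
  next
    assume *: "?m = 0 \<and> val (env e) \<phi> \<le> 1 / 2 ^ s"
    then have "2 ^ s * val (env e) \<phi> \<le> 1" by (simp add: field_simps)
    moreover have "0 \<le> 2 ^ s * val (env e) \<phi>" using val_bounds by simp
    ultimately show ?thesis unfolding c using * by simp
  qed
qed

text \<open>Errors of subformulas add up, and so do codes by \<open>le_pr\<close>, so the code
  itself bounds the error. The bound \<open>2^s\<close> is carried along to make the subtraction for
  \<open>NegF\<close> exact.\<close>

lemma code_approx:
  "quantifier_free \<phi> \<Longrightarrow> code_approx (pr s e) (formula_code \<phi>) \<le> 2 ^ s \<and>
    \<bar>2 ^ s * val (env e) \<phi> - code_approx (pr s e) (formula_code \<phi>)\<bar> \<le> formula_code \<phi> + 1"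
proof (induction \<phi>)
  case (DistF t u)
  show ?case using code_approx_atomic[of "DistF t u" s e] by (simp del: formula_code.simps val_simps)
next
  case (PredF P ts)
  show ?case using code_approx_atomic[of "PredF P ts" s e] by (simp del: formula_code.simps val_simps)
next
  case (NegF \<phi>)
  let ?a = "code_approx (pr s e) (formula_code \<phi>)"
  have 1: "code_approx (pr s e) (formula_code (NegF \<phi>)) = 2 ^ s - ?a"
    by (subst code_approx_rec) simp
  have IH: "?a \<le> 2 ^ s" "\<bar>2 ^ s * val (env e) \<phi> - ?a\<bar> \<le> formula_code \<phi> + 1" using NegF by simp_all
  have "real (2 ^ s - ?a) = 2 ^ s - real ?a"
    using IH(1) by (simp add: of_nat_diff)
  moreover have "real (formula_code \<phi>) \<le> formula_code (NegF \<phi>)"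
    using le_pr[of 2 "formula_code \<phi>"] by simp
  ultimately show ?case
    unfolding 1 val_simps right_diff_distrib mult_1_right using IH(2) by (intro conjI; linarith)
next
  case (HalfF \<phi>)
  let ?a = "code_approx (pr s e) (formula_code \<phi>)"
  have 1: "code_approx (pr s e) (formula_code (HalfF \<phi>)) = ?a div 2"
    by (subst code_approx_rec) simp
  have IH: "?a \<le> 2 ^ s" "\<bar>2 ^ s * val (env e) \<phi> - ?a\<bar> \<le> formula_code \<phi> + 1" using HalfF by simp_all
  have "\<bar>real ?a / 2 - real (?a div 2)\<bar> \<le> 1 / 2"
    by (simp add: real_of_nat_div)
  moreover have "real (formula_code \<phi>) \<le> formula_code (HalfF \<phi>)"
    using le_pr[of 3 "formula_code \<phi>"] by simp
  moreover have "?a div 2 \<le> 2 ^ s" using IH(1) by simp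
  moreover have "2 ^ s * val (env e) (HalfF \<phi>) = (2 ^ s * val (env e) \<phi>) / 2" by simp
  ultimately show ?case
    unfolding 1 using IH(2) by (intro conjI; linarith)
next
  case (MinusF \<phi> \<psi>)
  let ?a = "code_approx (pr s e) (formula_code \<phi>)" and ?b = "code_approx (pr s e) (formula_code \<psi>)"
  have 1: "code_approx (pr s e) (formula_code (MinusF \<phi> \<psi>)) = ?a - ?b"
    by (subst code_approx_rec) simp
  have IH: "?a \<le> 2 ^ s" "\<bar>2 ^ s * val (env e) \<phi> - ?a\<bar> \<le> formula_code \<phi> + 1"
    "\<bar>2 ^ s * val (env e) \<psi> - ?b\<bar> \<le> formula_code \<psi> + 1" using MinusF by simp_all
  have "2 ^ s * val (env e) (MinusF \<phi> \<psi>) = max 0 (2 ^ s * val (env e) \<phi> - 2 ^ s * val (env e) \<psi>)"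
    by (simp add: max_def right_diff_distrib)
  moreover have "real (?a - ?b) = max 0 (real ?a - real ?b)"
    by (simp add: max_def of_nat_diff)
  \<comment> \<open>The tag 4 leaves room for the additional 1 in the sum of the two error
    bounds.\<close>
  moreover have "real (formula_code \<phi>) + real (formula_code \<psi>) + 1 \<le> formula_code (MinusF \<phi> \<psi>)"
    using le_pr[of 4 "pr (formula_code \<phi>) (formula_code \<psi>)"] le_pr[of "formula_code \<phi>" "formula_code \<psi>"]
    by simp
  moreover have "?a - ?b \<le> 2 ^ s" using IH(1) by simp
  ultimately show ?case
    unfolding 1 using IH(2,3) by (intro conjI; linarith)
qed simp_all

lemma ex_power_gt:
  assumes "0 < (r :: real)" shows "\<exists>s. C < 2 ^ s * r"
proof -
  obtain s where "C / r < 2 ^ s" using real_arch_pow[of 2 "C / r"] by auto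
  then show ?thesis using assms by (auto simp: field_simps)
qed

text \<open>The error does not depend on \<open>s\<close> while the scale \<open>2^s\<close> grows,
  so a strict inequality becomes visible at some stage. The test is cross-multiplied to live in the
  natural numbers.\<close>

lemma val_less_iff_approx:
  assumes "quantifier_free \<phi>" "0 < d"
  shows "val (env e) \<phi> < real n / real d \<longleftrightarrow>
    (\<exists>s. (code_approx (pr s e) (formula_code \<phi>) + formula_code \<phi> + 1) * d < n * 2 ^ s)"
proof -
  let ?a = "\<lambda>s. code_approx (pr s e) (formula_code \<phi>)" and ?c = "formula_code \<phi>"
  have a: "\<bar>2 ^ s * val (env e) \<phi> - ?a s\<bar> \<le> ?c + 1" for s
    using code_approx[OF assms(1)] by blast
  have iff: "(?a s + ?c + 1) * d < n * 2 ^ s \<longleftrightarrow> ?a s + ?c + 1 < 2 ^ s * (real n / real d)" for s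
  proof -
    have "(?a s + ?c + 1) * d < n * 2 ^ s \<longleftrightarrow> real ((?a s + ?c + 1) * d) < real (n * 2 ^ s)"
      by (simp only: of_nat_less_iff)
    also have "\<dots> \<longleftrightarrow> ?a s + ?c + 1 < 2 ^ s * (real n / real d)"
      using assms(2) by (simp add: field_simps)
    finally show ?thesis .
  qed
  show ?thesis
    unfolding iff
  proof
    assume "val (env e) \<phi> < real n / real d"
    \<comment> \<open>Twice the error: once for the deviation of the approximation, once for the
      safety margin in the test.\<close>
    then obtain s where s: "2 * (real ?c + 1) < 2 ^ s * (real n / real d - val (env e) \<phi>)"
      using ex_power_gt[of "real n / real d - val (env e) \<phi>" "2 * (real ?c + 1)"] by auto
    then have "?a s + ?c + 1 < 2 ^ s * (real n / real d)"
      using a[of s] by (simp add: right_diff_distrib abs_le_iff)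
    then show "\<exists>s. ?a s + ?c + 1 < 2 ^ s * (real n / real d)" ..
  next
    assume "\<exists>s. ?a s + ?c + 1 < 2 ^ s * (real n / real d)"
    then obtain s where s: "?a s + ?c + 1 < 2 ^ s * (real n / real d)" ..
    then have "2 ^ s * val (env e) \<phi> < 2 ^ s * (real n / real d)"
      using a[of s] by (simp add: abs_le_iff)
    then show "val (env e) \<phi> < real n / real d"
      by (simp only: mult_less_cancel_left_pos zero_less_power zero_less_numeral)
  qed
qed

lemma val_le_iff_approx:
  assumes "quantifier_free \<phi>" "0 < d"
  shows "val (env e) \<phi> \<le> real n / real d \<longleftrightarrow>
    (\<forall>s. code_approx (pr s e) (formula_code \<phi>) * d \<le> n * 2 ^ s + (formula_code \<phi> + 1) * d)"
proof -
  let ?a = "\<lambda>s. code_approx (pr s e) (formula_code \<phi>)" and ?c = "formula_code \<phi>"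
  have a: "\<bar>2 ^ s * val (env e) \<phi> - ?a s\<bar> \<le> ?c + 1" for s
    using code_approx[OF assms(1)] by blast
  have iff: "?a s * d \<le> n * 2 ^ s + (?c + 1) * d \<longleftrightarrow> ?a s \<le> 2 ^ s * (real n / real d) + (?c + 1)" for s
  proof -
    have "?a s * d \<le> n * 2 ^ s + (?c + 1) * d \<longleftrightarrow> real (?a s * d) \<le> real (n * 2 ^ s + (?c + 1) * d)"
      by (simp only: of_nat_le_iff)
    also have "\<dots> \<longleftrightarrow> ?a s \<le> 2 ^ s * (real n / real d) + (?c + 1)"
      using assms(2) by (simp add: field_simps)
    finally show ?thesis .
  qed
  show ?thesis
    unfolding iff
  proof
    assume v: "val (env e) \<phi> \<le> real n / real d"
    have "2 ^ s * val (env e) \<phi> \<le> 2 ^ s * (real n / real d)" for s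
      by (rule mult_left_mono[OF v]) simp
    then show "\<forall>s. ?a s \<le> 2 ^ s * (real n / real d) + (?c + 1)"
      using a by (smt (verit))
  next
    assume *: "\<forall>s. ?a s \<le> 2 ^ s * (real n / real d) + (?c + 1)"
    show "val (env e) \<phi> \<le> real n / real d"
    proof (rule ccontr)
      assume "\<not> val (env e) \<phi> \<le> real n / real d"
      then obtain s where s: "2 * (real ?c + 1) < 2 ^ s * (val (env e) \<phi> - real n / real d)"
        using ex_power_gt[of "val (env e) \<phi> - real n / real d" "2 * (real ?c + 1)"] by auto
      then show False
        using a[of s] spec[OF *, of s] by (simp add: right_diff_distrib abs_le_iff)
    qed
  qed
qed

section \<open>Quantifier blocks\<close>

text \<open>The classes are defined with an unspecified block length; removing the maximal block
  instead gives a deterministic test, justified by \<open>Pi_formula_Suc\<close>.\<close>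

primrec strip_Sup :: "mformula \<Rightarrow> mformula" where
  "strip_Sup (DistF s t) = DistF s t"
| "strip_Sup (PredF P ts) = PredF P ts"
| "strip_Sup (NegF \<phi>) = NegF \<phi>"
| "strip_Sup (HalfF \<phi>) = HalfF \<phi>"
| "strip_Sup (MinusF \<phi> \<psi>) = MinusF \<phi> \<psi>"
| "strip_Sup (SupF x \<phi>) = strip_Sup \<phi>"
| "strip_Sup (InfF x \<phi>) = InfF x \<phi>"

primrec strip_Inf :: "mformula \<Rightarrow> mformula" where
  "strip_Inf (DistF s t) = DistF s t"
| "strip_Inf (PredF P ts) = PredF P ts"
| "strip_Inf (NegF \<phi>) = NegF \<phi>"
| "strip_Inf (HalfF \<phi>) = HalfF \<phi>"
| "strip_Inf (MinusF \<phi> \<psi>) = MinusF \<phi> \<psi>"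
| "strip_Inf (SupF x \<phi>) = SupF x \<phi>"
| "strip_Inf (InfF x \<phi>) = strip_Inf \<phi>"

lemma foldr_eq_quantifier:
  "foldr InfF xs \<psi> = SupF x \<phi> \<longleftrightarrow> xs = [] \<and> \<psi> = SupF x \<phi>"
  "foldr SupF xs \<psi> = InfF x \<phi> \<longleftrightarrow> xs = [] \<and> \<psi> = InfF x \<phi>"
  by (cases xs; simp)+

text \<open>The maximal block may be longer than the block chosen in the definition, so each class
  has to survive removal of further leading quantifiers of either kind.\<close>

lemma subformula_class:
  "(Sigma_formula N (SupF x \<phi>) \<longrightarrow> Sigma_formula N \<phi>) \<and> (Pi_formula N (SupF x \<phi>) \<longrightarrow> Pi_formula N \<phi>) \<and>
   (Sigma_formula N (InfF x \<phi>) \<longrightarrow> Sigma_formula N \<phi>) \<and> (Pi_formula N (InfF x \<phi>) \<longrightarrow> Pi_formula N \<phi>)"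
proof (induction N)
  case (Suc N)
  show ?case
  proof (intro conjI impI)
    assume "Sigma_formula (Suc N) (SupF x \<phi>)"
    \<comment> \<open>A nonempty block of infima cannot begin with a supremum, so the block is
      empty.\<close>
    then have "Pi_formula N (SupF x \<phi>)" using foldr_eq_quantifier(1) by (metis Sigma_formula.simps(2))
    with Suc show "Sigma_formula (Suc N) \<phi>" by (simp only: Sigma_formula_of_Pi)
  next
    assume "Pi_formula (Suc N) (InfF x \<phi>)"
    then have "Sigma_formula N (InfF x \<phi>)" using foldr_eq_quantifier(2) by (metis Pi_formula.simps(2))
    with Suc show "Pi_formula (Suc N) \<phi>" by (simp only: Pi_formula_of_Sigma)
  next
    assume "Pi_formula (Suc N) (SupF x \<phi>)"
    then obtain xs \<psi> where \<psi>: "SupF x \<phi> = foldr SupF xs \<psi>" "Sigma_formula N \<psi>" by auto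
    show "Pi_formula (Suc N) \<phi>"
    proof (cases xs)
      case Nil
      with \<psi> Suc show ?thesis by (simp only: foldr.simps id_apply Pi_formula_of_Sigma)
    next
      case (Cons y ys)
      with \<psi> show ?thesis by auto
    qed
  next
    assume "Sigma_formula (Suc N) (InfF x \<phi>)"
    then obtain xs \<psi> where \<psi>: "InfF x \<phi> = foldr InfF xs \<psi>" "Pi_formula N \<psi>" by auto
    show "Sigma_formula (Suc N) \<phi>"
    proof (cases xs)
      case Nil
      with \<psi> Suc show ?thesis by (simp only: foldr.simps id_apply Sigma_formula_of_Pi)
    next
      case (Cons y ys)
      with \<psi> show ?thesis by auto
    qed
  qed
qed simp

lemma strip_class:
  "Sigma_formula N \<phi> \<Longrightarrow> Sigma_formula N (strip_Sup \<phi>)" "Pi_formula N \<phi> \<Longrightarrow> Pi_formula N (strip_Inf \<phi>)"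
proof -
  show "Sigma_formula N \<phi> \<Longrightarrow> Sigma_formula N (strip_Sup \<phi>)"
  proof (induction \<phi>)
    case (SupF x \<phi>)
    have "Sigma_formula N \<phi>" using subformula_class[of N x \<phi>] SupF.prems by blast
    then show ?case unfolding strip_Sup.simps by (rule SupF.IH)
  qed (simp_all only: strip_Sup.simps)
  show "Pi_formula N \<phi> \<Longrightarrow> Pi_formula N (strip_Inf \<phi>)"
  proof (induction \<phi>)
    case (InfF x \<phi>)
    have "Pi_formula N \<phi>" using subformula_class[of N x \<phi>] InfF.prems by blast
    then show ?case unfolding strip_Inf.simps by (rule InfF.IH)
  qed (simp_all only: strip_Inf.simps)
qed

lemma strip_foldr: "strip_Sup (foldr SupF xs \<phi>) = strip_Sup \<phi>" "strip_Inf (foldr InfF xs \<phi>) = strip_Inf \<phi>"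
  by (induction xs) simp_all

lemma foldr_strip: "\<exists>xs. \<phi> = foldr SupF xs (strip_Sup \<phi>)" "\<exists>xs. \<phi> = foldr InfF xs (strip_Inf \<phi>)"
proof -
  show "\<exists>xs. \<phi> = foldr SupF xs (strip_Sup \<phi>)"
  proof (induction \<phi>)
    case (SupF x \<phi>)
    then obtain xs where "\<phi> = foldr SupF xs (strip_Sup \<phi>)" ..
    then show ?case by (intro exI[of _ "x # xs"]) simp
  qed (auto intro: exI[of _ "[]"])
  show "\<exists>xs. \<phi> = foldr InfF xs (strip_Inf \<phi>)"
  proof (induction \<phi>)
    case (InfF x \<phi>)
    then obtain xs where "\<phi> = foldr InfF xs (strip_Inf \<phi>)" ..
    then show ?case by (intro exI[of _ "x # xs"]) simp
  qed (auto intro: exI[of _ "[]"])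
qed

lemma Pi_formula_Suc: "Pi_formula (Suc N) \<phi> \<longleftrightarrow> Sigma_formula N (strip_Sup \<phi>)"
proof
  assume "Pi_formula (Suc N) \<phi>"
  then obtain xs \<psi> where "\<phi> = foldr SupF xs \<psi>" "Sigma_formula N \<psi>" by auto
  then show "Sigma_formula N (strip_Sup \<phi>)" by (simp only: strip_foldr strip_class)
next
  assume "Sigma_formula N (strip_Sup \<phi>)"
  with foldr_strip(1)[of \<phi>] show "Pi_formula (Suc N) \<phi>" unfolding Pi_formula.simps by blast
qed

lemma Sigma_formula_Suc: "Sigma_formula (Suc N) \<phi> \<longleftrightarrow> Pi_formula N (strip_Inf \<phi>)"
proof
  assume "Sigma_formula (Suc N) \<phi>"
  then obtain xs \<psi> where "\<phi> = foldr InfF xs \<psi>" "Pi_formula N \<psi>" by auto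
  then show "Pi_formula N (strip_Inf \<phi>)" by (simp only: strip_foldr strip_class)
next
  assume "Pi_formula N (strip_Inf \<phi>)"
  with foldr_strip(2)[of \<phi>] show "Sigma_formula (Suc N) \<phi>" unfolding Sigma_formula.simps by blast
qed

lemma wf_strip: "wf_formula arith_lang \<phi> \<Longrightarrow> wf_formula arith_lang (strip_Sup \<phi>)" "wf_formula arith_lang \<phi> \<Longrightarrow> wf_formula arith_lang (strip_Inf \<phi>)"
  by (induction \<phi>) simp_all

text \<open>A state \<open>(c, e, w)\<close> consists of the codes of a formula, of an environment, and of a list of
  values for the variables to be stripped. The tag \<open>t\<close> is \<open>5\<close> for suprema and \<open>6\<close> for infima.\<close>

definition strip_step :: "nat \<Rightarrow> nat \<Rightarrow> nat" where
  "strip_step t z =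
    (if pfst (pfst z) = t
     then triple (psnd (psnd (pfst z))) (cons (pr (pfst (psnd (pfst z))) (lhd (psnd (psnd z)))) (pfst (psnd z)))
       (ltl (psnd (psnd z)))
     else z)"

definition strip :: "nat \<Rightarrow> nat \<Rightarrow> nat" where
  "strip t z = (strip_step t ^^ pfst z) z"

lemma rcf_strip [rc]:
  assumes "rcf f" shows "rcf (\<lambda>x. strip t (f x))"
proof -
  have f: "(g ^^ k) z = rec_nat z (\<lambda>_. g) k" for g :: "nat \<Rightarrow> nat" and k z
    by (induction k) simp_all
  have "rcf (\<lambda>z. strip t z)"
    unfolding strip_def f strip_step_def by (intro rc)
  from rcf_comp[OF this assms] show ?thesis .
qed

lemma strip_step_simps [simp]:
  "strip_step 5 (triple (formula_code (SupF x \<phi>)) e w) =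
     triple (formula_code \<phi>) (cons (pr x (lhd w)) e) (ltl w)"
  "strip_step 6 (triple (formula_code (InfF x \<phi>)) e w) =
     triple (formula_code \<phi>) (cons (pr x (lhd w)) e) (ltl w)"
  by (simp_all add: strip_step_def)

lemma strip_step_other:
  "(\<And>x \<psi>. \<phi> \<noteq> SupF x \<psi>) \<Longrightarrow> (strip_step 5 ^^ k) (triple (formula_code \<phi>) e w) = triple (formula_code \<phi>) e w"
  "(\<And>x \<psi>. \<phi> \<noteq> InfF x \<psi>) \<Longrightarrow> (strip_step 6 ^^ k) (triple (formula_code \<phi>) e w) = triple (formula_code \<phi>) e w"
proof -
  show "(strip_step 5 ^^ k) (triple (formula_code \<phi>) e w) = triple (formula_code \<phi>) e w"
    if "\<And>x \<psi>. \<phi> \<noteq> SupF x \<psi>"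
    by (induction k) (use that in \<open>cases \<phi>; simp add: strip_step_def\<close>)+
  show "(strip_step 6 ^^ k) (triple (formula_code \<phi>) e w) = triple (formula_code \<phi>) e w"
    if "\<And>x \<psi>. \<phi> \<noteq> InfF x \<psi>"
    by (induction k) (use that in \<open>cases \<phi>; simp add: strip_step_def\<close>)+
qed

text \<open>Every pair \<open>(a, w)\<close> is the head and tail of some code, so one quantifier
  over lists covers a whole block.\<close>

lemma all_cons: "(\<forall>w. P (lhd w) (ltl w)) \<longleftrightarrow> (\<forall>a w. P a w)"
  by (metis lhd_Cons ltl_Cons)

lemma ex_cons: "(\<exists>w. P (lhd w) (ltl w)) \<longleftrightarrow> (\<exists>a w. P a w)"
  by (metis lhd_Cons ltl_Cons)

definition strip_env :: "nat \<Rightarrow> nat \<Rightarrow> nat \<Rightarrow> nat \<Rightarrow> nat" where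
  "strip_env t c e w = pfst (psnd (strip t (triple c e w)))"

lemma formula_code_less:
  "formula_code \<phi> < formula_code (SupF x \<phi>)" "formula_code \<phi> < formula_code (InfF x \<phi>)"
  using subcode_less(3)[of "formula_code (SupF x \<phi>)"] subcode_less(3)[of "formula_code (InfF x \<phi>)"]
  by simp_all

text \<open>Each quantifier increases the code, so the code bounds the length of the block, and
  surplus steps change nothing. The whole block of universal quantifiers becomes a single one over
  \<open>w\<close>.\<close>

lemma strip_Sup_iter:
  "formula_code \<phi> \<le> k \<Longrightarrow> pfst ((strip_step 5 ^^ k) (triple (formula_code \<phi>) e w)) = formula_code (strip_Sup \<phi>) \<and>
   (val (env e) \<phi> \<le> r \<longleftrightarrow> (\<forall>w. val (env (pfst (psnd ((strip_step 5 ^^ k) (triple (formula_code \<phi>) e w))))) (strip_Sup \<phi>) \<le> r))"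
proof (induction \<phi> arbitrary: k e w)
  case (SupF x \<phi>)
  then obtain k' where k: "k = Suc k'" "formula_code \<phi> \<le> k'"
    using formula_code_less(1)[of \<phi> x] by (cases k) auto
  have step: "(strip_step 5 ^^ k) (triple (formula_code (SupF x \<phi>)) e w) =
      (strip_step 5 ^^ k') (triple (formula_code \<phi>) (cons (pr x (lhd w)) e) (ltl w))" for w
    unfolding k funpow_Suc_right comp_apply strip_step_simps ..
  note IH = SupF.IH[OF k(2)]
  have "val (env e) (SupF x \<phi>) \<le> r \<longleftrightarrow> (\<forall>a. val (env (cons (pr x a) e)) \<phi> \<le> r)"
    unfolding val_SupF_le env_cons ..
  also have "\<dots> \<longleftrightarrow> (\<forall>a w. val (env (pfst (psnd ((strip_step 5 ^^ k')
      (triple (formula_code \<phi>) (cons (pr x a) e) w))))) (strip_Sup \<phi>) \<le> r)"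
    using IH by blast
  also have "\<dots> \<longleftrightarrow> (\<forall>w. val (env (pfst (psnd ((strip_step 5 ^^ k')
      (triple (formula_code \<phi>) (cons (pr x (lhd w)) e) (ltl w)))))) (strip_Sup \<phi>) \<le> r)"
    by (rule all_cons[symmetric])
  finally show ?case
    unfolding step strip_Sup.simps using IH by blast
qed (simp_all only: strip_step_other mformula.distinct not_False_eq_True strip_Sup.simps pfst_pr psnd_pr simp_thms)

lemma strip_Inf_iter:
  "formula_code \<phi> \<le> k \<Longrightarrow> pfst ((strip_step 6 ^^ k) (triple (formula_code \<phi>) e w)) = formula_code (strip_Inf \<phi>) \<and>
   (val (env e) \<phi> < r \<longleftrightarrow> (\<exists>w. val (env (pfst (psnd ((strip_step 6 ^^ k) (triple (formula_code \<phi>) e w))))) (strip_Inf \<phi>) < r))"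
proof (induction \<phi> arbitrary: k e w)
  case (InfF x \<phi>)
  then obtain k' where k: "k = Suc k'" "formula_code \<phi> \<le> k'"
    using formula_code_less(2)[of \<phi> x] by (cases k) auto
  have step: "(strip_step 6 ^^ k) (triple (formula_code (InfF x \<phi>)) e w) =
      (strip_step 6 ^^ k') (triple (formula_code \<phi>) (cons (pr x (lhd w)) e) (ltl w))" for w
    unfolding k funpow_Suc_right comp_apply strip_step_simps ..
  note IH = InfF.IH[OF k(2)]
  have "val (env e) (InfF x \<phi>) < r \<longleftrightarrow> (\<exists>a. val (env (cons (pr x a) e)) \<phi> < r)"
    unfolding val_InfF_less env_cons ..
  also have "\<dots> \<longleftrightarrow> (\<exists>a w. val (env (pfst (psnd ((strip_step 6 ^^ k')
      (triple (formula_code \<phi>) (cons (pr x a) e) w))))) (strip_Inf \<phi>) < r)"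
    using IH by blast
  also have "\<dots> \<longleftrightarrow> (\<exists>w. val (env (pfst (psnd ((strip_step 6 ^^ k')
      (triple (formula_code \<phi>) (cons (pr x (lhd w)) e) (ltl w)))))) (strip_Inf \<phi>) < r)"
    by (rule ex_cons[symmetric])
  finally show ?case
    unfolding step strip_Inf.simps using IH by blast
qed (simp_all only: strip_step_other mformula.distinct not_False_eq_True strip_Inf.simps pfst_pr psnd_pr simp_thms)

lemma pfst_strip:
  "pfst (strip 5 (triple (formula_code \<phi>) e w)) = formula_code (strip_Sup \<phi>)"
  "pfst (strip 6 (triple (formula_code \<phi>) e w)) = formula_code (strip_Inf \<phi>)"
  unfolding strip_def pfst_pr using strip_Sup_iter strip_Inf_iter by blast+

lemma val_strip:
  "val (env e) \<phi> \<le> r \<longleftrightarrow> (\<forall>w. val (env (strip_env 5 (formula_code \<phi>) e w)) (strip_Sup \<phi>) \<le> r)"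
  "val (env e) \<phi> < r \<longleftrightarrow> (\<exists>w. val (env (strip_env 6 (formula_code \<phi>) e w)) (strip_Inf \<phi>) < r)"
  unfolding strip_env_def strip_def pfst_pr using strip_Sup_iter strip_Inf_iter by blast+

section \<open>Complexity of the diagrams\<close>

text \<open>\<open>T\<close> is constrained only on codes of well-formed formulas in
  \<open>C\<close> and positive denominators; the rest is filtered out later by a decidable test.
  Fractions need not be in lowest terms.\<close>

definition decides :: "(mformula \<Rightarrow> bool) \<Rightarrow> (real \<Rightarrow> real \<Rightarrow> bool) \<Rightarrow> (nat \<Rightarrow> bool) \<Rightarrow> bool" where
  "decides C R T \<longleftrightarrow> (\<forall>\<phi> e n d. wf_formula arith_lang \<phi> \<and> C \<phi> \<and> 0 < d \<longrightarrow>
     (T (triple (formula_code \<phi>) e (pr n d)) \<longleftrightarrow> R (val (env e) \<phi>) (real n / real d)))"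

lemma decidesD:
  "decides C R T \<Longrightarrow> wf_formula arith_lang \<phi> \<Longrightarrow> C \<phi> \<Longrightarrow> 0 < d \<Longrightarrow>
    T (triple (formula_code \<phi>) e (pr n d)) \<longleftrightarrow> R (val (env e) \<phi>) (real n / real d)"
  by (simp add: decides_def)

lemma quantifier_free_decides:
  "\<exists>T. sigp (Suc 0) T \<and> decides quantifier_free (<) T"
  "\<exists>T. pip (Suc 0) T \<and> decides quantifier_free (\<le>) T"
proof -
  let ?a = "\<lambda>z s. code_approx (pr s (pfst (psnd z))) (pfst z)"
  let ?n = "\<lambda>z. pfst (psnd (psnd z))" and ?d = "\<lambda>z. psnd (psnd (psnd z))"
  show "\<exists>T. sigp (Suc 0) T \<and> decides quantifier_free (<) T"
  proof (intro exI conjI)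
    show "sigp (Suc 0) (\<lambda>z. \<exists>s. (?a z s + pfst z + 1) * ?d z < ?n z * 2 ^ s)"
      by (rule sigp_ExI, unfold pip_0) (intro rc)
    show "decides quantifier_free (<) (\<lambda>z. \<exists>s. (?a z s + pfst z + 1) * ?d z < ?n z * 2 ^ s)"
      unfolding decides_def using val_less_iff_approx by simp
  qed
  show "\<exists>T. pip (Suc 0) T \<and> decides quantifier_free (\<le>) T"
  proof (intro exI conjI)
    show "pip (Suc 0) (\<lambda>z. \<forall>s. ?a z s * ?d z \<le> ?n z * 2 ^ s + (pfst z + 1) * ?d z)"
      by (rule pip_AllI, unfold sigp_0) (intro rc)
    show "decides quantifier_free (\<le>) (\<lambda>z. \<forall>s. ?a z s * ?d z \<le> ?n z * 2 ^ s + (pfst z + 1) * ?d z)"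
      unfolding decides_def using val_le_iff_approx by simp
  qed
qed

definition stripped :: "nat \<Rightarrow> nat \<Rightarrow> nat \<Rightarrow> nat" where
  "stripped t z w =
    triple (pfst (strip t (triple (pfst z) (pfst (psnd z)) w)))
      (pfst (psnd (strip t (triple (pfst z) (pfst (psnd z)) w)))) (psnd (psnd z))"

lemma rcf_stripped [rc]: "rcf f \<Longrightarrow> rcf g \<Longrightarrow> rcf (\<lambda>x. stripped t (f x) (g x))"
  by (rule rcf2_app[of "stripped t"]) (unfold stripped_def, intro rc)

lemma stripped:
  "stripped 5 (triple (formula_code \<phi>) e q) w =
    triple (formula_code (strip_Sup \<phi>)) (strip_env 5 (formula_code \<phi>) e w) q"
  "stripped 6 (triple (formula_code \<phi>) e q) w =
    triple (formula_code (strip_Inf \<phi>)) (strip_env 6 (formula_code \<phi>) e w) q"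
  by (simp_all only: stripped_def pfst_pr psnd_pr pfst_strip strip_env_def)

text \<open>A supremum commutes with \<open>\<le>\<close>, and the resulting universal quantifier is
  absorbed by the leading one of \<open>T\<close>, so the level stays put.\<close>

lemma decides_closed_Pi_Suc:
  assumes "pip (Suc m) T" "decides (Sigma_formula N) (\<le>) T"
  shows "\<exists>T. pip (Suc m) T \<and> decides (Pi_formula (Suc N)) (\<le>) T"
proof (intro exI conjI)
  show "pip (Suc m) (\<lambda>z. \<forall>w. T (stripped 5 z w))"
    by (intro pip_All pip_comp[OF assms(1)] rc)
  show "decides (Pi_formula (Suc N)) (\<le>) (\<lambda>z. \<forall>w. T (stripped 5 z w))"
    unfolding decides_def
  proof (intro allI impI; elim conjE)
    fix \<phi> e n d
    assume "wf_formula arith_lang \<phi>" "Pi_formula (Suc N) \<phi>" "0 < (d :: nat)"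
    then have "T (stripped 5 (triple (formula_code \<phi>) e (pr n d)) w) \<longleftrightarrow>
        val (env (strip_env 5 (formula_code \<phi>) e w)) (strip_Sup \<phi>) \<le> real n / real d" for w
      unfolding stripped Pi_formula_Suc by (intro decidesD[OF assms(2)] wf_strip)
    then show "(\<forall>w. T (stripped 5 (triple (formula_code \<phi>) e (pr n d)) w)) \<longleftrightarrow>
        val (env e) \<phi> \<le> real n / real d"
      by (subst val_strip(1)) (simp only:)
  qed
qed

lemma decides_open_Sigma_Suc:
  assumes "sigp (Suc m) T" "decides (Pi_formula N) (<) T"
  shows "\<exists>T. sigp (Suc m) T \<and> decides (Sigma_formula (Suc N)) (<) T"
proof (intro exI conjI)
  show "sigp (Suc m) (\<lambda>z. \<exists>w. T (stripped 6 z w))"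
    by (intro sigp_Ex sigp_comp[OF assms(1)] rc)
  show "decides (Sigma_formula (Suc N)) (<) (\<lambda>z. \<exists>w. T (stripped 6 z w))"
    unfolding decides_def
  proof (intro allI impI; elim conjE)
    fix \<phi> e n d
    assume "wf_formula arith_lang \<phi>" "Sigma_formula (Suc N) \<phi>" "0 < (d :: nat)"
    then have "T (stripped 6 (triple (formula_code \<phi>) e (pr n d)) w) \<longleftrightarrow>
        val (env (strip_env 6 (formula_code \<phi>) e w)) (strip_Inf \<phi>) < real n / real d" for w
      unfolding stripped Sigma_formula_Suc by (intro decidesD[OF assms(2)] wf_strip)
    then show "(\<exists>w. T (stripped 6 (triple (formula_code \<phi>) e (pr n d)) w)) \<longleftrightarrow>
        val (env e) \<phi> < real n / real d"
      by (subst val_strip(2)) (simp only:)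
  qed
qed

lemma frac_less_iff: "0 < d \<Longrightarrow> 0 < b \<Longrightarrow> real a / real b < real n / real d \<longleftrightarrow> a * d < n * b"
proof -
  assume "0 < d" "0 < b"
  then have "real a / real b < real n / real d \<longleftrightarrow> real (a * d) < real (n * b)"
    by (simp add: field_simps)
  then show ?thesis by (simp only: of_nat_less_iff)
qed

lemma ex_frac_below:
  assumes "0 \<le> v" "v < real n / real d" "0 < d"
  shows "\<exists>a b. 0 < b \<and> a * d < n * b \<and> v \<le> real a / real b"
proof -
  obtain r where r: "v < of_rat r" "of_rat r < real n / real d"
    using of_rat_dense[OF assms(2)] by blast
  then have "0 \<le> r" using assms(1) by (metis le_less_trans less_imp_le zero_less_of_rat_iff)
  obtain p q where pq: "r = of_int p / of_int q" "0 < q"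
    using quotient_of_div quotient_of_denom_pos' by (metis prod.collapse)
  have "0 \<le> p" using \<open>0 \<le> r\<close> pq by (simp add: zero_le_divide_iff)
  then have "(of_rat r :: real) = real (nat p) / real (nat q)"
    using pq by (simp add: of_rat_divide)
  with r pq(2) assms(3) frac_less_iff[of d "nat q" "nat p" n] show ?thesis
    by (intro exI[of _ "nat p"] exI[of _ "nat q"]) simp
qed

lemma ex_frac_above:
  assumes "real n / real d < v" "0 < d"
  shows "\<exists>a b. 0 < b \<and> n * b < a * d \<and> real a / real b \<le> v"
proof -
  obtain r where r: "real n / real d < of_rat r" "of_rat r < v"
    using of_rat_dense[OF assms(1)] by blast
  have "0 \<le> real n / real d" by simp
  then have "0 \<le> r" using r(1) by (metis le_less_trans less_imp_le zero_less_of_rat_iff)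
  obtain p q where pq: "r = of_int p / of_int q" "0 < q"
    using quotient_of_div quotient_of_denom_pos' by (metis prod.collapse)
  have "0 \<le> p" using \<open>0 \<le> r\<close> pq by (simp add: zero_le_divide_iff)
  then have "(of_rat r :: real) = real (nat p) / real (nat q)"
    using pq by (simp add: of_rat_divide)
  with r pq(2) assms(2) frac_less_iff[of "nat q" d n "nat p"] show ?thesis
    by (intro exI[of _ "nat p"] exI[of _ "nat q"]) simp
qed

text \<open>The quantifier over intermediate rationals costs one level; applied to
  \<open>Pi_formula\<close> it gives the additional level of the open diagram.\<close>

lemma decides_open_of_closed:
  assumes "pip (Suc m) T" "decides C (\<le>) T"
  shows "\<exists>T. sigp (Suc (Suc m)) T \<and> decides C (<) T"
proof (intro exI conjI)
  let ?n = "\<lambda>z. pfst (psnd (psnd z))" and ?d = "\<lambda>z. psnd (psnd (psnd z))"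
  let ?T = "\<lambda>z. \<exists>q. (0 < psnd q \<and> pfst q * ?d z < ?n z * psnd q) \<and> T (triple (pfst z) (pfst (psnd z)) q)"
  show "sigp (Suc (Suc m)) ?T"
    by (intro sigp_ExI pip_conj pip_comp[OF assms(1)] rc)
  show "decides C (<) ?T"
    unfolding decides_def
  proof (intro allI impI; elim conjE)
    fix \<phi> e n d
    assume \<phi>: "wf_formula arith_lang \<phi>" "C \<phi>" "0 < (d :: nat)"
    have T: "T (triple (formula_code \<phi>) e (pr a b)) \<longleftrightarrow> val (env e) \<phi> \<le> real a / real b" if "0 < b" for a b
      using decidesD[OF assms(2) \<phi>(1,2) that] .
    have "?T (triple (formula_code \<phi>) e (pr n d)) \<longleftrightarrow>
        (\<exists>a b. 0 < b \<and> a * d < n * b \<and> val (env e) \<phi> \<le> real a / real b)"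
      unfolding ex_pr[of "\<lambda>q. (0 < psnd q \<and> _ q) \<and> _ q"] pfst_pr psnd_pr using T by blast
    also have "\<dots> \<longleftrightarrow> val (env e) \<phi> < real n / real d"
      using ex_frac_below[OF conjunct1[OF val_bounds[of "env e" \<phi>]], of n d] frac_less_iff[OF \<phi>(3)] \<phi>(3)
      by (meson le_less_trans)
    finally show "?T (triple (formula_code \<phi>) e (pr n d)) \<longleftrightarrow> val (env e) \<phi> < real n / real d" .
  qed
qed

lemma decides_closed_of_open:
  assumes "sigp m T" "decides C (<) T"
  shows "\<exists>T. pip (Suc m) T \<and> decides C (\<le>) T"
proof (intro exI conjI)
  let ?n = "\<lambda>z. pfst (psnd (psnd z))" and ?d = "\<lambda>z. psnd (psnd (psnd z))"
  let ?T = "\<lambda>z. \<forall>q. 0 < psnd q \<and> ?n z * psnd q < pfst q * ?d z \<longrightarrow> T (triple (pfst z) (pfst (psnd z)) q)"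
  show "pip (Suc m) ?T"
    by (intro pip_AllI sigp_imp sigp_comp[OF assms(1)] rc)
  show "decides C (\<le>) ?T"
    unfolding decides_def
  proof (intro allI impI; elim conjE)
    fix \<phi> e n d
    assume \<phi>: "wf_formula arith_lang \<phi>" "C \<phi>" "0 < (d :: nat)"
    have T: "T (triple (formula_code \<phi>) e (pr a b)) \<longleftrightarrow> val (env e) \<phi> < real a / real b" if "0 < b" for a b
      using decidesD[OF assms(2) \<phi>(1,2) that] .
    have "?T (triple (formula_code \<phi>) e (pr n d)) \<longleftrightarrow>
        (\<forall>a b. 0 < b \<and> n * b < a * d \<longrightarrow> val (env e) \<phi> < real a / real b)"
      unfolding all_pr[of "\<lambda>q. 0 < psnd q \<and> _ q \<longrightarrow> _ q"] pfst_pr psnd_pr using T by blast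
    also have "\<dots> \<longleftrightarrow> val (env e) \<phi> \<le> real n / real d"
      using ex_frac_above[of n d "val (env e) \<phi>"] frac_less_iff[OF _ \<phi>(3)] \<phi>(3)
      by (meson le_less_trans not_le)
    finally show "?T (triple (formula_code \<phi>) e (pr n d)) \<longleftrightarrow> val (env e) \<phi> \<le> real n / real d" .
  qed
qed

text \<open>The four bounds need a joint induction, as each class is built from the dual one. The
  \<open>max 1 N\<close> reflects that values of quantifier-free formulas are only approximable, so
  comparisons start at level 1.\<close>

lemma diagrams_decided:
  "(\<exists>T. pip (max 1 N) T \<and> decides (Pi_formula N) (\<le>) T) \<and>
   (\<exists>T. sigp (Suc N) T \<and> decides (Pi_formula N) (<) T) \<and>
   (\<exists>T. pip (Suc N) T \<and> decides (Sigma_formula N) (\<le>) T) \<and>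
   (\<exists>T. sigp (max 1 N) T \<and> decides (Sigma_formula N) (<) T)"
proof (induction N)
  case 0
  have "Pi_formula 0 = quantifier_free" "Sigma_formula 0 = quantifier_free" by (simp_all add: fun_eq_iff)
  then show ?case using quantifier_free_decides by simp
next
  case (Suc N)
  have m: "max 1 (Suc N) = Suc N" by simp
  have cp: "\<exists>T. pip (Suc N) T \<and> decides (Pi_formula (Suc N)) (\<le>) T"
    using Suc decides_closed_Pi_Suc by blast
  have os: "\<exists>T. sigp (Suc N) T \<and> decides (Sigma_formula (Suc N)) (<) T"
    using Suc decides_open_Sigma_Suc by blast
  show ?case
    unfolding m using cp os decides_open_of_closed decides_closed_of_open by blast
qed

section \<open>Membership in the diagrams and completeness\<close>

lemma rcp_class:
  "(\<exists>K. rcp K \<and> (\<forall>\<phi>. K (formula_code \<phi>) \<longleftrightarrow> Sigma_formula N \<phi>)) \<and>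
   (\<exists>K. rcp K \<and> (\<forall>\<phi>. K (formula_code \<phi>) \<longleftrightarrow> Pi_formula N \<phi>))"
proof (induction N)
  case 0
  have "rcp (\<lambda>c. code_qf c \<noteq> 0)" by (intro rc)
  then show ?case using code_qf by (auto intro!: exI[of _ "\<lambda>c. code_qf c \<noteq> 0"])
next
  case (Suc N)
  then obtain K K' where K: "rcp K" "\<And>\<phi>. K (formula_code \<phi>) \<longleftrightarrow> Sigma_formula N \<phi>"
    and K': "rcp K'" "\<And>\<phi>. K' (formula_code \<phi>) \<longleftrightarrow> Pi_formula N \<phi>" by blast
  show ?case
  proof (intro conjI exI allI)
    \<comment> \<open>The stripped formula does not depend on the environment or the supplied
      values, so 0 serves for both.\<close>
    show "rcp (\<lambda>c. K' (pfst (strip 6 (triple c 0 0))))" "rcp (\<lambda>c. K (pfst (strip 5 (triple c 0 0))))"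
      by (intro rc rcp_comp[OF K(1)] rcp_comp[OF K'(1)])+
  qed (simp_all only: pfst_strip K(2) K'(2) Sigma_formula_Suc Pi_formula_Suc)
qed

text \<open>\<open>rat_code\<close> yields lowest terms, so other fractions are rejected. The last
  conjunct is coprimality with all quantifiers bounded; \<open>k = 0\<close> cannot divide the
  positive denominator.\<close>

definition code_rat :: "nat \<Rightarrow> bool" where
  "code_rat q \<longleftrightarrow> 0 < psnd q \<and> pfst q \<le> psnd q \<and>
     (\<forall>k\<le>psnd q. (\<exists>i\<le>pfst q. k * i = pfst q) \<and> (\<exists>i\<le>psnd q. k * i = psnd q) \<longrightarrow> k = 1)"

lemma rcp_code_rat [rc]: "rcf f \<Longrightarrow> rcp (\<lambda>x. code_rat (f x))"
  by (rule rcp_comp) (unfold code_rat_def, intro rc)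

lemma dvd_iff_bounded: "0 < k \<Longrightarrow> k dvd a \<longleftrightarrow> (\<exists>i\<le>a. k * i = (a :: nat))"
  by (auto simp: dvd_def)

lemma code_rat_coprime: "code_rat q \<longleftrightarrow> 0 < psnd q \<and> pfst q \<le> psnd q \<and> coprime (pfst q) (psnd q)"
proof (cases "0 < psnd q")
  case True
  have "(\<exists>i\<le>pfst q. k * i = pfst q) \<and> (\<exists>i\<le>psnd q. k * i = psnd q) \<longleftrightarrow> k dvd pfst q \<and> k dvd psnd q" for k
    using True dvd_iff_bounded[of k] by (cases "k = 0") auto
  moreover have "k \<le> psnd q" if "k dvd psnd q" for k
    using that True by (rule dvd_imp_le)
  ultimately show ?thesis
    unfolding code_rat_def coprime_def nat_dvd_1_iff_1 by blast
qed (simp add: code_rat_def)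

lemma rat_code_props:
  assumes "0 \<le> r"
  shows "0 < psnd (rat_code r)" "coprime (pfst (rat_code r)) (psnd (rat_code r))"
    "r = of_nat (pfst (rat_code r)) / of_nat (psnd (rat_code r))"
proof -
  obtain p q where pq: "quotient_of r = (p, q)" by fastforce
  have *: "0 < q" "0 \<le> p" "coprime p q"
    using quotient_of_denom_pos[OF pq] quotient_of_nonneg[OF assms] quotient_of_coprime[OF pq] pq
    by simp_all
  then obtain a b where ab: "p = int a" "q = int b"
    by (metis nonneg_int_cases less_imp_le)
  then have c: "rat_code r = pr a b" by (simp add: rat_code_def pq)
  show "0 < psnd (rat_code r)" "coprime (pfst (rat_code r)) (psnd (rat_code r))"
    "r = of_nat (pfst (rat_code r)) / of_nat (psnd (rat_code r))"
    using * quotient_of_div[OF pq] unfolding c ab by simp_all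
qed

lemma code_rat: "code_rat q \<longleftrightarrow> (\<exists>r. 0 \<le> r \<and> r \<le> 1 \<and> rat_code r = q)"
proof
  assume "code_rat q"
  then have q: "0 < psnd q" "pfst q \<le> psnd q" "coprime (pfst q) (psnd q)"
    by (simp_all add: code_rat_coprime)
  then have "rat_code (of_nat (pfst q) / of_nat (psnd q)) = q"
    by (simp add: rat_code_coprime)
  then show "\<exists>r. 0 \<le> r \<and> r \<le> 1 \<and> rat_code r = q"
    using q by (intro exI[of _ "of_nat (pfst q) / of_nat (psnd q)"]) simp
next
  assume "\<exists>r. 0 \<le> r \<and> r \<le> 1 \<and> rat_code r = q"
  then obtain r where r: "0 \<le> r" "r \<le> 1" "rat_code r = q" by blast
  have "(of_nat (pfst q) :: rat) / of_nat (psnd q) \<le> 1"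
    using rat_code_props(3)[OF r(1)] r(2,3) by simp
  then show "code_rat q"
    using rat_code_props(1,2)[OF r(1)] r(3) by (simp add: code_rat_coprime)
qed

text \<open>Splits membership into a decidable syntactic test and the comparison \<open>T\<close>;
  by \<open>pip_conj\<close> and \<open>sigp_conj\<close> the former leaves the level
  unchanged.\<close>

lemma diagram_eq:
  assumes "\<And>\<phi>. K (formula_code \<phi>) \<longleftrightarrow> C \<phi>"
  shows "decides C (\<le>) T \<Longrightarrow> closed_diagram arith_lang arith_struct C =
      {z. (code_sentence (pfst z) \<and> K (pfst z) \<and> code_rat (psnd z)) \<and> T (triple (pfst z) 0 (psnd z))}"
    and "decides C (<) T \<Longrightarrow> open_diagram arith_lang arith_struct C =
      {z. (code_sentence (pfst z) \<and> K (pfst z) \<and> code_rat (psnd z)) \<and> T (triple (pfst z) 0 (psnd z))}"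
proof -
  have *: "T (triple (formula_code \<phi>) 0 (rat_code q)) \<longleftrightarrow> R (sentence_value arith_struct \<phi>) (of_rat q)"
    if "decides C R T" "sentence arith_lang \<phi>" "C \<phi>" "0 \<le> q" for \<phi> q R
  proof -
    have "(of_rat q :: real) = real (pfst (rat_code q)) / real (psnd (rat_code q))"
      by (subst rat_code_props(3)[OF that(4)]) (simp only: of_rat_divide of_rat_of_nat_eq)
    moreover have "wf_formula arith_lang \<phi>" using that(2) by (simp add: sentence_def)
    moreover have "rat_code q = pr (pfst (rat_code q)) (psnd (rat_code q))" by simp
    ultimately show ?thesis
      using decidesD[OF that(1) _ that(3) rat_code_props(1)[OF that(4)], of 0 "pfst (rat_code q)"]
        sentence_value_arith_struct[OF that(2), of "env 0"] by simp
  qed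
  have z: "z = pr (formula_code \<phi>) (rat_code q) \<longleftrightarrow> pfst z = formula_code \<phi> \<and> psnd z = rat_code q" for z \<phi> q
    by (metis pfst_pr psnd_pr pr_collapse)
  show "closed_diagram arith_lang arith_struct C =
      {z. (code_sentence (pfst z) \<and> K (pfst z) \<and> code_rat (psnd z)) \<and> T (triple (pfst z) 0 (psnd z))}"
    if "decides C (\<le>) T"
  proof -
    have "(\<exists>\<phi> q. z = pr (formula_code \<phi>) (rat_code q) \<and> sentence arith_lang \<phi> \<and> C \<phi> \<and> 0 \<le> q \<and> q \<le> 1 \<and>
        sentence_value arith_struct \<phi> \<le> of_rat q) \<longleftrightarrow>
      (code_sentence (pfst z) \<and> K (pfst z) \<and> code_rat (psnd z)) \<and> T (triple (pfst z) 0 (psnd z))" for z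
      unfolding z code_sentence code_rat using *[OF that] assms by metis
    then show ?thesis unfolding closed_diagram_def by (simp only:)
  qed
  show "open_diagram arith_lang arith_struct C =
      {z. (code_sentence (pfst z) \<and> K (pfst z) \<and> code_rat (psnd z)) \<and> T (triple (pfst z) 0 (psnd z))}"
    if "decides C (<) T"
  proof -
    have "(\<exists>\<phi> q. z = pr (formula_code \<phi>) (rat_code q) \<and> sentence arith_lang \<phi> \<and> C \<phi> \<and> 0 \<le> q \<and> q \<le> 1 \<and>
        sentence_value arith_struct \<phi> < of_rat q) \<longleftrightarrow>
      (code_sentence (pfst z) \<and> K (pfst z) \<and> code_rat (psnd z)) \<and> T (triple (pfst z) 0 (psnd z))" for z
      unfolding z code_sentence code_rat using *[OF that] assms by metis
    then show ?thesis unfolding open_diagram_def by (simp only:)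
  qed
qed

lemma diagram_in_class:
  assumes "\<exists>K. rcp K \<and> (\<forall>\<phi>. K (formula_code \<phi>) \<longleftrightarrow> C \<phi>)"
  shows "\<exists>T. pip n T \<and> decides C (\<le>) T \<Longrightarrow> closed_diagram arith_lang arith_struct C \<in> Pi0 n"
    and "\<exists>T. sigp n T \<and> decides C (<) T \<Longrightarrow> open_diagram arith_lang arith_struct C \<in> Sigma0 n"
proof -
  obtain K where K: "rcp K" "\<And>\<phi>. K (formula_code \<phi>) \<longleftrightarrow> C \<phi>" using assms by blast
  have R: "rcp (\<lambda>z. code_sentence (pfst z) \<and> K (pfst z) \<and> code_rat (psnd z))"
    by (intro rc rcp_comp[OF K(1)])
  {
    assume "\<exists>T. pip n T \<and> decides C (\<le>) T"
    then obtain T where T: "pip n T" "decides C (\<le>) T" by blast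
    show "closed_diagram arith_lang arith_struct C \<in> Pi0 n"
      unfolding diagram_eq(1)[OF K(2) T(2)] pip_def[symmetric]
      by (intro pip_conj R pip_comp[OF T(1)] rc)
  next
    assume "\<exists>T. sigp n T \<and> decides C (<) T"
    then obtain T where T: "sigp n T" "decides C (<) T" by blast
    show "open_diagram arith_lang arith_struct C \<in> Sigma0 n"
      unfolding diagram_eq(2)[OF K(2) T(2)] sigp_def[symmetric]
      by (intro sigp_conj R sigp_comp[OF T(1)] rc)
  }
qed

lemma complete_forI:
  shows "\<lbrakk>A \<in> Sigma0 n; \<And>P. sigp n P \<Longrightarrow> many_one_reducible (Collect P) A\<rbrakk> \<Longrightarrow> complete_for (Sigma0 n) A"
    and "\<lbrakk>A \<in> Pi0 n; \<And>P. pip n P \<Longrightarrow> many_one_reducible (Collect P) A\<rbrakk> \<Longrightarrow> complete_for (Pi0 n) A"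
  unfolding complete_for_def sigp_def pip_def by (metis Collect_mem_eq)+

lemma complete_quantifier_free:
  "complete_for (Pi0 1) (closed_diagram arith_lang arith_struct quantifier_free)"
  "complete_for (Sigma0 1) (open_diagram arith_lang arith_struct quantifier_free)"
proof -
  have K: "\<exists>K. rcp K \<and> (\<forall>\<phi>. K (formula_code \<phi>) \<longleftrightarrow> quantifier_free \<phi>)"
    using rcp_class[of 0] by simp
  show "complete_for (Pi0 1) (closed_diagram arith_lang arith_struct quantifier_free)"
    unfolding One_nat_def
    by (intro complete_forI diagram_in_class[OF K] quantifier_free_decides many_one_reducible_quantifier_free)
  show "complete_for (Sigma0 1) (open_diagram arith_lang arith_struct quantifier_free)"
    unfolding One_nat_def
    by (intro complete_forI diagram_in_class[OF K] quantifier_free_decides many_one_reducible_quantifier_free)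
qed

lemma complete_Pi:
  "complete_for (Pi0 (Suc n)) (closed_diagram arith_lang arith_struct (Pi_formula (Suc n)))"
  "complete_for (Sigma0 (Suc (Suc n))) (open_diagram arith_lang arith_struct (Pi_formula (Suc n)))"
proof -
  note K = conjunct2[OF rcp_class[of "Suc n"]]
  have m: "max 1 (Suc n) = Suc n" by simp
  note d = diagrams_decided[of "Suc n", unfolded m]
  show "complete_for (Pi0 (Suc n)) (closed_diagram arith_lang arith_struct (Pi_formula (Suc n)))"
    using d by (intro complete_forI diagram_in_class[OF K] many_one_reducible_closed_Pi) blast
  show "complete_for (Sigma0 (Suc (Suc n))) (open_diagram arith_lang arith_struct (Pi_formula (Suc n)))"
    using d by (intro complete_forI diagram_in_class[OF K] many_one_reducible_open_Pi) blast
qed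

lemma complete_Sigma:
  "complete_for (Pi0 (Suc (Suc n))) (closed_diagram arith_lang arith_struct (Sigma_formula (Suc n)))"
  "complete_for (Sigma0 (Suc n)) (open_diagram arith_lang arith_struct (Sigma_formula (Suc n)))"
proof -
  note K = conjunct1[OF rcp_class[of "Suc n"]]
  have m: "max 1 (Suc n) = Suc n" by simp
  note d = diagrams_decided[of "Suc n", unfolded m]
  show "complete_for (Pi0 (Suc (Suc n))) (closed_diagram arith_lang arith_struct (Sigma_formula (Suc n)))"
    using d by (intro complete_forI diagram_in_class[OF K] many_one_reducible_closed_Sigma) blast
  show "complete_for (Sigma0 (Suc n)) (open_diagram arith_lang arith_struct (Sigma_formula (Suc n)))"
    using d by (intro complete_forI diagram_in_class[OF K] many_one_reducible_open_Sigma) blast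
qed

theorem theorem5p1:
  shows "\<exists>(L :: metric_lang) (M :: real metric_struct).
    metric_language L \<and> effectively_numbered L \<and> uniformly_computable_moduli L \<and>
    metric_structure L M \<and> computably_presentable L M \<and>
    complete_for (Pi0 1) (closed_diagram L M quantifier_free) \<and>
    complete_for (Sigma0 1) (open_diagram L M quantifier_free) \<and>
    (\<forall>N\<ge>1. complete_for (Pi0 N) (closed_diagram L M (Pi_formula N)) \<and>
            complete_for (Sigma0 (N + 1)) (open_diagram L M (Pi_formula N))) \<and>
    (\<forall>N\<ge>1. complete_for (Pi0 (N + 1)) (closed_diagram L M (Sigma_formula N)) \<and>
            complete_for (Sigma0 N) (open_diagram L M (Sigma_formula N)))"
proof (intro exI conjI allI impI)
  show "computably_presentable arith_lang arith_struct"
    unfolding computably_presentable_def using computable_presentation_arith_struct by blast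
  fix N :: nat
  assume "N \<ge> 1"
  then obtain n where N: "N = Suc n" by (cases N) auto
  show "complete_for (Pi0 N) (closed_diagram arith_lang arith_struct (Pi_formula N))"
    "complete_for (Sigma0 (N + 1)) (open_diagram arith_lang arith_struct (Pi_formula N))"
    "complete_for (Pi0 (N + 1)) (closed_diagram arith_lang arith_struct (Sigma_formula N))"
    "complete_for (Sigma0 N) (open_diagram arith_lang arith_struct (Sigma_formula N))"
    unfolding N Suc_eq_plus1[symmetric] by (rule complete_Pi complete_Sigma)+
qed (rule metric_language_arith_lang effectively_numbered_arith_lang uniformly_computable_moduli_arith_lang
    metric_structure_arith_struct complete_quantifier_free)+

end
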